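(* Let $(\mathcal{C},\otimes,I)$ be a small productive symmetric monoidal category. Then monoidal streams over $\mathcal{C}$ form a feedback monoidal category $(\mathrm{STREAM},\partial,\mathrm{fbk})$, where $\partial$ is the delay functor and $\mathrm{fbk}$ is the feedback operation on streams; that is, $\mathrm{fbk}$ satisfies the axioms (A1)–(A5) (tightening, vanishing, joining, strength, sliding).
   Context: Composition in diagrammatic order $;$, coherence isomorphisms suppressed. $\mathcal{C}^{\mathbb{N}}$: sequences $\mathbf{X}=(X_0,X_1,\dots)$ of objects of $\mathcal{C}$; $\mathbf{X}^+=(X_1,X_2,\dots)$; $M\cdot\mathbf{X}=(M\otimes X_0,X_1,\dots)$. Productive: for objects $P,Q$ write $\langle h\rangle$ for the class of $h\colon P\to W\otimes Q$ in $\int^W\mathcal{C}(P,W\otimes Q)$ (morphisms with varying $W$ modulo the equivalence generated by $h;(r\otimes1_Q)\sim h$). $\mathcal{C}$ is productive if for all $X_0,Y_0$, every class $\alpha\in\int^M\mathcal{C}(X_0,M\otimes Y_0)$ admits $M_0$, $\alpha_0\colon X_0\to M_0\otimes Y_0$ and for each representative $\alpha_i\colon X_0\to M_i\otimes Y_0$ a morphism $s_i\colon M_0\to M_i$ with $\alpha_i=\alpha_0;(s_i\otimes1)$, such that for all $u\colon M_i\otimes A\to U\otimes B$, $v\colon M_j\otimes A\to V\otimes B$, $\langle(\alpha_i\otimes1_A);(u\otimes1_{Y_0})\rangle=\langle(\alpha_j\otimes1_A);(v\otimes1_{Y_0})\rangle$ implies $\langle(s_i\otimes1_A);u\rangle=\langle(s_j\otimes1_A);v\rangle$.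 Monoidal streams: $\mathrm{STREAM}(\mathbf{X},\mathbf{Y})$ is the final coalgebra of $\Phi(Q)(\mathbf{X},\mathbf{Y})=\int^{M}\mathcal{C}(X_0,M\otimes Y_0)\times Q(M\cdot\mathbf{X}^+,\mathbf{Y}^+)$. A stream $f$ consists of a memory $M(f)$, a first action $\mathrm{now}(f)\colon X_0\to M(f)\otimes Y_0$ and a rest $\mathrm{later}(f)\in\mathrm{STREAM}(M(f)\cdot\mathbf{X}^+,\mathbf{Y}^+)$, quotiented coinductively by the equivalence generated by: $f\sim g$ if there is $r\colon M(g)\to M(f)$ with $\mathrm{now}(f)=\mathrm{now}(g);(r\otimes1)$ and $r\cdot\mathrm{later}(f)\sim\mathrm{later}(g)$ ($r\cdot h$ precomposes the first action of $h$ with $r\otimes1$). Sequential composition with memories: for $f\in\mathrm{STREAM}(A\cdot\mathbf{X},\mathbf{Y})$, $g\in\mathrm{STREAM}(B\cdot\mathbf{Y},\mathbf{Z})$, $f^A;g^B$ has memory $M(f)\otimes M(g)$, first action $\mathrm{now}(f)$ followed by $\mathrm{now}(g)$ (with symmetries), rest $\mathrm{later}(f)^{M(f)};\mathrm{later}(g)^{M(g)}$; $f;g:=f^I;g^I$. Identities: memory $I$, first action identity, rest identity. Tensor: memory $M(f)\otimes M(g)$, first action $\mathrm{now}(f)\otimes\mathrm{now}(g)$ up to symmetries, rest $\mathrm{later}(f)\otimes\mathrm{later}(g)$. This gives a symmetric monoidal category $\mathrm{STREAM}$ whose objects are those of $\mathcal{C}^{\mathbb{N}}$. Delay: $\partial(X_0,X_1,\dots)=(I,X_0,X_1,\dots)$;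 on streams, $\partial f$ has memory $I$, first action $\mathrm{id}_I$ and rest $f$. Feedback: for $f\in\mathrm{STREAM}(N\cdot(\partial\mathbf{S}\otimes\mathbf{X}),\mathbf{S}\otimes\mathbf{Y})$, $\mathrm{fbk}(f^N)\in\mathrm{STREAM}(N\cdot\mathbf{X},\mathbf{Y})$ has memory $M(f)\otimes S_0$, first action $\mathrm{now}(f)$, and rest $\mathrm{fbk}(\mathrm{later}(f)^{M(f)\otimes S_0})$ (note $\mathrm{later}(f)\in\mathrm{STREAM}((M(f)\otimes S_0)\cdot(\partial\mathbf{S}^+\otimes\mathbf{X}^+),\mathbf{S}^+\otimes\mathbf{Y}^+)$); $\mathrm{fbk}_{\mathbf{S}}(f):=\mathrm{fbk}(f^I)$. A feedback monoidal category is a symmetric monoidal category with a symmetric strong monoidal endofunctor $F$ and operations $\mathrm{fbk}_S\colon\mathrm{Hom}(FS\otimes X,S\otimes Y)\to\mathrm{Hom}(X,Y)$ such that: (A1) $u;\mathrm{fbk}_S(f);v=\mathrm{fbk}_S((\mathrm{id}_{FS}\otimes u);f;(\mathrm{id}_S\otimes v))$; (A2) $\mathrm{fbk}_I(f)=f$; (A3) $\mathrm{fbk}_T(\mathrm{fbk}_S(f))=\mathrm{fbk}_{S\otimes T}(f)$; (A4) $\mathrm{fbk}_S(f)\otimes g=\mathrm{fbk}_S(f\otimes g)$; (A5) $\mathrm{fbk}_S((Fh\otimes\mathrm{id});f)=\mathrm{fbk}_T(f;(h\otimes\mathrm{id}))$ for $h\colon S\to T$, $f\colon FT\otimes X\to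 S\otimes Y$. *)

theory Defs
  imports Main
begin

section \<open>Symmetric monoidal categories\<close>

text \<open>
  A small category is given by a type of objects (every HOL type is a nonempty set, and a monoidal
  category has at least the unit object) and a set of arrows for each pair of objects. Composition
  is written in diagrammatic order. Coherence isomorphisms are explicit; the monoidal structure is
  not assumed strict.
\<close>

record ('o, 'm) smcat =
  Hom :: "'o \<Rightarrow> 'o \<Rightarrow> 'm set"
  Ide :: "'o \<Rightarrow> 'm"
  Seq :: "'m \<Rightarrow> 'm \<Rightarrow> 'm" (infixl "\<Zcomp>\<index>" 60)
  Unit :: 'o ("\<one>\<index>")
  TensO :: "'o \<Rightarrow> 'o \<Rightarrow> 'o" (infixr "\<otimes>\<index>" 70)
  TensA :: "'m \<Rightarrow> 'm \<Rightarrow> 'm" (infixr "\<otimes>\<^sub>a\<index>" 70)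
  Assoc :: "'o \<Rightarrow> 'o \<Rightarrow> 'o \<Rightarrow> 'm"
  LUnit :: "'o \<Rightarrow> 'm"
  RUnit :: "'o \<Rightarrow> 'm"
  Sym :: "'o \<Rightarrow> 'o \<Rightarrow> 'm"

definition inverse_arrows :: "('o, 'm) smcat \<Rightarrow> 'o \<Rightarrow> 'o \<Rightarrow> 'm \<Rightarrow> 'm \<Rightarrow> bool" where
  "inverse_arrows C X Y f g \<longleftrightarrow>
     f \<in> Hom C X Y \<and> g \<in> Hom C Y X \<and> f \<Zcomp>\<^bsub>C\<^esub> g = Ide C X \<and> g \<Zcomp>\<^bsub>C\<^esub> f = Ide C Y"

definition iso_arrow :: "('o, 'm) smcat \<Rightarrow> 'o \<Rightarrow> 'o \<Rightarrow> 'm \<Rightarrow> bool" where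
  "iso_arrow C X Y f \<longleftrightarrow> (\<exists>g. inverse_arrows C X Y f g)"

definition arr_inv :: "('o, 'm) smcat \<Rightarrow> 'o \<Rightarrow> 'o \<Rightarrow> 'm \<Rightarrow> 'm" where
  "arr_inv C X Y f = (THE g. inverse_arrows C X Y f g)"

locale symmetric_monoidal_category =
  fixes C :: "('o, 'm) smcat" (structure)
  assumes Ide_Hom: "Ide C X \<in> Hom C X X"
    and Seq_Hom: "\<lbrakk>f \<in> Hom C X Y; g \<in> Hom C Y Z\<rbrakk> \<Longrightarrow> f \<Zcomp> g \<in> Hom C X Z"
    and Ide_Seq: "f \<in> Hom C X Y \<Longrightarrow> Ide C X \<Zcomp> f = f"
    and Seq_Ide: "f \<in> Hom C X Y \<Longrightarrow> f \<Zcomp> Ide C Y = f"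
    and Seq_assoc: "\<lbrakk>f \<in> Hom C W X; g \<in> Hom C X Y; h \<in> Hom C Y Z\<rbrakk>
      \<Longrightarrow> (f \<Zcomp> g) \<Zcomp> h = f \<Zcomp> (g \<Zcomp> h)"
    and Tens_Hom: "\<lbrakk>f \<in> Hom C X Y; f' \<in> Hom C X' Y'\<rbrakk>
      \<Longrightarrow> f \<otimes>\<^sub>a f' \<in> Hom C (X \<otimes> X') (Y \<otimes> Y')"
    and Tens_Ide: "Ide C X \<otimes>\<^sub>a Ide C Y = Ide C (X \<otimes> Y)"
    and Tens_Seq: "\<lbrakk>f \<in> Hom C X Y; g \<in> Hom C Y Z; f' \<in> Hom C X' Y'; g' \<in> Hom C Y' Z'\<rbrakk>
      \<Longrightarrow> (f \<Zcomp> g) \<otimes>\<^sub>a (f' \<Zcomp> g') = (f \<otimes>\<^sub>a f') \<Zcomp> (g \<otimes>\<^sub>a g')"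
    and Assoc_iso: "iso_arrow C ((X \<otimes> Y) \<otimes> Z) (X \<otimes> (Y \<otimes> Z)) (Assoc C X Y Z)"
    and LUnit_iso: "iso_arrow C (\<one> \<otimes> X) X (LUnit C X)"
    and RUnit_iso: "iso_arrow C (X \<otimes> \<one>) X (RUnit C X)"
    and Sym_Hom: "Sym C X Y \<in> Hom C (X \<otimes> Y) (Y \<otimes> X)"
    and Assoc_natural: "\<lbrakk>f \<in> Hom C X X'; g \<in> Hom C Y Y'; h \<in> Hom C Z Z'\<rbrakk>
      \<Longrightarrow> ((f \<otimes>\<^sub>a g) \<otimes>\<^sub>a h) \<Zcomp> Assoc C X' Y' Z' = Assoc C X Y Z \<Zcomp> (f \<otimes>\<^sub>a (g \<otimes>\<^sub>a h))"
    and LUnit_natural: "f \<in> Hom C X Y \<Longrightarrow> (Ide C \<one> \<otimes>\<^sub>a f) \<Zcomp> LUnit C Y = LUnit C X \<Zcomp> f"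
    and RUnit_natural: "f \<in> Hom C X Y \<Longrightarrow> (f \<otimes>\<^sub>a Ide C \<one>) \<Zcomp> RUnit C Y = RUnit C X \<Zcomp> f"
    and Sym_natural: "\<lbrakk>f \<in> Hom C X X'; g \<in> Hom C Y Y'\<rbrakk>
      \<Longrightarrow> (f \<otimes>\<^sub>a g) \<Zcomp> Sym C X' Y' = Sym C X Y \<Zcomp> (g \<otimes>\<^sub>a f)"
    and pentagon: "Assoc C (W \<otimes> X) Y Z \<Zcomp> Assoc C W X (Y \<otimes> Z) =
      (Assoc C W X Y \<otimes>\<^sub>a Ide C Z) \<Zcomp> Assoc C W (X \<otimes> Y) Z \<Zcomp> (Ide C W \<otimes>\<^sub>a Assoc C X Y Z)"
    and triangle: "Assoc C X \<one> Y \<Zcomp> (Ide C X \<otimes>\<^sub>a LUnit C Y) = RUnit C X \<otimes>\<^sub>a Ide C Y"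
    and hexagon: "Assoc C X Y Z \<Zcomp> Sym C X (Y \<otimes> Z) \<Zcomp> Assoc C Y Z X =
      (Sym C X Y \<otimes>\<^sub>a Ide C Z) \<Zcomp> Assoc C Y X Z \<Zcomp> (Ide C Y \<otimes>\<^sub>a Sym C X Z)"
    and Sym_Sym: "Sym C X Y \<Zcomp> Sym C Y X = Ide C (X \<otimes> Y)"

locale symmetric_strong_monoidal_endofunctor =
  symmetric_monoidal_category C for C :: "('o, 'm) smcat" (structure) +
  fixes Fo :: "'o \<Rightarrow> 'o" and Fa :: "'m \<Rightarrow> 'm"
    and mu :: "'o \<Rightarrow> 'o \<Rightarrow> 'm" and eps :: 'm
  assumes F_Hom: "f \<in> Hom C X Y \<Longrightarrow> Fa f \<in> Hom C (Fo X) (Fo Y)"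
    and F_Ide: "Fa (Ide C X) = Ide C (Fo X)"
    and F_Seq: "\<lbrakk>f \<in> Hom C X Y; g \<in> Hom C Y Z\<rbrakk> \<Longrightarrow> Fa (f \<Zcomp> g) = Fa f \<Zcomp> Fa g"
    and mu_iso: "iso_arrow C (Fo X \<otimes> Fo Y) (Fo (X \<otimes> Y)) (mu X Y)"
    and eps_iso: "iso_arrow C \<one> (Fo \<one>) eps"
    and mu_natural: "\<lbrakk>f \<in> Hom C X X'; g \<in> Hom C Y Y'\<rbrakk>
      \<Longrightarrow> (Fa f \<otimes>\<^sub>a Fa g) \<Zcomp> mu X' Y' = mu X Y \<Zcomp> Fa (f \<otimes>\<^sub>a g)"
    and mu_Assoc: "(mu X Y \<otimes>\<^sub>a Ide C (Fo Z)) \<Zcomp> mu (X \<otimes> Y) Z \<Zcomp> Fa (Assoc C X Y Z) =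
      Assoc C (Fo X) (Fo Y) (Fo Z) \<Zcomp> (Ide C (Fo X) \<otimes>\<^sub>a mu Y Z) \<Zcomp> mu X (Y \<otimes> Z)"
    and mu_LUnit: "(eps \<otimes>\<^sub>a Ide C (Fo X)) \<Zcomp> mu \<one> X \<Zcomp> Fa (LUnit C X) = LUnit C (Fo X)"
    and mu_RUnit: "(Ide C (Fo X) \<otimes>\<^sub>a eps) \<Zcomp> mu X \<one> \<Zcomp> Fa (RUnit C X) = RUnit C (Fo X)"
    and mu_Sym: "mu X Y \<Zcomp> Fa (Sym C X Y) = Sym C (Fo X) (Fo Y) \<Zcomp> mu Y X"

text \<open>
  Feedback takes the objects \<open>S\<close>, \<open>X\<close>, \<open>Y\<close> explicitly: they are not determined by the domain
  \<open>Fo S \<otimes> X\<close> and the codomain \<open>S \<otimes> Y\<close>.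
\<close>

locale feedback_monoidal_category =
  symmetric_strong_monoidal_endofunctor C Fo Fa mu eps
  for C :: "('o, 'm) smcat" (structure) and Fo Fa mu eps +
  fixes fbk :: "'o \<Rightarrow> 'o \<Rightarrow> 'o \<Rightarrow> 'm \<Rightarrow> 'm"
  assumes fbk_Hom: "f \<in> Hom C (Fo S \<otimes> X) (S \<otimes> Y) \<Longrightarrow> fbk S X Y f \<in> Hom C X Y"
    and tightening:
      "\<lbrakk>u \<in> Hom C X' X; f \<in> Hom C (Fo S \<otimes> X) (S \<otimes> Y); v \<in> Hom C Y Y'\<rbrakk>
       \<Longrightarrow> u \<Zcomp> fbk S X Y f \<Zcomp> v =
           fbk S X' Y' ((Ide C (Fo S) \<otimes>\<^sub>a u) \<Zcomp> f \<Zcomp> (Ide C S \<otimes>\<^sub>a v))"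
    and vanishing:
      "f \<in> Hom C (Fo \<one> \<otimes> X) (\<one> \<otimes> Y)
       \<Longrightarrow> fbk \<one> X Y f =
           arr_inv C (\<one> \<otimes> X) X (LUnit C X) \<Zcomp> (eps \<otimes>\<^sub>a Ide C X) \<Zcomp> f \<Zcomp> LUnit C Y"
    and joining:
      "f \<in> Hom C (Fo S \<otimes> (Fo T \<otimes> X)) (S \<otimes> (T \<otimes> Y))
       \<Longrightarrow> fbk T X Y (fbk S (Fo T \<otimes> X) (T \<otimes> Y) f) =
           fbk (S \<otimes> T) X Y
             ((arr_inv C (Fo S \<otimes> Fo T) (Fo (S \<otimes> T)) (mu S T) \<otimes>\<^sub>a Ide C X)
              \<Zcomp> Assoc C (Fo S) (Fo T) X \<Zcomp> f
              \<Zcomp> arr_inv C ((S \<otimes> T) \<otimes> Y) (S \<otimes> (T \<otimes> Y)) (Assoc C S T Y))"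
    and strength:
      "\<lbrakk>f \<in> Hom C (Fo S \<otimes> X) (S \<otimes> Y); g \<in> Hom C X' Y'\<rbrakk>
       \<Longrightarrow> fbk S X Y f \<otimes>\<^sub>a g =
           fbk S (X \<otimes> X') (Y \<otimes> Y')
             (arr_inv C ((Fo S \<otimes> X) \<otimes> X') (Fo S \<otimes> (X \<otimes> X')) (Assoc C (Fo S) X X')
              \<Zcomp> (f \<otimes>\<^sub>a g) \<Zcomp> Assoc C S Y Y')"
    and sliding:
      "\<lbrakk>h \<in> Hom C S T; f \<in> Hom C (Fo T \<otimes> X) (S \<otimes> Y)\<rbrakk>
       \<Longrightarrow> fbk S X Y ((Fa h \<otimes>\<^sub>a Ide C X) \<Zcomp> f) = fbk T X Y (f \<Zcomp> (h \<otimes>\<^sub>a Ide C Y))"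


section \<open>Structural arrows and productivity\<close>

context
  fixes C :: "('o, 'm) smcat" (structure)
begin

definition AssocI :: "'o \<Rightarrow> 'o \<Rightarrow> 'o \<Rightarrow> 'm" where
  "AssocI X Y Z = arr_inv C ((X \<otimes> Y) \<otimes> Z) (X \<otimes> (Y \<otimes> Z)) (Assoc C X Y Z)"

definition LUnitI :: "'o \<Rightarrow> 'm" where
  "LUnitI X = arr_inv C (\<one> \<otimes> X) X (LUnit C X)"

text \<open>\<open>(X \<otimes> Y) \<otimes> Z \<rightarrow> (X \<otimes> Z) \<otimes> Y\<close>\<close>
definition swap_last :: "'o \<Rightarrow> 'o \<Rightarrow> 'o \<Rightarrow> 'm" where
  "swap_last X Y Z = Assoc C X Y Z \<Zcomp> (Ide C X \<otimes>\<^sub>a Sym C Y Z) \<Zcomp> AssocI X Z Y"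

text \<open>\<open>(A \<otimes> B) \<otimes> (X \<otimes> Y) \<rightarrow> (A \<otimes> X) \<otimes> (B \<otimes> Y)\<close>\<close>
definition swap_mid :: "'o \<Rightarrow> 'o \<Rightarrow> 'o \<Rightarrow> 'o \<Rightarrow> 'm" where
  "swap_mid A B X Y =
     AssocI (A \<otimes> B) X Y \<Zcomp> (swap_last A B X \<otimes>\<^sub>a Ide C Y) \<Zcomp> Assoc C (A \<otimes> X) B Y"

text \<open>
  The coend \<open>\<integral>\<^sup>W C(P, W \<otimes> Q)\<close>: pairs of an object \<open>W\<close> and an arrow \<open>h : P \<rightarrow> W \<otimes> Q\<close>, modulo the
  equivalence generated by sliding arrows out of \<open>W\<close>.
\<close>

definition wires :: "'o \<Rightarrow> 'o \<Rightarrow> ('o \<times> 'm) set" where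
  "wires P Q = {(W, h). h \<in> Hom C P (W \<otimes> Q)}"

definition wire_slide :: "'o \<Rightarrow> 'o \<Rightarrow> 'o \<times> 'm \<Rightarrow> 'o \<times> 'm \<Rightarrow> bool" where
  "wire_slide P Q p q \<longleftrightarrow> p \<in> wires P Q \<and> q \<in> wires P Q \<and>
     (\<exists>r \<in> Hom C (fst q) (fst p). snd p = snd q \<Zcomp> (r \<otimes>\<^sub>a Ide C Q))"

definition wire_class :: "'o \<Rightarrow> 'o \<Rightarrow> 'o \<Rightarrow> 'm \<Rightarrow> ('o \<times> 'm) set" where
  "wire_class P Q W h = {q \<in> wires P Q. equivclp (wire_slide P Q) (W, h) q}"

definition coend :: "'o \<Rightarrow> 'o \<Rightarrow> ('o \<times> 'm) set set" where
  "coend P Q = {wire_class P Q W h | W h. h \<in> Hom C P (W \<otimes> Q)}"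

text \<open>
  The composite \<open>(a \<otimes> 1\<^sub>A) ; (u \<otimes> 1\<^sub>Y)\<close> of \<open>a : X \<rightarrow> M \<otimes> Y\<close> and \<open>u : M \<otimes> A \<rightarrow> U \<otimes> B\<close> with its
  coherence arrows, of type \<open>X \<otimes> A \<rightarrow> U \<otimes> (B \<otimes> Y)\<close>.
\<close>
definition run :: "'o \<Rightarrow> 'o \<Rightarrow> 'm \<Rightarrow> 'o \<Rightarrow> 'o \<Rightarrow> 'o \<Rightarrow> 'm \<Rightarrow> 'm" where
  "run Y M a A U B u =
     (a \<otimes>\<^sub>a Ide C A) \<Zcomp> swap_last M Y A \<Zcomp> (u \<otimes>\<^sub>a Ide C Y) \<Zcomp> Assoc C U B Y"

definition productive :: bool where
  "productive \<longleftrightarrow> (\<forall>X Y. \<forall>\<alpha> \<in> coend X Y. \<exists>M\<^sub>0. \<exists>a\<^sub>0 \<in> Hom C X (M\<^sub>0 \<otimes> Y). \<exists>s.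
     (\<forall>M a. (M, a) \<in> \<alpha> \<longrightarrow>
        s M a \<in> Hom C M\<^sub>0 M \<and> a = a\<^sub>0 \<Zcomp> (s M a \<otimes>\<^sub>a Ide C Y)) \<and>
     (\<forall>M a N b A B U V. \<forall>u \<in> Hom C (M \<otimes> A) (U \<otimes> B). \<forall>v \<in> Hom C (N \<otimes> A) (V \<otimes> B).
        (M, a) \<in> \<alpha> \<longrightarrow> (N, b) \<in> \<alpha> \<longrightarrow>
        wire_class (X \<otimes> A) (B \<otimes> Y) U (run Y M a A U B u) =
        wire_class (X \<otimes> A) (B \<otimes> Y) V (run Y N b A V B v) \<longrightarrow>
        wire_class (M\<^sub>0 \<otimes> A) B U ((s M a \<otimes>\<^sub>a Ide C A) \<Zcomp> u) =
        wire_class (M\<^sub>0 \<otimes> A) B V ((s N b \<otimes>\<^sub>a Ide C A) \<Zcomp> v)))"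


end


section \<open>Monoidal streams\<close>

text \<open>
  Representatives of streams: a memory, a first action and the rest. The objects occurring in the
  type of a stream are kept outside of the representative.
\<close>

codatatype ('o, 'm) istream =
  IStream (Mem: 'o) (Now: 'm) (Later: "('o, 'm) istream")

abbreviation stl :: "(nat \<Rightarrow> 'a) \<Rightarrow> nat \<Rightarrow> 'a" where
  "stl X \<equiv> (\<lambda>n. X (Suc n))"

context
  fixes C :: "('o, 'm) smcat" (structure)
begin

text \<open>\<open>M \<cdot> X\<close>\<close>
definition load :: "'o \<Rightarrow> (nat \<Rightarrow> 'o) \<Rightarrow> nat \<Rightarrow> 'o" where
  "load M X = (\<lambda>n. case n of 0 \<Rightarrow> M \<otimes> X 0 | Suc k \<Rightarrow> X (Suc k))"

coinductive is_istream :: "(nat \<Rightarrow> 'o) \<Rightarrow> (nat \<Rightarrow> 'o) \<Rightarrow> ('o, 'm) istream \<Rightarrow> bool" where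
  "\<lbrakk>Now f \<in> Hom C (X 0) (Mem f \<otimes> Y 0); is_istream (load (Mem f) (stl X)) (stl Y) (Later f)\<rbrakk>
   \<Longrightarrow> is_istream X Y f"

text \<open>Precomposition of the first action\<close>
definition pre :: "'m \<Rightarrow> ('o, 'm) istream \<Rightarrow> ('o, 'm) istream" where
  "pre p h = IStream (Mem h) (p \<Zcomp> Now h) (Later h)"

text \<open>
  One generating step of the equivalence, where the rests are compared by \<open>E\<close>.
\<close>
definition stream_step ::
  "((nat \<Rightarrow> 'o) \<Rightarrow> (nat \<Rightarrow> 'o) \<Rightarrow> ('o, 'm) istream \<Rightarrow> ('o, 'm) istream \<Rightarrow> bool) \<Rightarrow>
   (nat \<Rightarrow> 'o) \<Rightarrow> (nat \<Rightarrow> 'o) \<Rightarrow> ('o, 'm) istream \<Rightarrow> ('o, 'm) istream \<Rightarrow> bool" where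
  "stream_step E X Y f g \<longleftrightarrow> is_istream X Y f \<and> is_istream X Y g \<and>
     (\<exists>r \<in> Hom C (Mem g) (Mem f). Now f = Now g \<Zcomp> (r \<otimes>\<^sub>a Ide C (Y 0)) \<and>
        E (load (Mem g) (stl X)) (stl Y) (pre (r \<otimes>\<^sub>a Ide C (X 1)) (Later f)) (Later g))"

lemma equivclp_stream_step_mono [mono]:
  assumes "E \<le> E'"
  shows "equivclp (stream_step E X Y) f g \<longrightarrow> equivclp (stream_step E' X Y) f g"
proof
  have step: "stream_step E X Y f g \<Longrightarrow> stream_step E' X Y f g" for f g
    using assms unfolding stream_step_def le_fun_def le_bool_def by blast
  have "symclp (stream_step E X Y) \<le> symclp (stream_step E' X Y)"
    by (auto simp: symclp_def intro: step)
  then have "equivclp (stream_step E X Y) \<le> equivclp (stream_step E' X Y)"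
    unfolding equivclp_def by (rule rtranclp_mono)
  moreover assume "equivclp (stream_step E X Y) f g"
  ultimately show "equivclp (stream_step E' X Y) f g" by blast
qed

text \<open>
  The greatest relation \<open>E\<close> contained in the equivalence generated by \<open>stream_step E\<close>. Two
  representatives are identified iff their images agree in the coend
  \<open>\<integral>\<^sup>M C(X\<^sub>0, M \<otimes> Y\<^sub>0) \<times> Q(M \<cdot> X\<^sup>+, Y\<^sup>+)\<close>, where \<open>Q\<close> is this same quotient of representatives; this
  quotient is the final coalgebra.
\<close>
coinductive stream_eq ::
  "(nat \<Rightarrow> 'o) \<Rightarrow> (nat \<Rightarrow> 'o) \<Rightarrow> ('o, 'm) istream \<Rightarrow> ('o, 'm) istream \<Rightarrow> bool" where
  "\<lbrakk>is_istream X Y f; is_istream X Y g; equivclp (stream_step stream_eq X Y) f g\<rbrakk>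
   \<Longrightarrow> stream_eq X Y f g"

definition stream_class ::
  "(nat \<Rightarrow> 'o) \<Rightarrow> (nat \<Rightarrow> 'o) \<Rightarrow> ('o, 'm) istream \<Rightarrow> ('o, 'm) istream set" where
  "stream_class X Y f = {g. stream_eq X Y f g}"

definition streams :: "(nat \<Rightarrow> 'o) \<Rightarrow> (nat \<Rightarrow> 'o) \<Rightarrow> ('o, 'm) istream set set" where
  "streams X Y = {stream_class X Y f | f. is_istream X Y f}"


section \<open>Operations on representatives\<close>

text \<open>
  An operation with memories such as \<open>seq_mem A B X Y Z f g\<close> takes its \<open>i\<close>-th stream argument with
  the \<open>i\<close>-th memory loaded onto its domain; the result has the tensor of the memories loaded.
  Loading the unit \<open>\<one>\<close> is suppressed on paper: it is inserted by \<open>pre (LUnit C _)\<close> and removed by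
  \<open>pre (LUnitI _)\<close>.
\<close>

text \<open>
  A sequence \<open>\<phi> n : X n \<rightarrow> Y n\<close> as a stream with trivial memories, first on \<open>\<one> \<cdot> X\<close>, then on \<open>X\<close>.
\<close>

primcorec pure_mem :: "(nat \<Rightarrow> 'm) \<Rightarrow> ('o, 'm) istream" where
  "Mem (pure_mem \<phi>) = \<one>"
| "Now (pure_mem \<phi>) = Ide C \<one> \<otimes>\<^sub>a \<phi> 0"
| "Later (pure_mem \<phi>) = pure_mem (stl \<phi>)"

definition pure_rep :: "(nat \<Rightarrow> 'o) \<Rightarrow> (nat \<Rightarrow> 'm) \<Rightarrow> ('o, 'm) istream" where
  "pure_rep X \<phi> = pre (LUnitI C (X 0)) (pure_mem \<phi>)"

primcorec seq_mem ::
  "'o \<Rightarrow> 'o \<Rightarrow> (nat \<Rightarrow> 'o) \<Rightarrow> (nat \<Rightarrow> 'o) \<Rightarrow> (nat \<Rightarrow> 'o) \<Rightarrow>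
   ('o, 'm) istream \<Rightarrow> ('o, 'm) istream \<Rightarrow> ('o, 'm) istream" where
  "Mem (seq_mem A B X Y Z f g) = Mem f \<otimes> Mem g"
| "Now (seq_mem A B X Y Z f g) =
     swap_last C A B (X 0) \<Zcomp> (Now f \<otimes>\<^sub>a Ide C B)
     \<Zcomp> Assoc C (Mem f) (Y 0) B \<Zcomp> (Ide C (Mem f) \<otimes>\<^sub>a (Sym C (Y 0) B \<Zcomp> Now g))
     \<Zcomp> AssocI C (Mem f) (Mem g) (Z 0)"
| "Later (seq_mem A B X Y Z f g) =
     seq_mem (Mem f) (Mem g) (stl X) (stl Y) (stl Z) (Later f) (Later g)"

definition seq_rep ::
  "(nat \<Rightarrow> 'o) \<Rightarrow> (nat \<Rightarrow> 'o) \<Rightarrow> (nat \<Rightarrow> 'o) \<Rightarrow>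
   ('o, 'm) istream \<Rightarrow> ('o, 'm) istream \<Rightarrow> ('o, 'm) istream" where
  "seq_rep X Y Z f g =
     pre (LUnitI C (X 0) \<Zcomp> (LUnitI C \<one> \<otimes>\<^sub>a Ide C (X 0)))
       (seq_mem \<one> \<one> X Y Z (pre (LUnit C (X 0)) f) (pre (LUnit C (Y 0)) g))"

primcorec tens_mem ::
  "'o \<Rightarrow> 'o \<Rightarrow> (nat \<Rightarrow> 'o) \<Rightarrow> (nat \<Rightarrow> 'o) \<Rightarrow> (nat \<Rightarrow> 'o) \<Rightarrow> (nat \<Rightarrow> 'o) \<Rightarrow>
   ('o, 'm) istream \<Rightarrow> ('o, 'm) istream \<Rightarrow> ('o, 'm) istream" where
  "Mem (tens_mem A B X Y X' Y' f g) = Mem f \<otimes> Mem g"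
| "Now (tens_mem A B X Y X' Y' f g) =
     swap_mid C A B (X 0) (X' 0) \<Zcomp> (Now f \<otimes>\<^sub>a Now g) \<Zcomp> swap_mid C (Mem f) (Y 0) (Mem g) (Y' 0)"
| "Later (tens_mem A B X Y X' Y' f g) =
     tens_mem (Mem f) (Mem g) (stl X) (stl Y) (stl X') (stl Y') (Later f) (Later g)"

definition tens_rep ::
  "(nat \<Rightarrow> 'o) \<Rightarrow> (nat \<Rightarrow> 'o) \<Rightarrow> (nat \<Rightarrow> 'o) \<Rightarrow> (nat \<Rightarrow> 'o) \<Rightarrow>
   ('o, 'm) istream \<Rightarrow> ('o, 'm) istream \<Rightarrow> ('o, 'm) istream" where
  "tens_rep X Y X' Y' f g =
     IStream (Mem f \<otimes> Mem g)
       ((Now f \<otimes>\<^sub>a Now g) \<Zcomp> swap_mid C (Mem f) (Y 0) (Mem g) (Y' 0))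
       (tens_mem (Mem f) (Mem g) (stl X) (stl Y) (stl X') (stl Y') (Later f) (Later g))"

definition delay_obj :: "(nat \<Rightarrow> 'o) \<Rightarrow> nat \<Rightarrow> 'o" where
  "delay_obj X = (\<lambda>n. case n of 0 \<Rightarrow> \<one> | Suc k \<Rightarrow> X k)"

definition delay_rep :: "(nat \<Rightarrow> 'o) \<Rightarrow> ('o, 'm) istream \<Rightarrow> ('o, 'm) istream" where
  "delay_rep X f = IStream \<one> (LUnitI C \<one>) (pre (LUnit C (X 0)) f)"

text \<open>
  The stream argument is of type \<open>N \<cdot> (\<partial>S \<otimes> X) \<rightarrow> S \<otimes> Y\<close>. Its rest has a domain starting with
  \<open>Mem f \<otimes> (S 0 \<otimes> X 1)\<close>, which is rearranged to the start \<open>(Mem f \<otimes> S 0) \<otimes> (\<one> \<otimes> X 1)\<close> of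
  \<open>(Mem f \<otimes> S 0) \<cdot> (\<partial>S\<^sup>+ \<otimes> X\<^sup>+)\<close>.
\<close>
primcorec fbk_mem ::
  "'o \<Rightarrow> (nat \<Rightarrow> 'o) \<Rightarrow> (nat \<Rightarrow> 'o) \<Rightarrow> (nat \<Rightarrow> 'o) \<Rightarrow> ('o, 'm) istream \<Rightarrow> ('o, 'm) istream" where
  "Mem (fbk_mem N S X Y f) = Mem f \<otimes> S 0"
| "Now (fbk_mem N S X Y f) =
     (Ide C N \<otimes>\<^sub>a LUnitI C (X 0)) \<Zcomp> Now f \<Zcomp> AssocI C (Mem f) (S 0) (Y 0)"
| "Later (fbk_mem N S X Y f) =
     fbk_mem (Mem f \<otimes> S 0) (stl S) (stl X) (stl Y)
       (pre (Assoc C (Mem f) (S 0) (\<one> \<otimes> X 1)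
             \<Zcomp> (Ide C (Mem f) \<otimes>\<^sub>a (Ide C (S 0) \<otimes>\<^sub>a LUnit C (X 1))))
         (Later f))"

definition fbk_rep ::
  "(nat \<Rightarrow> 'o) \<Rightarrow> (nat \<Rightarrow> 'o) \<Rightarrow> (nat \<Rightarrow> 'o) \<Rightarrow> ('o, 'm) istream \<Rightarrow> ('o, 'm) istream" where
  "fbk_rep S X Y f = pre (LUnitI C (X 0)) (fbk_mem \<one> S X Y (pre (LUnit C (\<one> \<otimes> X 0)) f))"

end


section \<open>The category of monoidal streams, delay and feedback\<close>

text \<open>
  An arrow carries its domain and codomain next to its class. An operation on classes is the union
  of the classes of the results over all representatives, which is a class only if the operation
  respects the equivalence.
\<close>

type_synonym ('o, 'm) stream_arrow =
  "(nat \<Rightarrow> 'o) \<times> (nat \<Rightarrow> 'o) \<times> ('o, 'm) istream set"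

context
  fixes C :: "('o, 'm) smcat" (structure)
begin

definition pure_arrow ::
  "(nat \<Rightarrow> 'o) \<Rightarrow> (nat \<Rightarrow> 'o) \<Rightarrow> (nat \<Rightarrow> 'm) \<Rightarrow> ('o, 'm) stream_arrow" where
  "pure_arrow X Y \<phi> = (X, Y, stream_class C X Y (pure_rep C X \<phi>))"

definition STREAM :: "(nat \<Rightarrow> 'o, ('o, 'm) stream_arrow) smcat" where
  "STREAM = \<lparr>
     Hom = (\<lambda>X Y. {(X, Y, c) | c. c \<in> streams C X Y}),
     Ide = (\<lambda>X. pure_arrow X X (\<lambda>n. Ide C (X n))),
     Seq = (\<lambda>(X, Y, c) (Y', Z, d).
       (X, Z, \<Union>f\<in>c. \<Union>g\<in>d. stream_class C X Z (seq_rep C X Y Z f g))),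
     Unit = (\<lambda>n. \<one>),
     TensO = (\<lambda>X Y n. X n \<otimes> Y n),
     TensA = (\<lambda>(X, Y, c) (X', Y', d).
       (\<lambda>n. X n \<otimes> X' n, \<lambda>n. Y n \<otimes> Y' n,
        \<Union>f\<in>c. \<Union>g\<in>d. stream_class C (\<lambda>n. X n \<otimes> X' n) (\<lambda>n. Y n \<otimes> Y' n)
          (tens_rep C X Y X' Y' f g))),
     Assoc = (\<lambda>X Y Z. pure_arrow (\<lambda>n. (X n \<otimes> Y n) \<otimes> Z n) (\<lambda>n. X n \<otimes> (Y n \<otimes> Z n))
       (\<lambda>n. Assoc C (X n) (Y n) (Z n))),
     LUnit = (\<lambda>X. pure_arrow (\<lambda>n. \<one> \<otimes> X n) X (\<lambda>n. LUnit C (X n))),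
     RUnit = (\<lambda>X. pure_arrow (\<lambda>n. X n \<otimes> \<one>) X (\<lambda>n. RUnit C (X n))),
     Sym = (\<lambda>X Y. pure_arrow (\<lambda>n. X n \<otimes> Y n) (\<lambda>n. Y n \<otimes> X n) (\<lambda>n. Sym C (X n) (Y n)))
   \<rparr>"

definition delay :: "('o, 'm) stream_arrow \<Rightarrow> ('o, 'm) stream_arrow" where
  "delay = (\<lambda>(X, Y, c).
     (delay_obj C X, delay_obj C Y,
      \<Union>f\<in>c. stream_class C (delay_obj C X) (delay_obj C Y) (delay_rep C X f)))"

text \<open>The structure arrows \<open>\<partial>X \<otimes> \<partial>Y \<rightarrow> \<partial>(X \<otimes> Y)\<close> and \<open>I \<rightarrow> \<partial>I\<close>.\<close>

definition delay_mu :: "(nat \<Rightarrow> 'o) \<Rightarrow> (nat \<Rightarrow> 'o) \<Rightarrow> ('o, 'm) stream_arrow" where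
  "delay_mu X Y =
     pure_arrow (\<lambda>n. delay_obj C X n \<otimes> delay_obj C Y n) (delay_obj C (\<lambda>n. X n \<otimes> Y n))
       (\<lambda>n. case n of 0 \<Rightarrow> LUnit C \<one> | Suc k \<Rightarrow> Ide C (X k \<otimes> Y k))"

definition delay_eps :: "('o, 'm) stream_arrow" where
  "delay_eps = pure_arrow (\<lambda>n. \<one>) (delay_obj C (\<lambda>n. \<one>)) (\<lambda>n. Ide C \<one>)"

definition feedback ::
  "(nat \<Rightarrow> 'o) \<Rightarrow> (nat \<Rightarrow> 'o) \<Rightarrow> (nat \<Rightarrow> 'o) \<Rightarrow>
   ('o, 'm) stream_arrow \<Rightarrow> ('o, 'm) stream_arrow" where
  "feedback S X Y = (\<lambda>(_, _, c). (X, Y, \<Union>f\<in>c. stream_class C X Y (fbk_rep C S X Y f)))"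

end

end

theory Submission
  imports Defs
begin

text \<open>
  A machine from \<open>X\<close> to \<open>Y\<close> consists of objects \<open>M n\<close>, an initial state \<open>i : \<one> \<rightarrow> M 0\<close> and actions
  \<open>a n : M n \<otimes> X n \<rightarrow> M (n + 1) \<otimes> Y n\<close>. Every stream is the behaviour of a machine, and each operation
  on streams acts on machines time step by time step; for feedback the memory becomes
  \<open>M n \<otimes> (\<partial>S) n\<close>. If arrows \<open>r n\<close> between the memories of two machines commute with the initial
  states and the actions, both machines have the same behaviour, since the \<open>n\<close>-th square is one
  generating step of the equivalence at depth \<open>n\<close>. Hence each axiom follows from a family of
  commuting squares in \<open>C\<close>, where \<open>r n\<close> is structural except for sliding along \<open>h\<close>: there the
  left-hand side stores a value which the right-hand side stores after applying \<open>h\<close> to it, so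
  \<open>r n\<close> runs \<open>h\<close>.

  The squares hold by coherence. Both sides are evaluated symbolically on numbered wires, where
  structural arrows are invisible; they agree when they perform the same actions on the same wires, up
  to exchanging independent actions.
\<close>

text \<open>Three choices shape the proof. A stream has no memory before its first action, while
  each of its rests has one loaded; an explicit memory \<open>M 0\<close> with an initial state
  makes all times alike, so that one square with parameter \<open>n\<close> usually suffices. Delay
  forces some case distinctions at time 0, where its objects are units. Equality of streams allows
  zigzags of sliding arrows at every depth, but a law between machines needs one direction only.
  Zigzags have to be faced when the operations are shown to respect the equivalence, without which a
  union over representatives need not be a class. Finally, the category is not strict, and a square
  contains many associators, unitors and symmetries. Instead of strictifying, coherence is proved in
  the form in which it is used: bracketed objects flatten to products nested to the right,
  permutations of distinct wires depend on their end points only, and an arrow is a list of actions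
  interleaved with such permutations. Beyond equality of lists, one exchange of neighbouring
  independent actions is all that any square requires.\<close>

type_synonym ('o, 'm) typed_arrow = "'o \<times> 'o \<times> 'm"
type_synonym 'o wire = "nat \<times> 'o"

text \<open>
  A bracketing of wires. Wires are told apart by their numbers, so that reordering them needs no
  notation: two patterns with the same wires are related by one canonical symmetry.
\<close>
datatype 'o pattern = PU | PW nat 'o | PT "'o pattern" "'o pattern"

fun leaves :: "'o pattern \<Rightarrow> 'o wire list" where
  "leaves PU = []" | "leaves (PW n X) = [(n, X)]" | "leaves (PT p q) = leaves p @ leaves q"

type_synonym ('o, 'm) action = "'m \<times> 'o pattern \<times> 'o pattern"
text \<open>\<open>M 0\<close> does not occur in the result: it is the memory loaded onto the
  domain. A behaviour is thus a stream on \<open>load C (M 0) X\<close>, and its own first memory is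
  \<open>M 1\<close>.\<close>

primcorec behaviour :: "(nat \<Rightarrow> 'o) \<Rightarrow> (nat \<Rightarrow> 'm) \<Rightarrow> ('o, 'm) istream" where
  "Mem (behaviour M a) = M 1"
| "Now (behaviour M a) = a 0"
| "Later (behaviour M a) = behaviour (stl M) (stl a)"

lemma (in symmetric_monoidal_category) arr_inv_eq:
  assumes "inverse_arrows C X Y f g" shows "arr_inv C X Y f = g"
proof -
  have "h = g" if "inverse_arrows C X Y f h" for h
  proof -
    have "h = h \<Zcomp> (f \<Zcomp> g)" using assms that Seq_Ide unfolding inverse_arrows_def by metis
    also have "\<dots> = (h \<Zcomp> f) \<Zcomp> g" using assms that Seq_assoc unfolding inverse_arrows_def by metis
    also have "\<dots> = g" using assms that Ide_Seq unfolding inverse_arrows_def by metis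
    finally show ?thesis .
  qed
  then show ?thesis unfolding arr_inv_def using assms by blast
qed

lemma (in symmetric_monoidal_category) arr_inv_inverse:
  assumes "iso_arrow C X Y f" shows "inverse_arrows C X Y f (arr_inv C X Y f)"
  using assms arr_inv_eq unfolding iso_arrow_def by metis

context symmetric_monoidal_category
begin

section \<open>Coherence\<close>

text \<open>
  The hom-sets of \<open>C\<close> may overlap. Carrying source and target along makes them computable by rewriting.
\<close>
definition src :: "('o, 'm) typed_arrow \<Rightarrow> 'o" where "src t = fst t"
definition tgt :: "('o, 'm) typed_arrow \<Rightarrow> 'o" where "tgt t = fst (snd t)"
definition arr :: "('o, 'm) typed_arrow \<Rightarrow> 'm" where "arr t = snd (snd t)"
definition valid :: "('o, 'm) typed_arrow \<Rightarrow> bool" where "valid t \<longleftrightarrow> arr t \<in> Hom C (src t) (tgt t)"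
text \<open>Composition is total and does not check \<open>tgt s = src t\<close>. The equations
  below therefore carry validity and matching conditions; rewriting discharges them, because
  \<open>src_tgt\<close> computes all end points.\<close>

definition cmp :: "('o, 'm) typed_arrow \<Rightarrow> ('o, 'm) typed_arrow \<Rightarrow> ('o, 'm) typed_arrow" (infixr "\<bullet>" 60)
  where "s \<bullet> t = (src s, tgt t, arr s \<Zcomp> arr t)"
definition tensor :: "('o, 'm) typed_arrow \<Rightarrow> ('o, 'm) typed_arrow \<Rightarrow> ('o, 'm) typed_arrow" (infixr "\<boxtimes>" 70)
  where "s \<boxtimes> t = (src s \<otimes> src t, tgt s \<otimes> tgt t, arr s \<otimes>\<^sub>a arr t)"
definition idt :: "'o \<Rightarrow> ('o, 'm) typed_arrow" where "idt X = (X, X, Ide C X)"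
definition assoc where "assoc X Y Z = ((X \<otimes> Y) \<otimes> Z, X \<otimes> (Y \<otimes> Z), Assoc C X Y Z)"
definition assocI where "assocI X Y Z = (X \<otimes> (Y \<otimes> Z), (X \<otimes> Y) \<otimes> Z, AssocI C X Y Z)"
definition lunit where "lunit X = (\<one> \<otimes> X, X, LUnit C X)"
definition lunitI where "lunitI X = (X, \<one> \<otimes> X, LUnitI C X)"
definition runit where "runit X = (X \<otimes> \<one>, X, RUnit C X)"
definition RUnitI where "RUnitI X = arr_inv C (X \<otimes> \<one>) X (RUnit C X)"
definition runitI where "runitI X = (X, X \<otimes> \<one>, RUnitI X)"
definition symm where "symm X Y = (X \<otimes> Y, Y \<otimes> X, Sym C X Y)"

lemmas typed_arrow_defs = src_def tgt_def arr_def valid_def cmp_def tensor_def idt_def assoc_def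
  assocI_def lunit_def lunitI_def
  runit_def runitI_def symm_def

section \<open>Typing and cancellation of structural arrows\<close>

lemma AssocI_inverse: "inverse_arrows C ((X \<otimes> Y) \<otimes> Z) (X \<otimes> (Y \<otimes> Z)) (Assoc C X Y Z) (AssocI C X Y Z)"
  unfolding AssocI_def by (rule arr_inv_inverse[OF Assoc_iso])
lemma LUnitI_inverse: "inverse_arrows C (\<one> \<otimes> X) X (LUnit C X) (LUnitI C X)"
  unfolding LUnitI_def by (rule arr_inv_inverse[OF LUnit_iso])
lemma RUnitI_inverse: "inverse_arrows C (X \<otimes> \<one>) X (RUnit C X) (RUnitI X)"
  unfolding RUnitI_def by (rule arr_inv_inverse[OF RUnit_iso])

lemma src_tgt [simp]:
  "src (s \<bullet> t) = src s" "tgt (s \<bullet> t) = tgt t"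
  "src (s \<boxtimes> t) = src s \<otimes> src t" "tgt (s \<boxtimes> t) = tgt s \<otimes> tgt t"
  "src (idt X) = X" "tgt (idt X) = X"
  "src (assoc X Y Z) = (X \<otimes> Y) \<otimes> Z" "tgt (assoc X Y Z) = X \<otimes> (Y \<otimes> Z)"
  "src (assocI X Y Z) = X \<otimes> (Y \<otimes> Z)" "tgt (assocI X Y Z) = (X \<otimes> Y) \<otimes> Z"
  "src (lunit X) = \<one> \<otimes> X" "tgt (lunit X) = X" "src (lunitI X) = X" "tgt (lunitI X) = \<one> \<otimes> X"
  "src (runit X) = X \<otimes> \<one>" "tgt (runit X) = X" "src (runitI X) = X" "tgt (runitI X) = X \<otimes> \<one>"
  "src (symm X Y) = X \<otimes> Y" "tgt (symm X Y) = Y \<otimes> X"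
  by (simp_all add: typed_arrow_defs)

lemma valid_struct [simp]:
  "valid (idt X)" "valid (assoc X Y Z)" "valid (assocI X Y Z)" "valid (lunit X)" "valid (lunitI X)"
  "valid (runit X)" "valid (runitI X)" "valid (symm X Y)"
  using AssocI_inverse LUnitI_inverse RUnitI_inverse
  by (simp_all add: typed_arrow_defs Ide_Hom Sym_Hom inverse_arrows_def)

lemma valid_cmp [simp]: "\<lbrakk>valid s; valid t; tgt s = src t\<rbrakk> \<Longrightarrow> valid (s \<bullet> t)"
  by (auto simp: typed_arrow_defs intro: Seq_Hom)
lemma valid_tensor [simp]: "\<lbrakk>valid s; valid t\<rbrakk> \<Longrightarrow> valid (s \<boxtimes> t)"
  by (auto simp: typed_arrow_defs intro: Tens_Hom)

lemma cmp_assoc [simp]: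
  "\<lbrakk>valid s; valid t; valid u; tgt s = src t; tgt t = src u\<rbrakk> \<Longrightarrow> (s \<bullet> t) \<bullet> u = s \<bullet> (t \<bullet> u)"
  by (auto simp: typed_arrow_defs intro: Seq_assoc)
lemma cmp_idt [simp]: "\<lbrakk>valid s; tgt s = X\<rbrakk> \<Longrightarrow> s \<bullet> idt X = s"
  by (cases s) (auto simp: typed_arrow_defs intro: Seq_Ide)
lemma idt_cmp [simp]: "\<lbrakk>valid s; src s = X\<rbrakk> \<Longrightarrow> idt X \<bullet> s = s"
  by (cases s) (auto simp: typed_arrow_defs intro: Ide_Seq)
lemma tensor_idt [simp]: "idt X \<boxtimes> idt Y = idt (X \<otimes> Y)"
  by (simp add: typed_arrow_defs Tens_Ide)
lemma tensor_cmp: "\<lbrakk>valid s; valid t; valid s'; valid t'; tgt s = src t; tgt s' = src t'\<rbrakk>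
   \<Longrightarrow> (s \<boxtimes> s') \<bullet> (t \<boxtimes> t') = (s \<bullet> t) \<boxtimes> (s' \<bullet> t')"
  using Tens_Seq by (auto simp: typed_arrow_defs)

text \<open>Composites are kept nested to the right, where an equation for
  \<open>s \<bullet> t\<close> finds no instance once a further factor \<open>k\<close> follows.
  This turns it into one that applies in front of \<open>k\<close>.\<close>

lemma cmp_extend:
  assumes "s \<bullet> t = u" "valid s" "valid t" "tgt s = src t" "valid k" "tgt t = src k"
  shows "s \<bullet> t \<bullet> k = u \<bullet> k"
  using assms cmp_assoc by metis

lemma cmp3_extend:
  assumes "s \<bullet> t \<bullet> t' = u" "valid s" "valid t" "tgt s = src t" "valid t'" "tgt t = src t'"
    "valid k" "tgt t' = src k"
  shows "s \<bullet> t \<bullet> t' \<bullet> k = u \<bullet> k"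
  using assms by (metis cmp_assoc src_tgt(1,2) valid_cmp)

text \<open>Interchange is oriented towards fusing neighbouring tensors, also in front of a tail;
  inverse structural arrows inside parallel factors then meet and cancel.\<close>

lemma tensor_cmp' [simp]: "\<lbrakk>valid s; valid t; valid s'; valid t'; tgt s = src t; tgt s' = src t';
   valid k; src k = tgt t \<otimes> tgt t'\<rbrakk>
   \<Longrightarrow> (s \<boxtimes> s') \<bullet> (t \<boxtimes> t') \<bullet> k = ((s \<bullet> t) \<boxtimes> (s' \<bullet> t')) \<bullet> k"
  by (rule cmp_extend[OF tensor_cmp]) auto
declare tensor_cmp [simp]

lemma inv_struct [simp]:
  "assoc X Y Z \<bullet> assocI X Y Z = idt ((X \<otimes> Y) \<otimes> Z)" "assocI X Y Z \<bullet> assoc X Y Z = idt (X \<otimes> (Y \<otimes> Z))"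
  "lunit X \<bullet> lunitI X = idt (\<one> \<otimes> X)" "lunitI X \<bullet> lunit X = idt X"
  "runit X \<bullet> runitI X = idt (X \<otimes> \<one>)" "runitI X \<bullet> runit X = idt X"
  "symm X Y \<bullet> symm Y X = idt (X \<otimes> Y)"
  using AssocI_inverse LUnitI_inverse RUnitI_inverse Sym_Sym
  by (simp_all add: typed_arrow_defs inverse_arrows_def)

lemma inv_struct' [simp]:
  "\<lbrakk>valid k; src k = (X \<otimes> Y) \<otimes> Z\<rbrakk> \<Longrightarrow> assoc X Y Z \<bullet> assocI X Y Z \<bullet> k = k"
  "\<lbrakk>valid k; src k = X \<otimes> (Y \<otimes> Z)\<rbrakk> \<Longrightarrow> assocI X Y Z \<bullet> assoc X Y Z \<bullet> k = k"
  "\<lbrakk>valid k; src k = \<one> \<otimes> X\<rbrakk> \<Longrightarrow> lunit X \<bullet> lunitI X \<bullet> k = k"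
  "\<lbrakk>valid k; src k = X\<rbrakk> \<Longrightarrow> lunitI X \<bullet> lunit X \<bullet> k = k"
  "\<lbrakk>valid k; src k = X \<otimes> \<one>\<rbrakk> \<Longrightarrow> runit X \<bullet> runitI X \<bullet> k = k"
  "\<lbrakk>valid k; src k = X\<rbrakk> \<Longrightarrow> runitI X \<bullet> runit X \<bullet> k = k"
  "\<lbrakk>valid k; src k = X \<otimes> Y\<rbrakk> \<Longrightarrow> symm X Y \<bullet> symm Y X \<bullet> k = k"
  by (simp_all flip: cmp_assoc)

lemma assoc_natural: "\<lbrakk>valid f; valid g; valid h; src f = X; src g = Y; src h = Z; tgt f = X'; tgt g
  = Y'; tgt h = Z'\<rbrakk>
   \<Longrightarrow> ((f \<boxtimes> g) \<boxtimes> h) \<bullet> assoc X' Y' Z' = assoc X Y Z \<bullet> (f \<boxtimes> (g \<boxtimes> h))"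
  using Assoc_natural by (auto simp: typed_arrow_defs)
lemma lunit_natural: "\<lbrakk>valid f; src f = X; tgt f = X'\<rbrakk> \<Longrightarrow> (idt \<one> \<boxtimes> f) \<bullet> lunit X' = lunit X \<bullet> f"
  using LUnit_natural by (auto simp: typed_arrow_defs)
lemma runit_natural: "\<lbrakk>valid f; src f = X; tgt f = X'\<rbrakk> \<Longrightarrow> (f \<boxtimes> idt \<one>) \<bullet> runit X' = runit X \<bullet> f"
  using RUnit_natural by (auto simp: typed_arrow_defs)
lemma symm_natural: "\<lbrakk>valid f; valid g; src f = X; src g = Y; tgt f = X'; tgt g = Y'\<rbrakk>
   \<Longrightarrow> (f \<boxtimes> g) \<bullet> symm X' Y' = symm X Y \<bullet> (g \<boxtimes> f)"
  using Sym_natural by (auto simp: typed_arrow_defs)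

lemma pentagon_tensor: "assoc (W \<otimes> X) Y Z \<bullet> assoc W X (Y \<otimes> Z)
    = (assoc W X Y \<boxtimes> idt Z) \<bullet> assoc W (X \<otimes> Y) Z \<bullet> (idt W \<boxtimes> assoc X Y Z)"
proof -
  have "Assoc C W X Y \<otimes>\<^sub>a Ide C Z \<in> Hom C (((W \<otimes> X) \<otimes> Y) \<otimes> Z) ((W \<otimes> (X \<otimes> Y)) \<otimes> Z)"
    "Assoc C W (X \<otimes> Y) Z \<in> Hom C ((W \<otimes> (X \<otimes> Y)) \<otimes> Z) (W \<otimes> ((X \<otimes> Y) \<otimes> Z))"
    "Ide C W \<otimes>\<^sub>a Assoc C X Y Z \<in> Hom C (W \<otimes> ((X \<otimes> Y) \<otimes> Z)) (W \<otimes> (X \<otimes> (Y \<otimes> Z)))"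
    using AssocI_inverse Ide_Hom Tens_Hom unfolding inverse_arrows_def by auto
  from Seq_assoc[OF this] show ?thesis using pentagon by (simp add: typed_arrow_defs)
qed
lemma triangle_tensor: "assoc X \<one> Y \<bullet> (idt X \<boxtimes> lunit Y) = runit X \<boxtimes> idt Y"
  using triangle by (simp add: typed_arrow_defs)
lemma hexagon_tensor: "assoc X Y Z \<bullet> symm X (Y \<otimes> Z) \<bullet> assoc Y Z X = (symm X Y \<boxtimes> idt Z) \<bullet> assoc Y X Z
  \<bullet> (idt Y \<boxtimes> symm X Z)"
proof -
  have 1: "assoc X Y Z \<bullet> symm X (Y \<otimes> Z) \<bullet> assoc Y Z X = (assoc X Y Z \<bullet> symm X (Y \<otimes> Z))
    \<bullet> assoc Y Z X" by simp
  have 2: "(symm X Y \<boxtimes> idt Z) \<bullet> assoc Y X Z \<bullet> (idt Y \<boxtimes> symm X Z)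
    = ((symm X Y \<boxtimes> idt Z) \<bullet> assoc Y X Z) \<bullet> (idt Y \<boxtimes> symm X Z)"
    by simp
  show ?thesis unfolding 1 2 using hexagon by (simp add: typed_arrow_defs)
qed

section \<open>Unit coherence and the adjacent transposition\<close>

lemma cancel_left:
  assumes "s \<bullet> f = s \<bullet> g" "valid s" "valid s'" "s' \<bullet> s = idt (src f)"
    "valid f" "valid g" "src f = tgt s" "src g = tgt s" "tgt s' = src s"
  shows "f = g"
  using assms by (metis cmp_assoc idt_cmp)
lemma cancel_right:
  assumes "f \<bullet> s = g \<bullet> s" "valid s" "valid s'" "s \<bullet> s' = idt (tgt f)"
    "valid f" "valid g" "tgt f = src s" "tgt g = src s" "tgt s = src s'"
  shows "f = g"
  using assms by (metis cmp_assoc cmp_idt)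

text \<open>By naturality of the left unitor, \<open>f\<close> is the conjugate of
  \<open>idt \<one> \<boxtimes> f\<close> by unitors. The unit laws below are first obtained under a
  tensor with the unit, which this lemma and its mirror image remove.\<close>

lemma idt_one_tensor_inj:
  assumes "idt \<one> \<boxtimes> f = idt \<one> \<boxtimes> g" "valid f" "valid g" "src f = src g" "tgt f = tgt g"
  shows "f = g"
proof -
  have "f = lunitI (src f) \<bullet> (idt \<one> \<boxtimes> f) \<bullet> lunit (tgt f)" using assms(2) by (simp add: lunit_natural)
  also have "\<dots> = g" unfolding assms using assms(3) by (simp add: lunit_natural)
  finally show ?thesis .
qed
lemma tensor_idt_one_inj:
  assumes "f \<boxtimes> idt \<one> = g \<boxtimes> idt \<one>" "valid f" "valid g" "src f = src g" "tgt f = tgt g"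
  shows "f = g"
proof -
  have "f = runitI (src f) \<bullet> (f \<boxtimes> idt \<one>) \<bullet> runit (tgt f)" using assms(2) by (simp add: runit_natural)
  also have "\<dots> = g" unfolding assms using assms(3) by (simp add: runit_natural)
  finally show ?thesis .
qed

text \<open>Kelly's argument. The triangle axiom speaks only of a unit in the middle. With a further
  unit in front, the pentagon and two triangles make both sides comparable, and all other factors
  are isomorphisms that cancel.\<close>

lemma assoc_lunit: "assoc \<one> X Y \<bullet> lunit (X \<otimes> Y) = lunit X \<boxtimes> idt Y"
proof -
  \<comment> \<open>An abbreviation that marks the auxiliary factor in front, as opposed to the unit
    which \<open>lunit\<close> removes.\<close>
  let ?W = "\<one>"
  have "(assoc ?W \<one> X \<boxtimes> idt Y) \<bullet> assoc ?W (\<one> \<otimes> X) Y \<bullet> (idt ?W \<boxtimes> (assoc \<one> X Y \<bullet> lunit (X \<otimes> Y)))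
    = ((assoc ?W \<one> X \<boxtimes> idt Y) \<bullet> assoc ?W (\<one> \<otimes> X) Y \<bullet> (idt ?W \<boxtimes> assoc \<one> X Y)) \<bullet> (idt ?W \<boxtimes> lunit (X \<otimes> Y))"
    by simp
  also have "\<dots> = assoc (?W \<otimes> \<one>) X Y \<bullet> (runit ?W \<boxtimes> (idt X \<boxtimes> idt Y))"
    unfolding pentagon_tensor[symmetric] by (simp add: triangle_tensor)
  also have "\<dots> = ((runit ?W \<boxtimes> idt X) \<boxtimes> idt Y) \<bullet> assoc ?W X Y"
    by (subst assoc_natural[of "runit ?W" "idt X" "idt Y", symmetric]) auto
  also have "\<dots> = (assoc ?W \<one> X \<boxtimes> idt Y) \<bullet> ((idt ?W \<boxtimes> lunit X) \<boxtimes> idt Y) \<bullet> assoc ?W X Y"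
    by (simp add: triangle_tensor)
  also have "((idt ?W \<boxtimes> lunit X) \<boxtimes> idt Y) \<bullet> assoc ?W X Y = assoc ?W (\<one> \<otimes> X) Y
    \<bullet> (idt ?W \<boxtimes> (lunit X \<boxtimes> idt Y))"
    by (simp add: assoc_natural)
  finally have "(assoc ?W \<one> X \<boxtimes> idt Y) \<bullet> assoc ?W (\<one> \<otimes> X) Y \<bullet> (idt ?W \<boxtimes> (assoc \<one> X Y \<bullet> lunit (X \<otimes> Y)))
     = (assoc ?W \<one> X \<boxtimes> idt Y) \<bullet> assoc ?W (\<one> \<otimes> X) Y \<bullet> (idt ?W \<boxtimes> (lunit X \<boxtimes> idt Y))" .
  then have "assoc ?W (\<one> \<otimes> X) Y \<bullet> (idt ?W \<boxtimes> (assoc \<one> X Y \<bullet> lunit (X \<otimes> Y))) = assoc ?W (\<one> \<otimes> X) Y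
    \<bullet> (idt ?W \<boxtimes> (lunit X \<boxtimes> idt Y))"
    by (rule cancel_left[where s'="assocI ?W \<one> X \<boxtimes> idt Y"]) auto
  then have "idt ?W \<boxtimes> (assoc \<one> X Y \<bullet> lunit (X \<otimes> Y)) = idt ?W \<boxtimes> (lunit X \<boxtimes> idt Y)"
    by (rule cancel_left[where s'="assocI ?W (\<one> \<otimes> X) Y"]) auto
  then show ?thesis by (rule idt_one_tensor_inj) auto
qed

text \<open>With a second unit \<open>?Z\<close> on the right, the hexagon for \<open>X\<close>,
  \<open>\<one>\<close>, \<open>?Z\<close> combines with \<open>assoc_lunit\<close> and the
  triangle. The common factor \<open>symm X ?Z\<close> is cancelled, then the auxiliary
  unit.\<close>

lemma symm_lunit: "symm X \<one> \<bullet> lunit X = runit X"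
proof -
  let ?Z = "\<one>"
  have "((symm X \<one> \<bullet> lunit X) \<boxtimes> idt ?Z) \<bullet> symm X ?Z = (symm X \<one> \<boxtimes> idt ?Z) \<bullet> (lunit X \<boxtimes> idt ?Z) \<bullet> symm X ?Z"
    by simp
  also have "\<dots> = (symm X \<one> \<boxtimes> idt ?Z) \<bullet> assoc \<one> X ?Z \<bullet> lunit (X \<otimes> ?Z) \<bullet> symm X ?Z"
    by (simp flip: assoc_lunit)
  also have "lunit (X \<otimes> ?Z) \<bullet> symm X ?Z = (idt \<one> \<boxtimes> symm X ?Z) \<bullet> lunit (?Z \<otimes> X)"
    by (simp add: lunit_natural)
  also have "(symm X \<one> \<boxtimes> idt ?Z) \<bullet> assoc \<one> X ?Z \<bullet> (idt \<one> \<boxtimes> symm X ?Z) \<bullet> lunit (?Z \<otimes> X)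
     = ((symm X \<one> \<boxtimes> idt ?Z) \<bullet> assoc \<one> X ?Z \<bullet> (idt \<one> \<boxtimes> symm X ?Z)) \<bullet> lunit (?Z \<otimes> X)" by simp
  also have "\<dots> = assoc X \<one> ?Z \<bullet> symm X (\<one> \<otimes> ?Z) \<bullet> (lunit ?Z \<boxtimes> idt X)"
    unfolding hexagon_tensor[symmetric] by (simp add: assoc_lunit)
  also have "symm X (\<one> \<otimes> ?Z) \<bullet> (lunit ?Z \<boxtimes> idt X) = (idt X \<boxtimes> lunit ?Z) \<bullet> symm X ?Z"
    by (simp add: symm_natural)
  also have "assoc X \<one> ?Z \<bullet> (idt X \<boxtimes> lunit ?Z) \<bullet> symm X ?Z = (runit X \<boxtimes> idt ?Z) \<bullet> symm X ?Z"
    by (subst cmp_extend[OF triangle_tensor]) auto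
  finally have "((symm X \<one> \<bullet> lunit X) \<boxtimes> idt ?Z) = runit X \<boxtimes> idt ?Z"
    by (rule cancel_right[where s'="symm ?Z X"]) auto
  then show ?thesis by (rule tensor_idt_one_inj) auto
qed

text \<open>The transposition of the first two factors of a product nested to the right. In this
  form symmetries act on the normal form \<open>wires_obj\<close> without further
  rebracketing.\<close>

definition tau where "tau X Y Z = assocI X Y Z \<bullet> (symm X Y \<boxtimes> idt Z) \<bullet> assoc Y X Z"

lemma tau_simps [simp]: "valid (tau X Y Z)" "src (tau X Y Z) = X \<otimes> (Y \<otimes> Z)" "tgt (tau X Y Z) = Y \<otimes> (X \<otimes> Z)"
  by (auto simp: tau_def)

lemma tau_tau [simp]: "tau X Y Z \<bullet> tau Y X Z = idt (X \<otimes> (Y \<otimes> Z))"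
  by (simp add: tau_def)
lemma tau_tau' [simp]: "\<lbrakk>valid k; src k = X \<otimes> (Y \<otimes> Z)\<rbrakk> \<Longrightarrow> tau X Y Z \<bullet> tau Y X Z \<bullet> k = k"
  by (subst cmp_extend[OF tau_tau]) auto

lemma assocI_natural: "\<lbrakk>valid f; valid g; valid h; src f = X; src g = Y; src h = Z; tgt f
  = X'; tgt g = Y'; tgt h = Z'\<rbrakk>
   \<Longrightarrow> (f \<boxtimes> (g \<boxtimes> h)) \<bullet> assocI X' Y' Z' = assocI X Y Z \<bullet> ((f \<boxtimes> g) \<boxtimes> h)"
  by (rule cancel_left[where s="assoc X Y Z" and s'="assocI X Y Z"], subst
    cmp_extend[OF assoc_natural[symmetric]]) auto

lemma tau_natural:
  assumes [simp]: "valid f" "valid g" "valid h" "src f = X" "src g = Y" "src h = Z" "tgt f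
    = X'" "tgt g = Y'" "tgt h = Z'"
  shows "(f \<boxtimes> (g \<boxtimes> h)) \<bullet> tau X' Y' Z' = tau X Y Z \<bullet> (g \<boxtimes> (f \<boxtimes> h))"
proof -
  have "(f \<boxtimes> (g \<boxtimes> h)) \<bullet> tau X' Y' Z' = assocI X Y Z \<bullet> ((f \<boxtimes> g) \<boxtimes> h) \<bullet> (symm X' Y' \<boxtimes> idt Z')
    \<bullet> assoc Y' X' Z'"
    unfolding tau_def by (subst cmp_extend[OF assocI_natural]) auto
  also have "((f \<boxtimes> g) \<boxtimes> h) \<bullet> (symm X' Y' \<boxtimes> idt Z') \<bullet> assoc Y' X' Z' = (symm X Y \<boxtimes> idt Z)
    \<bullet> ((g \<boxtimes> f) \<boxtimes> h) \<bullet> assoc Y' X' Z'"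
    by (simp add: symm_natural)
  also have "((g \<boxtimes> f) \<boxtimes> h) \<bullet> assoc Y' X' Z' = assoc Y X Z \<bullet> (g \<boxtimes> (f \<boxtimes> h))"
    by (simp add: assoc_natural)
  finally show ?thesis by (simp add: tau_def)
qed

text \<open>Passing a unit is invisible; this is the base case of moving a wire past a
  block.\<close>

lemma tau_unit: "tau X \<one> W \<bullet> lunit (X \<otimes> W) = idt X \<boxtimes> lunit W"
proof -
  have "tau X \<one> W \<bullet> lunit (X \<otimes> W) = assocI X \<one> W \<bullet> (runit X \<boxtimes> idt W)"
    by (simp add: tau_def assoc_lunit symm_lunit)
  then show ?thesis by (simp flip: triangle_tensor)
qed

lemma unit_tau: "tau \<one> X W \<bullet> (idt X \<boxtimes> lunit W) = lunit (X \<otimes> W)"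
  by (simp flip: tau_unit)

text \<open>The hexagon in terms of \<open>tau\<close>: a block is passed by passing its two halves
  in turn. Besides the hexagon only pentagons and naturality are involved, to move brackets around
  the spectator \<open>W\<close>.\<close>

lemma tau_tensor: "tau X (Y \<otimes> Z) W \<bullet> assoc Y Z (X \<otimes> W)
    = (idt X \<boxtimes> assoc Y Z W) \<bullet> tau X Y (Z \<otimes> W) \<bullet> (idt Y \<boxtimes> tau X Z W)"
proof -
  have pent1: "assocI X (Y \<otimes> Z) W \<bullet> (assocI X Y Z \<boxtimes> idt W) \<bullet> assoc (X \<otimes> Y) Z W
    = (idt X \<boxtimes> assoc Y Z W) \<bullet> assocI X Y (Z \<otimes> W)"
  proof -
    have "assoc (X \<otimes> Y) Z W = ((assoc X Y Z \<boxtimes> idt W) \<bullet> assoc X (Y \<otimes> Z) W \<bullet> (idt X \<boxtimes> assoc Y Z W))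
      \<bullet> assocI X Y (Z \<otimes> W)"
      by (subst pentagon_tensor[symmetric]) auto
    then show ?thesis by simp
  qed
  have pent2: "(assoc Y X Z \<boxtimes> idt W) \<bullet> assoc Y (X \<otimes> Z) W = assoc (Y \<otimes> X) Z W \<bullet> assoc Y X (Z \<otimes> W)
    \<bullet> (idt Y \<boxtimes> assocI X Z W)"
    by (subst cmp_extend[OF pentagon_tensor]) auto
  have hex1: "symm X (Y \<otimes> Z) \<bullet> assoc Y Z X = assocI X Y Z \<bullet> (symm X Y \<boxtimes> idt Z) \<bullet> assoc Y X Z
    \<bullet> (idt Y \<boxtimes> symm X Z)"
    by (subst hexagon_tensor[symmetric]) auto
  have "tau X (Y \<otimes> Z) W \<bullet> assoc Y Z (X \<otimes> W) = assocI X (Y \<otimes> Z) W \<bullet> (symm X (Y \<otimes> Z) \<boxtimes> idt W)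
    \<bullet> assoc (Y \<otimes> Z) X W \<bullet> assoc Y Z (X \<otimes> W)"
    by (simp add: tau_def)
  also have "\<dots> = assocI X (Y \<otimes> Z) W \<bullet> ((symm X (Y \<otimes> Z) \<bullet> assoc Y Z X) \<boxtimes> idt W) \<bullet> assoc Y (Z \<otimes> X) W
    \<bullet> (idt Y \<boxtimes> assoc Z X W)"
    by (subst pentagon_tensor) auto
  also have "\<dots> = assocI X (Y \<otimes> Z) W \<bullet> (assocI X Y Z \<boxtimes> idt W) \<bullet> ((symm X Y \<boxtimes> idt Z) \<boxtimes> idt W)
    \<bullet> (assoc Y X Z \<boxtimes> idt W)
      \<bullet> ((idt Y \<boxtimes> symm X Z) \<boxtimes> idt W) \<bullet> assoc Y (Z \<otimes> X) W \<bullet> (idt Y \<boxtimes> assoc Z X W)"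
    unfolding hex1 by simp
  also have "((idt Y \<boxtimes> symm X Z) \<boxtimes> idt W) \<bullet> assoc Y (Z \<otimes> X) W \<bullet> (idt Y \<boxtimes> assoc Z X W)
      = assoc Y (X \<otimes> Z) W \<bullet> (idt Y \<boxtimes> (symm X Z \<boxtimes> idt W)) \<bullet> (idt Y \<boxtimes> assoc Z X W)"
    by (subst cmp_extend[OF assoc_natural]) auto
  also have "(assoc Y X Z \<boxtimes> idt W) \<bullet> assoc Y (X \<otimes> Z) W \<bullet> (idt Y \<boxtimes> (symm X Z \<boxtimes> idt W))
    \<bullet> (idt Y \<boxtimes> assoc Z X W)
     = assoc (Y \<otimes> X) Z W \<bullet> assoc Y X (Z \<otimes> W) \<bullet> (idt Y \<boxtimes> tau X Z W)"
    by (subst cmp_extend[OF pent2]) (auto simp: tau_def)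
  also have "((symm X Y \<boxtimes> idt Z) \<boxtimes> idt W) \<bullet> assoc (Y \<otimes> X) Z W \<bullet> assoc Y X (Z \<otimes> W) \<bullet> (idt Y \<boxtimes> tau X Z W)
    = assoc (X \<otimes> Y) Z W \<bullet> (symm X Y \<boxtimes> (idt Z \<boxtimes> idt W)) \<bullet> assoc Y X (Z \<otimes> W) \<bullet> (idt Y \<boxtimes> tau X Z W)"
    by (subst cmp_extend[OF assoc_natural]) auto
  also have "assocI X (Y \<otimes> Z) W \<bullet> (assocI X Y Z \<boxtimes> idt W) \<bullet> assoc (X \<otimes> Y) Z W
    \<bullet> (symm X Y \<boxtimes> (idt Z \<boxtimes> idt W)) \<bullet> assoc Y X (Z \<otimes> W) \<bullet> (idt Y \<boxtimes> tau X Z W)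
     = (idt X \<boxtimes> assoc Y Z W) \<bullet> assocI X Y (Z \<otimes> W) \<bullet> (symm X Y \<boxtimes> (idt Z \<boxtimes> idt W)) \<bullet> assoc Y X (Z \<otimes> W)
       \<bullet> (idt Y \<boxtimes> tau X Z W)"
    by (subst cmp3_extend[OF pent1]) auto
  finally show ?thesis by (simp add: tau_def)
qed

text \<open>The hexagon for a block on the left. It follows from \<open>tau_tensor\<close> by
  inversion, because \<open>tau\<close> is inverse to itself with exchanged arguments.\<close>

lemma tensor_tau: "assoc X Y (Z \<otimes> W) \<bullet> (idt X \<boxtimes> tau Y Z W) \<bullet> tau X Z (Y \<otimes> W)
    = tau (X \<otimes> Y) Z W \<bullet> (idt Z \<boxtimes> assoc X Y W)"
proof -
  have "assoc X Y (Z \<otimes> W) = tau (X \<otimes> Y) Z W \<bullet> tau Z (X \<otimes> Y) W \<bullet> assoc X Y (Z \<otimes> W)" by simp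
  also have "\<dots> = tau (X \<otimes> Y) Z W \<bullet> (idt Z \<boxtimes> assoc X Y W) \<bullet> tau Z X (Y \<otimes> W) \<bullet> (idt X \<boxtimes> tau Z Y W)"
    by (subst tau_tensor) auto
  finally have "assoc X Y (Z \<otimes> W) \<bullet> (idt X \<boxtimes> tau Y Z W) \<bullet> tau X Z (Y \<otimes> W) =
     (tau (X \<otimes> Y) Z W \<bullet> (idt Z \<boxtimes> assoc X Y W) \<bullet> tau Z X (Y \<otimes> W) \<bullet> (idt X \<boxtimes> tau Z Y W)) \<bullet>
       (idt X \<boxtimes> tau Y Z W) \<bullet> tau X Z (Y \<otimes> W)"
    by simp
  then show ?thesis by simp
qed

text \<open>\<open>X\<close> passes the block of \<open>Y\<close> and \<open>Z\<close> as a whole by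
  \<open>tau_tensor\<close>, and by naturality \<open>Y\<close> and \<open>Z\<close> may be
  exchanged before or after that.\<close>

lemma yang_baxter: "tau X Y (Z \<otimes> W) \<bullet> (idt Y \<boxtimes> tau X Z W) \<bullet> tau Y Z (X \<otimes> W)
    = (idt X \<boxtimes> tau Y Z W) \<bullet> tau X Z (Y \<otimes> W) \<bullet> (idt Z \<boxtimes> tau X Y W)"
proof -
  have "tau X Y (Z \<otimes> W) \<bullet> (idt Y \<boxtimes> tau X Z W) = (idt X \<boxtimes> assocI Y Z W) \<bullet> tau X (Y \<otimes> Z) W
    \<bullet> assoc Y Z (X \<otimes> W)"
    by (subst tau_tensor) simp
  then have "tau X Y (Z \<otimes> W) \<bullet> (idt Y \<boxtimes> tau X Z W) \<bullet> tau Y Z (X \<otimes> W)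
    = (idt X \<boxtimes> assocI Y Z W) \<bullet> tau X (Y \<otimes> Z) W \<bullet> (symm Y Z \<boxtimes> (idt X \<boxtimes> idt W)) \<bullet> assoc Z Y (X \<otimes> W)"
    by (subst cmp_extend) (auto simp: tau_def[of Y Z])
  also have "tau X (Y \<otimes> Z) W \<bullet> (symm Y Z \<boxtimes> (idt X \<boxtimes> idt W)) \<bullet> assoc Z Y (X \<otimes> W)
     = (idt X \<boxtimes> (symm Y Z \<boxtimes> idt W)) \<bullet> tau X (Z \<otimes> Y) W \<bullet> assoc Z Y (X \<otimes> W)"
    by (subst cmp_extend[OF tau_natural[symmetric]]) auto
  also have "\<dots> = (idt X \<boxtimes> (symm Y Z \<boxtimes> idt W)) \<bullet> (idt X \<boxtimes> assoc Z Y W) \<bullet> tau X Z (Y \<otimes> W)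
    \<bullet> (idt Z \<boxtimes> tau X Y W)"
    by (simp add: tau_tensor)
  finally show ?thesis by (simp add: tau_def[of Y Z])
qed

section \<open>Permutations of wires\<close>
text \<open>Closing the product with a unit gives even the last wire the shape of a head followed by
  a rest, so that \<open>tau\<close> and the recursions below need no special case for it.\<close>

fun wires_obj :: "'o wire list \<Rightarrow> 'o" where
  "wires_obj [] = \<one>"
| "wires_obj (w # ws) = snd w \<otimes> wires_obj ws"

fun whisker :: "'o wire list \<Rightarrow> ('o, 'm) typed_arrow \<Rightarrow> ('o, 'm) typed_arrow" where
  "whisker [] k = k"
| "whisker (w # ws) k = idt (snd w) \<boxtimes> whisker ws k"

fun pull :: "'o wire \<Rightarrow> 'o wire list \<Rightarrow> ('o, 'm) typed_arrow" where
  "pull x [] = idt \<one>"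
| "pull x (y # ys) = (if x = y then idt (wires_obj (y # ys))
     else (idt (snd y) \<boxtimes> pull x ys) \<bullet> tau (snd y) (snd x) (wires_obj (remove1 x ys)))"

text \<open>A selection sort towards the second list. As wires are distinct, the two lists determine
  the arrow and no bijection has to be named.\<close>

fun perm :: "'o wire list \<Rightarrow> 'o wire list \<Rightarrow> ('o, 'm) typed_arrow" where
  "perm ws [] = idt \<one>"
| "perm ws (x # xs) = pull x ws \<bullet> (idt (snd x) \<boxtimes> perm (remove1 x ws) xs)"

definition same_wires :: "'o wire list \<Rightarrow> 'o wire list \<Rightarrow> bool" where
  "same_wires l l' \<longleftrightarrow> distinct l \<and> distinct l' \<and> set l = set l'"

lemma pull_simps [simp]:
  "x \<in> set l \<Longrightarrow> valid (pull x l)"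
  "x \<in> set l \<Longrightarrow> src (pull x l) = wires_obj l"
  "x \<in> set l \<Longrightarrow> tgt (pull x l) = snd x \<otimes> wires_obj (remove1 x l)"
proof -
  have "x \<in> set l \<Longrightarrow> valid (pull x l) \<and> src (pull x l) = wires_obj l \<and> tgt (pull x l)
    = snd x \<otimes> wires_obj (remove1 x l)"
    by (induction l) auto
  then show "x \<in> set l \<Longrightarrow> valid (pull x l)"
  "x \<in> set l \<Longrightarrow> src (pull x l) = wires_obj l"
  "x \<in> set l \<Longrightarrow> tgt (pull x l) = snd x \<otimes> wires_obj (remove1 x l)" by auto
qed

lemma same_wires_remove1: "same_wires l l' \<Longrightarrow> same_wires (remove1 x l) (remove1 x l')"
  by (auto simp: same_wires_def)
lemma same_wires_Cons: "same_wires l (x # xs) \<Longrightarrow> x \<in> set l \<and> same_wires (remove1 x l) xs"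
  by (auto simp: same_wires_def)
lemma same_wires_Nil: "same_wires l [] \<longleftrightarrow> l = []"
  by (auto simp: same_wires_def)
lemma same_wires_refl: "distinct l \<Longrightarrow> same_wires l l" by (simp add: same_wires_def)
lemma same_wires_sym: "same_wires l l' \<Longrightarrow> same_wires l' l" by (simp add: same_wires_def)
lemma same_wires_trans: "same_wires l l' \<Longrightarrow> same_wires l' l'' \<Longrightarrow> same_wires l l''"
  by (simp add: same_wires_def)

lemma perm_simps [simp]:
  assumes "same_wires l l'"
  shows "valid (perm l l')" "src (perm l l') = wires_obj l" "tgt (perm l l') = wires_obj l'"
proof -
  have "same_wires l l' \<Longrightarrow> valid (perm l l') \<and> src (perm l l') = wires_obj l \<and> tgt (perm l l')
    = wires_obj l'"
    by (induction l' arbitrary: l) (auto simp: same_wires_Nil dest!: same_wires_Cons)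
  then show "valid (perm l l')" "src (perm l l') = wires_obj l" "tgt (perm l l') = wires_obj l'"
    using assms by auto
qed

lemma whisker_simps [simp]:
  "valid k \<Longrightarrow> valid (whisker l k)"
  "src k = wires_obj r \<Longrightarrow> src (whisker l k) = wires_obj (l @ r)"
  "tgt k = wires_obj r \<Longrightarrow> tgt (whisker l k) = wires_obj (l @ r)"
  by (induction l) auto
lemma whisker_append: "whisker (l @ m) k = whisker l (whisker m k)"
  by (induction l) auto
lemma perm_refl [simp]: "distinct l \<Longrightarrow> perm l l = idt (wires_obj l)"
  by (induction l) auto

text \<open>
  The Yang--Baxter equation, lifted to lists; it makes the permutations below independent of
  the order in which wires are moved.
\<close>
lemma pull_pull:
  assumes "distinct l" "x \<noteq> y" "x \<in> set l" "y \<in> set l"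
  shows "pull y l \<bullet> (idt (snd y) \<boxtimes> pull x (remove1 y l))
    \<bullet> tau (snd y) (snd x) (wires_obj (remove1 x (remove1 y l)))
    = pull x l \<bullet> (idt (snd x) \<boxtimes> pull y (remove1 x l))"
  using assms
proof (induction l)
  case (Cons z zs)
  consider "z = y" | "z = x" | "z \<noteq> x" "z \<noteq> y" by blast
  then show ?case
  proof cases
    case 3
    let ?X = "snd x" let ?Y = "snd y" let ?Z = "snd z"
    have [simp]: "x \<in> set zs" "y \<in> set zs" "distinct zs" "x \<noteq> y" "y \<noteq> x" "z \<noteq> x" "z \<noteq> y" "x \<noteq> z"
      "y \<noteq> z" using Cons.prems 3 by auto
    let ?R = "wires_obj (remove1 x (remove1 y zs))"
    have [simp]: "remove1 y (remove1 x zs) = remove1 x (remove1 y zs)" by (rule remove1_commute)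
    have IH: "pull y zs \<bullet> (idt ?Y \<boxtimes> pull x (remove1 y zs)) \<bullet> tau ?Y ?X ?R = pull x zs
      \<bullet> (idt ?X \<boxtimes> pull y (remove1 x zs))"
      by (rule Cons.IH) auto
    have 1: "tau ?Z ?Y (wires_obj (remove1 y zs)) \<bullet> (idt ?Y \<boxtimes> (idt ?Z \<boxtimes> pull x (remove1 y zs)))
        = (idt ?Z \<boxtimes> (idt ?Y \<boxtimes> pull x (remove1 y zs))) \<bullet> tau ?Z ?Y (?X \<otimes> ?R)"
      by (rule tau_natural[symmetric]) auto
    have 2: "tau ?Z ?X (wires_obj (remove1 x zs)) \<bullet> (idt ?X \<boxtimes> (idt ?Z \<boxtimes> pull y (remove1 x zs)))
        = (idt ?Z \<boxtimes> (idt ?X \<boxtimes> pull y (remove1 x zs))) \<bullet> tau ?Z ?X (?Y \<otimes> ?R)"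
      by (rule tau_natural[symmetric]) auto
    have "pull y (z # zs) \<bullet> (idt ?Y \<boxtimes> pull x (remove1 y (z # zs)))
      \<bullet> tau ?Y ?X (wires_obj (remove1 x (remove1 y (z # zs))))
      = (idt ?Z \<boxtimes> pull y zs) \<bullet> tau ?Z ?Y (wires_obj (remove1 y zs)) \<bullet>
        (idt ?Y \<boxtimes> (idt ?Z \<boxtimes> pull x (remove1 y zs)))
          \<bullet> (idt ?Y \<boxtimes> tau ?Z ?X ?R) \<bullet> tau ?Y ?X (?Z \<otimes> ?R)" by simp
    also have "\<dots> = (idt ?Z \<boxtimes> pull y zs) \<bullet> (idt ?Z \<boxtimes> (idt ?Y \<boxtimes> pull x (remove1 y zs))) \<bullet> tau ?Z ?Y (?X \<otimes> ?R)
          \<bullet> (idt ?Y \<boxtimes> tau ?Z ?X ?R) \<bullet> tau ?Y ?X (?Z \<otimes> ?R)"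
      by (subst cmp_extend[OF 1]) auto
    also have "\<dots> = (idt ?Z \<boxtimes> (pull y zs \<bullet> (idt ?Y \<boxtimes> pull x (remove1 y zs)) \<bullet> tau ?Y ?X ?R))
      \<bullet> tau ?Z ?X (?Y \<otimes> ?R) \<bullet> (idt ?X \<boxtimes> tau ?Z ?Y ?R)"
      by (subst yang_baxter) auto
    also have "\<dots> = (idt ?Z \<boxtimes> pull x zs) \<bullet> (idt ?Z \<boxtimes> (idt ?X \<boxtimes> pull y (remove1 x zs)))
      \<bullet> tau ?Z ?X (?Y \<otimes> ?R) \<bullet> (idt ?X \<boxtimes> tau ?Z ?Y ?R)"
      unfolding IH by simp
    also have "\<dots> = (idt ?Z \<boxtimes> pull x zs) \<bullet> tau ?Z ?X (wires_obj (remove1 x zs))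
      \<bullet> (idt ?X \<boxtimes> (idt ?Z \<boxtimes> pull y (remove1 x zs))) \<bullet> (idt ?X \<boxtimes> tau ?Z ?Y ?R)"
      by (subst cmp_extend[OF 2]) auto
    finally show ?thesis by simp
  qed (use Cons.prems in auto)
qed simp

text \<open>If the target list starts with a wire \<open>y\<close> other than \<open>x\<close>, both
  wires get pulled, and \<open>pull_pull\<close> exchanges the order of the two pulls; the shorter
  permutation is covered by induction.\<close>

lemma perm_pull:
  assumes "same_wires l l'" "x \<in> set l"
  shows "perm l l' \<bullet> pull x l' = pull x l \<bullet> (idt (snd x) \<boxtimes> perm (remove1 x l) (remove1 x l'))"
  using assms
proof (induction l' arbitrary: l)
  case (Cons y ys)
  show ?case
  proof (cases "y = x")
    case False
    have same_wires: "same_wires (remove1 y l) ys" "y \<in> set l" using Cons.prems(1) same_wires_Cons by auto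
    have x: "x \<in> set (remove1 y l)" "x \<in> set ys" "distinct l" using Cons.prems False
      by (auto simp: same_wires_def)
    have pm': "same_wires (remove1 x (remove1 y l)) (remove1 x ys)" using same_wires
      same_wires_remove1 by auto
    have c: "remove1 y (remove1 x l) = remove1 x (remove1 y l)" by (rule remove1_commute)
    have y: "y \<in> set (remove1 x l)" "x \<in> set l" using same_wires False Cons.prems by auto
    note [simp] = same_wires x pm' c y
    let ?X = "snd x" let ?Y = "snd y" let ?R = "wires_obj (remove1 x (remove1 y l))"
    have "perm l (y # ys) \<bullet> pull x (y # ys) = pull y l
      \<bullet> (idt ?Y \<boxtimes> (perm (remove1 y l) ys \<bullet> pull x ys)) \<bullet> tau ?Y ?X (wires_obj (remove1 x ys))"
      using False by simp
    also have "\<dots> = pull y l \<bullet> (idt ?Y \<boxtimes> pull x (remove1 y l))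
      \<bullet> (idt ?Y \<boxtimes> (idt ?X \<boxtimes> perm (remove1 x (remove1 y l)) (remove1 x ys))) \<bullet> tau ?Y ?X
        (wires_obj (remove1 x ys))"
      using False by (simp add: Cons.IH[OF same_wires(1) x(1)])
    also have "(idt ?Y \<boxtimes> (idt ?X \<boxtimes> perm (remove1 x (remove1 y l)) (remove1 x ys)))
      \<bullet> tau ?Y ?X (wires_obj (remove1 x ys))
        = tau ?Y ?X ?R \<bullet> (idt ?X \<boxtimes> (idt ?Y \<boxtimes> perm (remove1 x (remove1 y l)) (remove1 x ys)))"
      by (rule tau_natural) auto
    also have "pull y l \<bullet> (idt ?Y \<boxtimes> pull x (remove1 y l)) \<bullet> tau ?Y ?X ?R
      \<bullet> (idt ?X \<boxtimes> (idt ?Y \<boxtimes> perm (remove1 x (remove1 y l)) (remove1 x ys)))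
       = (pull x l \<bullet> (idt ?X \<boxtimes> pull y (remove1 x l))) \<bullet>
         (idt ?X \<boxtimes> (idt ?Y \<boxtimes> perm (remove1 x (remove1 y l)) (remove1 x ys)))"
      by (subst cmp3_extend[OF pull_pull]) (use False in auto)
    finally show ?thesis using False by simp
  next
    case True
    then show ?thesis using same_wires_Cons[OF Cons.prems(1)] by auto
  qed
qed (simp add: same_wires_Nil)

text \<open>Composites of permutations depend on their end points only, which is coherence for
  symmetries of distinct wires. \<open>perm_pull\<close> carries the first wire of the last list
  through the first factor.\<close>

lemma perm_perm:
  assumes "same_wires l l'" "same_wires l' l''"
  shows "perm l l' \<bullet> perm l' l'' = perm l l''"
  using assms
proof (induction l'' arbitrary: l l')
  case (Cons x xs)
  have x: "x \<in> set l'" "same_wires (remove1 x l') xs" "x \<in> set l" "same_wires (remove1 x l) (remove1 x l')"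
    "same_wires (remove1 x l) xs"
    using Cons.prems same_wires_Cons same_wires_remove1 same_wires_trans by (auto simp: same_wires_def)
  note [simp] = x Cons.prems
  have "perm l l' \<bullet> perm l' (x # xs) = (perm l l' \<bullet> pull x l')
    \<bullet> (idt (snd x) \<boxtimes> perm (remove1 x l') xs)" by simp
  also have "\<dots> = pull x l \<bullet> (idt (snd x) \<boxtimes> perm (remove1 x l) xs)"
    by (subst perm_pull) (auto simp: Cons.IH)
  finally show ?case by simp
qed (simp add: same_wires_Nil)

lemma perm_perm' [simp]:
  assumes "same_wires l l'" "same_wires l' l''" "valid k" "src k = wires_obj l''"
  shows "perm l l' \<bullet> perm l' l'' \<bullet> k = perm l l'' \<bullet> k"
  by (subst cmp_extend[OF perm_perm]) (use assms in auto)
declare perm_perm [simp]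

text \<open>Along a common prefix, selection always finds its wire at the head, where
  \<open>pull\<close> is an identity.\<close>

lemma perm_whisker: "perm (l @ r) (l @ r') = whisker l (perm r r')" if "same_wires r r'"
  "set l \<inter> set r = {}" "distinct l"
  using that
proof (induction l)
  case (Cons x l)
  then have "same_wires (l @ r) (l @ r')" by (auto simp: same_wires_def)
  then show ?case using Cons by auto
qed simp

section \<open>Flattening bracketed patterns to lists of wires\<close>

fun obj :: "'o pattern \<Rightarrow> 'o" where
  "obj PU = \<one>" | "obj (PW n X) = X" | "obj (PT p q) = obj p \<otimes> obj q"

text \<open>The rest \<open>r\<close> is an accumulator: a pattern is flattened together with what
  follows it, which yields \<open>wires_obj (leaves p @ r)\<close> directly and avoids arrows for
  the concatenation of lists.\<close>

fun flat :: "'o pattern \<Rightarrow> 'o wire list \<Rightarrow> ('o, 'm) typed_arrow" where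
  "flat PU r = lunit (wires_obj r)"
| "flat (PW n X) r = idt (X \<otimes> wires_obj r)"
| "flat (PT p q) r = assoc (obj p) (obj q) (wires_obj r) \<bullet> (idt (obj p) \<boxtimes> flat q r) \<bullet> flat p (leaves q @ r)"

fun unflat :: "'o pattern \<Rightarrow> 'o wire list \<Rightarrow> ('o, 'm) typed_arrow" where
  "unflat PU r = lunitI (wires_obj r)"
| "unflat (PW n X) r = idt (X \<otimes> wires_obj r)"
| "unflat (PT p q) r = unflat p (leaves q @ r) \<bullet> (idt (obj p) \<boxtimes> unflat q r)
  \<bullet> assocI (obj p) (obj q) (wires_obj r)"

lemma flat_simps [simp]:
  "valid (flat p r)" "src (flat p r) = obj p \<otimes> wires_obj r" "tgt (flat p r) = wires_obj (leaves p @ r)"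
proof -
  have "valid (flat p r) \<and> src (flat p r) = obj p \<otimes> wires_obj r \<and> tgt (flat p r) = wires_obj (leaves p @ r)"
    by (induction p arbitrary: r) auto
  then show "valid (flat p r)" "src (flat p r) = obj p \<otimes> wires_obj r" "tgt (flat p r)
    = wires_obj (leaves p @ r)" by auto
qed

lemma unflat_simps [simp]:
  "valid (unflat p r)" "tgt (unflat p r) = obj p \<otimes> wires_obj r" "src (unflat p r)
    = wires_obj (leaves p @ r)"
proof -
  have "valid (unflat p r) \<and> tgt (unflat p r) = obj p \<otimes> wires_obj r \<and> src (unflat p r)
    = wires_obj (leaves p @ r)"
    by (induction p arbitrary: r) auto
  then show "valid (unflat p r)" "tgt (unflat p r) = obj p \<otimes> wires_obj r" "src (unflat p r)
    = wires_obj (leaves p @ r)" by auto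
qed

lemma flat_unflat [simp]: "flat p r \<bullet> unflat p r = idt (obj p \<otimes> wires_obj r)"
proof (induction p arbitrary: r)
  case (PT p q)
  have "(idt (obj p) \<boxtimes> flat q r) \<bullet> flat p (leaves q @ r) \<bullet> unflat p (leaves q @ r)
    \<bullet> (idt (obj p) \<boxtimes> unflat q r) \<bullet> assocI (obj p) (obj q) (wires_obj r)
    = (idt (obj p) \<boxtimes> flat q r) \<bullet> (idt (obj p) \<boxtimes> unflat q r) \<bullet> assocI (obj p) (obj q) (wires_obj r)"
    by (subst cmp_extend[OF PT(1)]) auto
  also have "\<dots> = assocI (obj p) (obj q) (wires_obj r)" by (simp add: PT(2))
  finally show ?case by simp
qed auto

lemma unflat_flat [simp]: "unflat p r \<bullet> flat p r = idt (wires_obj (leaves p @ r))"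
proof (induction p arbitrary: r)
  case (PT p q)
  have "unflat (PT p q) r \<bullet> flat (PT p q) r = unflat p (leaves q @ r) \<bullet> (idt (obj p) \<boxtimes> unflat q r)
    \<bullet> (idt (obj p) \<boxtimes> flat q r) \<bullet> flat p (leaves q @ r)"
    by simp
  also have "\<dots> = unflat p (leaves q @ r) \<bullet> flat p (leaves q @ r)" by (simp add: PT(2))
  finally show ?case using PT by simp
qed auto

lemma flat_unflat' [simp]: "\<lbrakk>valid k; src k = obj p \<otimes> wires_obj r\<rbrakk> \<Longrightarrow> flat p r \<bullet> unflat p r \<bullet> k = k"
  by (subst cmp_extend[OF flat_unflat]) auto
lemma unflat_flat' [simp]: "\<lbrakk>valid k; src k = wires_obj (leaves p @ r)\<rbrakk> \<Longrightarrow> unflat p r \<bullet> flat p r \<bullet> k = k"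
  by (subst cmp_extend[OF unflat_flat]) auto

lemma flat_whisker:
  assumes [simp]: "valid k" "src k = wires_obj r" "tgt k = wires_obj r'"
  shows "(idt (obj p) \<boxtimes> k) \<bullet> flat p r' = flat p r \<bullet> whisker (leaves p) k"
  using assms
proof (induction p arbitrary: k r r')
  case PU then show ?case by (simp add: lunit_natural)
next
  case (PT p q)
  note [simp] = PT.prems
  have "(idt (obj (PT p q)) \<boxtimes> k) \<bullet> flat (PT p q) r' = ((idt (obj p) \<boxtimes> idt (obj q)) \<boxtimes> k)
    \<bullet> assoc (obj p) (obj q) (wires_obj r') \<bullet> (idt (obj p) \<boxtimes> flat q r') \<bullet> flat p (leaves q @ r')"
    by simp
  also have "\<dots> = assoc (obj p) (obj q) (wires_obj r)
    \<bullet> (idt (obj p) \<boxtimes> ((idt (obj q) \<boxtimes> k) \<bullet> flat q r')) \<bullet> flat p (leaves q @ r')"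
    by (subst cmp_extend[OF assoc_natural]) auto
  also have "\<dots> = assoc (obj p) (obj q) (wires_obj r) \<bullet> (idt (obj p) \<boxtimes> flat q r)
    \<bullet> (idt (obj p) \<boxtimes> whisker (leaves q) k) \<bullet> flat p (leaves q @ r')"
    by (subst PT.IH(2)) auto
  also have "(idt (obj p) \<boxtimes> whisker (leaves q) k) \<bullet> flat p (leaves q @ r') = flat p (leaves q @ r)
    \<bullet> whisker (leaves p) (whisker (leaves q) k)"
    by (rule PT.IH(1)) auto
  finally show ?case by (simp add: whisker_append)
qed simp

lemma unflat_whisker:
  assumes [simp]: "valid k" "src k = wires_obj r" "tgt k = wires_obj r'"
  shows "whisker (leaves p) k \<bullet> unflat p r' = unflat p r \<bullet> (idt (obj p) \<boxtimes> k)"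
proof -
  have "whisker (leaves p) k \<bullet> unflat p r' = unflat p r \<bullet> (flat p r \<bullet> whisker (leaves p) k)
    \<bullet> unflat p r'" by simp
  then show ?thesis by (simp flip: flat_whisker)
qed

text \<open>An arrow between bracketed objects, seen on wire lists: it acts on an initial segment.
  Other positions are reached by permutations, see \<open>whisker_framed\<close>.\<close>

definition framed :: "('o, 'm) typed_arrow \<Rightarrow> 'o pattern \<Rightarrow> 'o pattern \<Rightarrow> 'o wire list \<Rightarrow> ('o, 'm)
  typed_arrow" where
  "framed e p q r = unflat p r \<bullet> (e \<boxtimes> idt (wires_obj r)) \<bullet> flat q r"

definition typed :: "('o, 'm) typed_arrow \<Rightarrow> 'o pattern \<Rightarrow> 'o pattern \<Rightarrow> bool" where
  "typed e p q \<longleftrightarrow> valid e \<and> src e = obj p \<and> tgt e = obj q"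

lemma framed_simps [simp]:
  assumes "typed e p q"
  shows "valid (framed e p q r)" "src (framed e p q r) = wires_obj (leaves p @ r)"
    "tgt (framed e p q r) = wires_obj (leaves q @ r)"
  using assms by (auto simp: framed_def typed_def)

text \<open>The interchange law for the front segment and the wires behind it. It is what lets
  independent actions change places.\<close>

lemma framed_whisker:
  assumes "typed e p q" and k [simp]: "valid k" "src k = wires_obj r" "tgt k = wires_obj r'"
  shows "framed e p q r \<bullet> whisker (leaves q) k = whisker (leaves p) k \<bullet> framed e p q r'"
proof -
  have [simp]: "valid e" "src e = obj p" "tgt e = obj q" using assms(1) by (auto simp: typed_def)
  have "framed e p q r \<bullet> whisker (leaves q) k = unflat p r \<bullet> (e \<boxtimes> idt (wires_obj r)) \<bullet> flat q r
    \<bullet> whisker (leaves q) k"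
    by (simp add: framed_def)
  also have "\<dots> = (unflat p r \<bullet> (idt (obj p) \<boxtimes> k)) \<bullet> (e \<boxtimes> idt (wires_obj r')) \<bullet> flat q r'"
    by (simp flip: flat_whisker)
  also have "\<dots> = whisker (leaves p) k \<bullet> framed e p q r'"
    by (simp add: framed_def flip: unflat_whisker)
  finally show ?thesis .
qed

text \<open>The hexagon, iterated along \<open>q\<close>.\<close>
lemma block_wire:
  assumes "distinct ((n, X) # leaves q @ r)"
  shows "tau X (obj q) (wires_obj r) \<bullet> flat q ((n, X) # r)
    = (idt X \<boxtimes> flat q r) \<bullet> perm ((n, X) # leaves q @ r) (leaves q @ (n, X) # r)"
  using assms
proof (induction q arbitrary: r)
  case PU then show ?case by (simp add: tau_unit)
next
  case (PW m Y)
  then show ?case by (auto)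
next
  case (PT q1 q2)
  let ?x = "(n, X)" let ?Y1 = "obj q1" let ?Y2 = "obj q2" let ?R = "wires_obj r"
  have d: "distinct (?x # leaves q2 @ r)" "distinct (?x # leaves q1 @ leaves q2 @ r)" using PT.prems by auto
  have pms: "same_wires (?x # leaves q2 @ r) (leaves q2 @ ?x # r)"
     "same_wires (?x # leaves q1 @ leaves q2 @ r) (leaves q1 @ ?x # leaves q2 @ r)"
     "same_wires (leaves q1 @ ?x # leaves q2 @ r) (leaves q1 @ leaves q2 @ ?x # r)"
     "same_wires (?x # leaves q1 @ leaves q2 @ r) (leaves q1 @ leaves q2 @ ?x # r)"
    using PT.prems by (auto simp: same_wires_def)
  note [simp] = pms(1) pms(2) pms(3) pms(4)
  let ?P2 = "perm (?x # leaves q2 @ r) (leaves q2 @ ?x # r)"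
  have IH1: "tau X ?Y1 (wires_obj (leaves q2 @ r)) \<bullet> flat q1 (?x # leaves q2 @ r)
    = (idt X \<boxtimes> flat q1 (leaves q2 @ r)) \<bullet> perm (?x # leaves q1 @ leaves q2 @ r)
      (leaves q1 @ ?x # leaves q2 @ r)"
    by (rule PT.IH(1)[OF d(2)])
  have IH2: "tau X ?Y2 ?R \<bullet> flat q2 (?x # r) = (idt X \<boxtimes> flat q2 r) \<bullet> ?P2"
    by (rule PT.IH(2)[OF d(1)])
  have w: "perm (leaves q1 @ ?x # leaves q2 @ r) (leaves q1 @ leaves q2 @ ?x # r) = whisker (leaves q1) ?P2"
    using perm_whisker[of "?x # leaves q2 @ r" "leaves q2 @ ?x # r" "leaves q1"] PT.prems by auto
  have wv: "valid (whisker (leaves q1) ?P2)" "src (whisker (leaves q1) ?P2)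
    = wires_obj (leaves q1 @ ?x # leaves q2 @ r)"
    "tgt (whisker (leaves q1) ?P2) = wires_obj (leaves q1 @ leaves q2 @ ?x # r)"
    using pms(3) by (simp_all flip: w)
  note [simp] = wv
  have fw: "(idt ?Y1 \<boxtimes> ?P2) \<bullet> flat q1 (leaves q2 @ ?x # r) = flat q1 (?x # leaves q2 @ r)
    \<bullet> whisker (leaves q1) ?P2"
    by (rule flat_whisker) auto
  have "tau X (obj (PT q1 q2)) ?R \<bullet> flat (PT q1 q2) (?x # r) =
    (tau X (?Y1 \<otimes> ?Y2) ?R \<bullet> assoc ?Y1 ?Y2 (X \<otimes> ?R)) \<bullet> (idt ?Y1 \<boxtimes> flat q2 (?x # r)) \<bullet> flat q1
      (leaves q2 @ ?x # r)" by simp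
  also have "\<dots> = (idt X \<boxtimes> assoc ?Y1 ?Y2 ?R) \<bullet> tau X ?Y1 (?Y2 \<otimes> ?R)
    \<bullet> (idt ?Y1 \<boxtimes> (tau X ?Y2 ?R \<bullet> flat q2 (?x # r))) \<bullet> flat q1 (leaves q2 @ ?x # r)"
    by (subst tau_tensor) auto
  also have "\<dots> = (idt X \<boxtimes> assoc ?Y1 ?Y2 ?R)
    \<bullet> (tau X ?Y1 (?Y2 \<otimes> ?R) \<bullet> (idt ?Y1 \<boxtimes> (idt X \<boxtimes> flat q2 r))) \<bullet> (idt ?Y1 \<boxtimes> ?P2) \<bullet> flat q1
      (leaves q2 @ ?x # r)"
    unfolding IH2 by simp
  also have "\<dots> = (idt X \<boxtimes> assoc ?Y1 ?Y2 ?R)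
    \<bullet> ((idt X \<boxtimes> (idt ?Y1 \<boxtimes> flat q2 r)) \<bullet> tau X ?Y1 (wires_obj (leaves q2 @ r))) \<bullet> flat q1
      (?x # leaves q2 @ r) \<bullet> whisker (leaves q1) ?P2"
    by (subst tau_natural[symmetric]) (auto simp: fw)
  also have "\<dots> = (idt X \<boxtimes> (assoc ?Y1 ?Y2 ?R \<bullet> (idt ?Y1 \<boxtimes> flat q2 r)))
    \<bullet> (tau X ?Y1 (wires_obj (leaves q2 @ r)) \<bullet> flat q1 (?x # leaves q2 @ r)) \<bullet> whisker (leaves q1) ?P2"
    by simp
  also have "\<dots> = (idt X \<boxtimes> (assoc ?Y1 ?Y2 ?R \<bullet> (idt ?Y1 \<boxtimes> flat q2 r)))
    \<bullet> (idt X \<boxtimes> flat q1 (leaves q2 @ r)) \<bullet> perm (?x # leaves q1 @ leaves q2 @ r)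
      (leaves q1 @ leaves q2 @ ?x # r)"
    unfolding IH1 w[symmetric] by (simp del: perm.simps)
  finally show ?case by (simp del: perm.simps)
qed

text \<open>Soundness of the evaluation rule for \<open>Sym\<close>: under flattening, the symmetry
  of two blocks becomes the canonical permutation of their wires. By induction on \<open>p\<close>,
  with \<open>block_wire\<close> for a single wire and \<open>tensor_tau\<close> to split a
  pair.\<close>

lemma block:
  assumes "distinct (leaves p @ leaves q @ r)"
  shows "tau (obj p) (obj q) (wires_obj r) \<bullet> (idt (obj q) \<boxtimes> flat p r) \<bullet> flat q (leaves p @ r)
    = (idt (obj p) \<boxtimes> flat q r) \<bullet> flat p (leaves q @ r) \<bullet> perm (leaves p @ leaves q @ r)
      (leaves q @ leaves p @ r)"
  using assms
proof (induction p arbitrary: r)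
  case PU
  have "tau \<one> (obj q) (wires_obj r) \<bullet> (idt (obj q) \<boxtimes> lunit (wires_obj r)) \<bullet> flat q r
    = lunit (obj q \<otimes> wires_obj r) \<bullet> flat q r"
    by (subst cmp_extend[OF unit_tau]) auto
  then show ?case using PU by (simp add: lunit_natural)
next
  case (PW n X)
  then have "same_wires ((n, X) # leaves q @ r) (leaves q @ (n, X) # r)" by (auto simp: same_wires_def)
  then show ?case using block_wire PW by (simp del: perm.simps)
next
  case (PT p1 p2)
  let ?X1 = "obj p1" let ?X2 = "obj p2" let ?Y = "obj q" let ?R = "wires_obj r"
  have pms: "same_wires (leaves p2 @ leaves q @ r) (leaves q @ leaves p2 @ r)"
    "same_wires (leaves p1 @ leaves q @ leaves p2 @ r) (leaves q @ leaves p1 @ leaves p2 @ r)"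
    "same_wires (leaves p1 @ leaves p2 @ leaves q @ r) (leaves p1 @ leaves q @ leaves p2 @ r)"
      "same_wires (leaves p1 @ leaves p2 @ leaves q @ r) (leaves q @ leaves p1 @ leaves p2 @ r)"
    using PT.prems by (auto simp: same_wires_def)
  note [simp] = pms(1) pms(2) pms(3) pms(4)
  have d: "distinct (leaves p2 @ leaves q @ r)" "distinct (leaves p1 @ leaves q @ leaves p2 @ r)"
    using PT.prems by auto
  let ?P2 = "perm (leaves p2 @ leaves q @ r) (leaves q @ leaves p2 @ r)"
  have IH1: "tau ?X1 ?Y (wires_obj (leaves p2 @ r)) \<bullet> (idt ?Y \<boxtimes> flat p1 (leaves p2 @ r))
    \<bullet> flat q (leaves p1 @ leaves p2 @ r)
     = (idt ?X1 \<boxtimes> flat q (leaves p2 @ r)) \<bullet> flat p1 (leaves q @ leaves p2 @ r) \<bullet> perm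
       (leaves p1 @ leaves q @ leaves p2 @ r) (leaves q @ leaves p1 @ leaves p2 @ r)"
    by (rule PT.IH(1)[OF d(2)])
  have IH2: "tau ?X2 ?Y ?R \<bullet> (idt ?Y \<boxtimes> flat p2 r) \<bullet> flat q (leaves p2 @ r)
    = (idt ?X2 \<boxtimes> flat q r) \<bullet> flat p2 (leaves q @ r) \<bullet> ?P2"
    by (rule PT.IH(2)[OF d(1)])
  have w: "perm (leaves p1 @ leaves p2 @ leaves q @ r) (leaves p1 @ leaves q @ leaves p2 @ r)
    = whisker (leaves p1) ?P2"
    by (rule perm_whisker) (use PT.prems in auto)
  have fw: "(idt ?X1 \<boxtimes> ?P2) \<bullet> flat p1 (leaves q @ leaves p2 @ r)
    = flat p1 (leaves p2 @ leaves q @ r) \<bullet> perm (leaves p1 @ leaves p2 @ leaves q @ r)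
      (leaves p1 @ leaves q @ leaves p2 @ r)"
    unfolding w by (rule flat_whisker) auto
  have tn: "tau ?X1 ?Y (?X2 \<otimes> ?R) \<bullet> (idt ?Y \<boxtimes> (idt ?X1 \<boxtimes> flat p2 r))
    = (idt ?X1 \<boxtimes> (idt ?Y \<boxtimes> flat p2 r)) \<bullet> tau ?X1 ?Y (wires_obj (leaves p2 @ r))"
    by (rule tau_natural[symmetric]) auto
  have "tau (?X1 \<otimes> ?X2) ?Y ?R \<bullet> (idt ?Y \<boxtimes> flat (PT p1 p2) r) \<bullet> flat q (leaves (PT p1 p2) @ r)
     = (tau (?X1 \<otimes> ?X2) ?Y ?R \<bullet> (idt ?Y \<boxtimes> assoc ?X1 ?X2 ?R)) \<bullet> (idt ?Y \<boxtimes> (idt ?X1 \<boxtimes> flat p2 r)) \<bullet>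
       (idt ?Y \<boxtimes> flat p1 (leaves p2 @ r)) \<bullet> flat q (leaves p1 @ leaves p2 @ r)"
    by simp
  also have "\<dots> = assoc ?X1 ?X2 (?Y \<otimes> ?R) \<bullet> (idt ?X1 \<boxtimes> tau ?X2 ?Y ?R)
    \<bullet> (tau ?X1 ?Y (?X2 \<otimes> ?R) \<bullet> (idt ?Y \<boxtimes> (idt ?X1 \<boxtimes> flat p2 r))) \<bullet>
      (idt ?Y \<boxtimes> flat p1 (leaves p2 @ r)) \<bullet> flat q (leaves p1 @ leaves p2 @ r)"
    unfolding tensor_tau[symmetric] by simp
  also have "\<dots> = assoc ?X1 ?X2 (?Y \<otimes> ?R) \<bullet> (idt ?X1 \<boxtimes> tau ?X2 ?Y ?R)
    \<bullet> (idt ?X1 \<boxtimes> (idt ?Y \<boxtimes> flat p2 r)) \<bullet>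
      (tau ?X1 ?Y (wires_obj (leaves p2 @ r)) \<bullet> (idt ?Y \<boxtimes> flat p1 (leaves p2 @ r)) \<bullet> flat q
        (leaves p1 @ leaves p2 @ r))"
    unfolding tn by simp
  also have "\<dots> = assoc ?X1 ?X2 (?Y \<otimes> ?R)
    \<bullet> (idt ?X1 \<boxtimes> (tau ?X2 ?Y ?R \<bullet> (idt ?Y \<boxtimes> flat p2 r) \<bullet> flat q (leaves p2 @ r))) \<bullet> flat p1
      (leaves q @ leaves p2 @ r) \<bullet> perm (leaves p1 @ leaves q @ leaves p2 @ r)
        (leaves q @ leaves p1 @ leaves p2 @ r)"
    unfolding IH1 by simp
  also have "\<dots> = assoc ?X1 ?X2 (?Y \<otimes> ?R)
    \<bullet> (idt ?X1 \<boxtimes> ((idt ?X2 \<boxtimes> flat q r) \<bullet> flat p2 (leaves q @ r))) \<bullet>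
      ((idt ?X1 \<boxtimes> ?P2) \<bullet> flat p1 (leaves q @ leaves p2 @ r)) \<bullet> perm
        (leaves p1 @ leaves q @ leaves p2 @ r) (leaves q @ leaves p1 @ leaves p2 @ r)"
    unfolding IH2 by simp
  also have "\<dots> = (assoc ?X1 ?X2 (?Y \<otimes> ?R) \<bullet> (idt ?X1 \<boxtimes> (idt ?X2 \<boxtimes> flat q r)))
    \<bullet> (idt ?X1 \<boxtimes> flat p2 (leaves q @ r)) \<bullet> flat p1 (leaves p2 @ leaves q @ r) \<bullet> perm
      (leaves p1 @ leaves p2 @ leaves q @ r) (leaves q @ leaves p1 @ leaves p2 @ r)"
    unfolding fw by simp
  also have "assoc ?X1 ?X2 (?Y \<otimes> ?R) \<bullet> (idt ?X1 \<boxtimes> (idt ?X2 \<boxtimes> flat q r))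
    = (idt (?X1 \<otimes> ?X2) \<boxtimes> flat q r) \<bullet> assoc ?X1 ?X2 (wires_obj (leaves q @ r))"
    unfolding tensor_idt[symmetric] by (rule assoc_natural[symmetric]) auto
  finally show ?case by simp
qed

text \<open>By \<open>block_wire\<close> the two permutations are \<open>tau\<close> up to
  flattening, and \<open>tau\<close> is natural in the factor on which \<open>e\<close>
  acts.\<close>

lemma whisker_wire_framed:
  assumes "typed e p q" "distinct ((n, X) # leaves p @ r)" "distinct ((n, X) # leaves q @ r)"
  shows "idt X \<boxtimes> framed e p q r = perm ((n, X) # leaves p @ r) (leaves p @ (n, X) # r)
    \<bullet> framed e p q ((n, X) # r)
    \<bullet> perm (leaves q @ (n, X) # r) ((n, X) # leaves q @ r)"
proof -
  let ?x = "(n, X)"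
  have [simp]: "valid e" "src e = obj p" "tgt e = obj q" using assms(1) by (auto simp: typed_def)
  note framed_simps[OF assms(1), simp]
  have pms: "same_wires (?x # leaves p @ r) (leaves p @ ?x # r)"
    "same_wires (leaves q @ ?x # r) (?x # leaves q @ r)"
     "same_wires (?x # leaves q @ r) (leaves q @ ?x # r)" using assms by (auto simp: same_wires_def)
  note [simp] = pms perm_simps[OF pms(1), unfolded wires_obj.simps snd_conv]
    perm_simps[OF pms(2), unfolded wires_obj.simps snd_conv]
      perm_simps[OF pms(3), unfolded wires_obj.simps snd_conv]
  note perm.simps[simp del]
  have 1: "perm (?x # leaves p @ r) (leaves p @ ?x # r) = (idt X \<boxtimes> unflat p r)
    \<bullet> tau X (obj p) (wires_obj r) \<bullet> flat p (?x # r)"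
    by (subst block_wire) (use assms in auto)
  have 2: "perm (?x # leaves q @ r) (leaves q @ ?x # r) = (idt X \<boxtimes> unflat q r)
    \<bullet> tau X (obj q) (wires_obj r) \<bullet> flat q (?x # r)"
    by (subst block_wire) (use assms in auto)
  have "perm (?x # leaves p @ r) (leaves p @ ?x # r) \<bullet> framed e p q (?x # r)
     = (idt X \<boxtimes> unflat p r) \<bullet> (tau X (obj p) (wires_obj r) \<bullet> (e \<boxtimes> (idt X \<boxtimes> idt (wires_obj r)))) \<bullet>
       flat q (?x # r)"
    unfolding 1 framed_def by simp
  also have "\<dots> = (idt X \<boxtimes> unflat p r)
    \<bullet> ((idt X \<boxtimes> (e \<boxtimes> idt (wires_obj r))) \<bullet> tau X (obj q) (wires_obj r)) \<bullet> flat q (?x # r)"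
    by (subst tau_natural[symmetric]) auto
  also have "\<dots> = (idt X \<boxtimes> framed e p q r) \<bullet> perm (?x # leaves q @ r) (leaves q @ ?x # r)"
    unfolding 2 framed_def by simp
  finally have "perm (?x # leaves p @ r) (leaves p @ ?x # r) \<bullet> framed e p q (?x # r) = \<dots>" .
  then have "perm (?x # leaves p @ r) (leaves p @ ?x # r) \<bullet> framed e p q (?x # r)
    \<bullet> perm (leaves q @ ?x # r) (?x # leaves q @ r)
     = (idt X \<boxtimes> framed e p q r) \<bullet> perm (?x # leaves q @ r) (leaves q @ ?x # r) \<bullet> perm
       (leaves q @ ?x # r) (?x # leaves q @ r)"
    by (subst cmp_extend) auto
  then show ?thesis using assms by simp
qed

text \<open>An action at any position can be performed at the front, with permutations before and
  after. Both the right factor of a tensor and the exchange of actions rely on this.\<close>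

lemma whisker_framed:
  assumes "typed e p q" "distinct (l @ leaves p @ r)" "distinct (l @ leaves q @ r)"
  shows "whisker l (framed e p q r) = perm (l @ leaves p @ r) (leaves p @ l @ r) \<bullet> framed e p q (l @ r)
    \<bullet> perm (leaves q @ l @ r) (l @ leaves q @ r)"
  using assms
proof (induction l)
  case Nil then show ?case by (simp add: same_wires_refl)
next
  case (Cons x l)
  note framed_simps[OF assms(1), simp]
  let ?X = "snd x"
  have "same_wires (l @ leaves p @ r) (leaves p @ l @ r)" "same_wires (leaves q @ l @ r) (l @ leaves q @ r)"
    "same_wires (x # l @ leaves p @ r) (x # leaves p @ l @ r)"
      "same_wires (x # leaves q @ l @ r) (x # l @ leaves q @ r)"
    "same_wires (x # leaves p @ l @ r) (leaves p @ x # l @ r)"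
      "same_wires (leaves q @ x # l @ r) (x # leaves q @ l @ r)"
    "same_wires (leaves q @ x # l @ r) (x # l @ leaves q @ r)"
    using Cons.prems by (auto simp: same_wires_def)
  note [simp] = this this[THEN perm_simps(1)] this[THEN perm_simps(2)] this[THEN perm_simps(3)]
  have "whisker (x # l) (framed e p q r) = (idt ?X \<boxtimes> perm (l @ leaves p @ r) (leaves p @ l @ r))
    \<bullet> (idt ?X \<boxtimes> framed e p q (l @ r)) \<bullet> (idt ?X \<boxtimes> perm (leaves q @ l @ r) (l @ leaves q @ r))"
    using Cons by simp
  also have "\<dots> = perm (x # l @ leaves p @ r) (x # leaves p @ l @ r)
    \<bullet> (idt ?X \<boxtimes> framed e p q (l @ r)) \<bullet> perm (x # leaves q @ l @ r) (x # l @ leaves q @ r)"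
    by simp
  also have "idt ?X \<boxtimes> framed e p q (l @ r) = perm (x # leaves p @ l @ r) (leaves p @ x # l @ r)
    \<bullet> framed e p q (x # l @ r) \<bullet> perm (leaves q @ x # l @ r) (x # leaves q @ l @ r)"
    using whisker_wire_framed[of e p q "fst x" "snd x" "l @ r"] Cons.prems by auto
  finally show ?case by (simp del: perm.simps(2) wires_obj.simps pull.simps)
qed

section \<open>Symbolic evaluation of arrows\<close>
definition tarr :: "'m \<Rightarrow> 'o pattern \<Rightarrow> 'o pattern \<Rightarrow> ('o, 'm) typed_arrow" where
  "tarr f p q = (obj p, obj q, f)"

definition others :: "'o wire list \<Rightarrow> 'o wire list \<Rightarrow> 'o wire list" where
  "others ws xs = filter (\<lambda>w. w \<notin> set xs) ws"

text \<open>Executability depends on the set of wires present, not on their order. Outputs must be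
  fresh against the untouched wires but may reuse inputs of the same action.\<close>

fun runs :: "('o, 'm) action list \<Rightarrow> 'o wire set \<Rightarrow> bool" where
  "runs [] A \<longleftrightarrow> True"
| "runs ((f, p, q) # \<sigma>) A \<longleftrightarrow> f \<in> Hom C (obj p) (obj q) \<and> distinct (leaves p) \<and> set (leaves p) \<subseteq> A \<and>
     distinct (leaves q) \<and> set (leaves q) \<inter> (A - set (leaves p)) = {} \<and> runs \<sigma>
       (set (leaves q) \<union> (A - set (leaves p)))"

fun final :: "('o, 'm) action list \<Rightarrow> 'o wire set \<Rightarrow> 'o wire set" where
  "final [] A = A"
| "final ((f, p, q) # \<sigma>) A = final \<sigma> (set (leaves q) \<union> (A - set (leaves p)))"

text \<open>The order of the wires between two actions is a matter of choice: inputs are moved to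
  the front, all others keep their order. \<open>denote_pre\<close> and \<open>denote_post\<close>
  show that reordering before or after is absorbed.\<close>

fun denote :: "('o, 'm) action list \<Rightarrow> 'o wire list \<Rightarrow> 'o wire list \<Rightarrow> ('o, 'm) typed_arrow" where
  "denote [] ws ws' = perm ws ws'"
| "denote ((f, p, q) # \<sigma>) ws ws' = perm ws (leaves p @ others ws (leaves p))
  \<bullet> framed (tarr f p q) p q (others ws (leaves p))
     \<bullet> denote \<sigma> (leaves q @ others ws (leaves p)) ws'"

definition valid_run :: "('o, 'm) action list \<Rightarrow> 'o wire list \<Rightarrow> 'o wire list \<Rightarrow> bool" where
  "valid_run \<sigma> ws ws' \<longleftrightarrow> distinct ws \<and> distinct ws' \<and> runs \<sigma> (set ws) \<and> final \<sigma> (set ws) = set ws'"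

lemma valid_run_Nil: "valid_run [] ws ws' \<longleftrightarrow> same_wires ws ws'"
  by (auto simp: valid_run_def same_wires_def)

lemma typed_tarr [simp]: "typed (tarr f p q) p q \<longleftrightarrow> f \<in> Hom C (obj p) (obj q)"
  by (auto simp: typed_def tarr_def typed_arrow_defs)

lemma tarr_simps [simp]: "src (tarr f p q) = obj p" "tgt (tarr f p q) = obj q"
  "valid (tarr f p q) \<longleftrightarrow> f \<in> Hom C (obj p) (obj q)" "arr (tarr f p q) = f"
  by (auto simp: typed_def tarr_def typed_arrow_defs)

lemma set_others [simp]: "set (others ws xs) = set ws - set xs" by (auto simp: others_def)
lemma distinct_others [simp]: "distinct ws \<Longrightarrow> distinct (others ws xs)" by (auto simp: others_def)
lemma others_append_left: "distinct (l @ r) \<Longrightarrow> others (l @ r) l = r"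
  by (auto simp: others_def filter_empty_conv intro!: filter_True)

lemma others_append: "others (l @ m) x = others l x @ others m x" by (simp add: others_def)
lemma others_disjoint: "set l \<inter> set x = {} \<Longrightarrow> others l x = l" by (auto simp: others_def intro: filter_True)
lemma others_self: "others l l = []" by (auto simp: others_def filter_empty_conv)

lemma valid_run_Cons:
  assumes "valid_run ((f, p, q) # \<sigma>) ws ws'"
  shows "same_wires ws (leaves p @ others ws (leaves p))" "typed (tarr f p q) p q"
    "valid_run \<sigma> (leaves q @ others ws (leaves p)) ws'"
    "f \<in> Hom C (obj p) (obj q)"
  using assms by (auto simp: valid_run_def same_wires_def)

lemma denote_simps [simp]:
  assumes "valid_run \<sigma> ws ws'"
  shows "valid (denote \<sigma> ws ws')" "src (denote \<sigma> ws ws') = wires_obj ws" "tgt (denote \<sigma> ws ws')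
    = wires_obj ws'"
proof -
  have "valid_run \<sigma> ws ws' \<Longrightarrow> valid (denote \<sigma> ws ws') \<and> src (denote \<sigma> ws ws') = wires_obj ws \<and>
    tgt (denote \<sigma> ws ws') = wires_obj ws'"
  proof (induction \<sigma> ws ws' rule: denote.induct)
    case (2 f p q \<sigma> ws ws')
    note valid_run_Cons[OF "2.prems"]
    then show ?case using "2.IH" by simp
  qed (simp add: valid_run_Nil)
  then show "valid (denote \<sigma> ws ws')" "src (denote \<sigma> ws ws') = wires_obj ws" "tgt (denote \<sigma> ws ws')
    = wires_obj ws'"
    using assms by auto
qed

lemma valid_run_same_wires: "same_wires ws1 ws \<Longrightarrow> valid_run \<sigma> ws ws' \<longleftrightarrow> valid_run \<sigma> ws1 ws'"
  by (auto simp: valid_run_def same_wires_def)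
lemma valid_run_same_wires': "same_wires ws' ws'' \<Longrightarrow> valid_run \<sigma> ws ws' \<longleftrightarrow> valid_run \<sigma> ws ws''"
  by (auto simp: valid_run_def same_wires_def)

text \<open>The reordering splits in two. One part brings the inputs of the first action to the
  front and is absorbed by \<open>perm_perm\<close>; the other permutes untouched wires, passes the
  action by \<open>framed_whisker\<close> and is absorbed recursively.\<close>

lemma denote_pre:
  assumes "same_wires ws1 ws" "valid_run \<sigma> ws ws'"
  shows "perm ws1 ws \<bullet> denote \<sigma> ws ws' = denote \<sigma> ws1 ws'"
  using assms
proof (induction \<sigma> ws ws' arbitrary: ws1 rule: denote.induct)
  case (2 f p q \<sigma> ws ws')
  let ?d = "others ws (leaves p)" let ?d1 = "others ws1 (leaves p)"
  note valid_run = valid_run_Cons[OF "2.prems"(2)]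
  have "same_wires ws1 (leaves p @ ?d1)" "same_wires (leaves p @ ?d1) (leaves p @ ?d)"
    "same_wires ?d1 ?d" "same_wires (leaves q @ ?d1) (leaves q @ ?d)"
    "same_wires ws1 (leaves p @ ?d)"
  proof -
    have s: "set ws1 = set ws" "distinct ws1" "distinct ws" using "2.prems"(1)
      by (auto simp: same_wires_def)
    then have d: "set ?d1 = set ?d" "distinct ?d1" "distinct ?d" by auto
    have p: "distinct (leaves p)" "set (leaves p) \<subseteq> set ws" "distinct (leaves q)"
      "set (leaves q) \<inter> set ?d = {}" "set (leaves p) \<inter> set ?d = {}"
      "set (leaves p) \<union> set ?d = set ws"
      using "2.prems"(2) by (auto simp: valid_run_def)
    show "same_wires ws1 (leaves p @ ?d1)" "same_wires (leaves p @ ?d1) (leaves p @ ?d)"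
      "same_wires ?d1 ?d" "same_wires (leaves q @ ?d1) (leaves q @ ?d)"
    "same_wires ws1 (leaves p @ ?d)" using s d p unfolding same_wires_def distinct_append set_append
      by simp_all
  qed
  note pms = this
  have ok1: "valid_run \<sigma> (leaves q @ ?d1) ws'" using valid_run(3) valid_run_same_wires[OF pms(4)] by simp
  note [simp] = pms(1) pms(2) pms(3) pms(4) pms(5) valid_run ok1 "2.prems"
  have w: "whisker (leaves q) (perm ?d1 ?d) = perm (leaves q @ ?d1) (leaves q @ ?d)"
     "whisker (leaves p) (perm ?d1 ?d) = perm (leaves p @ ?d1) (leaves p @ ?d)"
  proof -
    have "distinct (leaves p @ ?d1)" "distinct (leaves q @ ?d1)" using pms unfolding same_wires_def
      by blast+
    then show "whisker (leaves q) (perm ?d1 ?d) = perm (leaves q @ ?d1) (leaves q @ ?d)"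
     "whisker (leaves p) (perm ?d1 ?d) = perm (leaves p @ ?d1) (leaves p @ ?d)"
      unfolding distinct_append by (auto intro!: perm_whisker[symmetric] simp del: set_others)
  qed
  have aw: "perm (leaves p @ ?d1) (leaves p @ ?d) \<bullet> framed (tarr f p q) p q ?d
    = framed (tarr f p q) p q ?d1 \<bullet> perm (leaves q @ ?d1) (leaves q @ ?d)"
    unfolding w[symmetric] by (rule framed_whisker[symmetric]) auto
  have "perm ws1 ws \<bullet> denote ((f, p, q) # \<sigma>) ws ws'
      = perm ws1 (leaves p @ ?d1) \<bullet> perm (leaves p @ ?d1) (leaves p @ ?d) \<bullet> framed (tarr f p q) p q
        ?d \<bullet> denote \<sigma> (leaves q @ ?d) ws'"
    by simp
  also have "\<dots> = perm ws1 (leaves p @ ?d1)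
    \<bullet> (perm (leaves p @ ?d1) (leaves p @ ?d) \<bullet> framed (tarr f p q) p q ?d) \<bullet> denote \<sigma> (leaves q @ ?d) ws'"
    by (simp del: perm_perm')
  also have "\<dots> = perm ws1 (leaves p @ ?d1) \<bullet> framed (tarr f p q) p q ?d1
    \<bullet> (perm (leaves q @ ?d1) (leaves q @ ?d) \<bullet> denote \<sigma> (leaves q @ ?d) ws')"
    unfolding aw by simp
  also have "perm (leaves q @ ?d1) (leaves q @ ?d) \<bullet> denote \<sigma> (leaves q @ ?d) ws'
    = denote \<sigma> (leaves q @ ?d1) ws'"
    by (rule "2.IH") auto
  finally show ?case by simp
qed (simp add: valid_run_Nil)

lemma denote_append:
  assumes "valid_run \<sigma> ws ws'" "valid_run \<tau> ws' ws''"
  shows "denote (\<sigma> @ \<tau>) ws ws'' = denote \<sigma> ws ws' \<bullet> denote \<tau> ws' ws''"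
  using assms
proof (induction \<sigma> ws ws' rule: denote.induct)
  case (1 ws ws') then show ?case by (simp add: denote_pre valid_run_Nil)
next
  case (2 f p q \<sigma> ws ws')
  note valid_run_Cons[OF "2.prems"(1)]
  then show ?case using 2 by simp
qed

lemma runs_append: "runs (\<sigma> @ \<tau>) A \<longleftrightarrow> runs \<sigma> A \<and> runs \<tau> (final \<sigma> A)"
  by (induction \<sigma> A rule: final.induct) auto
lemma final_append: "final (\<sigma> @ \<tau>) A = final \<tau> (final \<sigma> A)"
  by (induction \<sigma> A rule: final.induct) auto

lemma valid_run_append: "valid_run \<sigma> ws ws' \<Longrightarrow> valid_run \<tau> ws' ws'' \<Longrightarrow> valid_run (\<sigma> @ \<tau>) ws ws''"
  by (auto simp: valid_run_def runs_append final_append)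

lemma denote_post:
  assumes "valid_run \<sigma> ws ws'" "same_wires ws' ws''"
  shows "denote \<sigma> ws ws' \<bullet> perm ws' ws'' = denote \<sigma> ws ws''"
  using denote_append[of \<sigma> ws ws' "[]" ws''] assms by (simp add: valid_run_Nil)

text \<open>With the inputs of both actions in front, the first one works behind the inputs of the
  second by \<open>whisker_framed\<close>, and \<open>framed_whisker\<close> then exchanges the
  two.\<close>

lemma denote_swap:
  assumes valid_run: "valid_run ((f, p, q) # (g, p', q') # \<tau>) ws ws'" and ok':
    "valid_run ((g, p', q') # (f, p, q) # \<tau>) ws ws'"
    and "set (leaves p) \<inter> set (leaves q') = {}" "set (leaves p') \<inter> set (leaves q) = {}"
    and "set (leaves p) \<inter> set (leaves p') = {}"
  shows "denote ((f, p, q) # (g, p', q') # \<tau>) ws ws' = denote ((g, p', q') # (f, p, q) # \<tau>) ws ws'"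
proof -
  \<comment> \<open>\<open>r\<close> lists the wires that neither action reads. By
    \<open>denote_pre\<close> the initial list may be replaced by the inputs of both actions
    followed by \<open>r\<close>.\<close>
  obtain r where r: "r = others (others ws (leaves p)) (leaves p')" by simp
  let ?u = "leaves p @ leaves p' @ r"
  have dis: "distinct (leaves q' @ leaves q @ r)" "distinct (leaves q @ leaves p' @ r)"
    "distinct (leaves q' @ leaves p @ r)" "distinct ?u" "set ws = set ?u"
    using assms by (auto simp: valid_run_def r)
  have pms: "same_wires ws ?u" "same_wires ?u (leaves p' @ leaves p @ r)"
    "same_wires (leaves q @ leaves p' @ r) (leaves p' @ leaves q @ r)"
    "same_wires (leaves q' @ leaves p @ r) (leaves p @ leaves q' @ r)"
      "same_wires (leaves q @ leaves q' @ r) (leaves q' @ leaves q @ r)"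
    "same_wires (leaves p' @ leaves q @ r) (leaves q @ leaves p' @ r)"
    using dis valid_run by (auto simp: same_wires_def valid_run_def)
  have u: "valid_run ((f, p, q) # (g, p', q') # \<tau>) ?u ws'" "valid_run ((g, p', q') # (f, p, q) # \<tau>) ?u ws'"
    using valid_run_same_wires[OF pms(1)] valid_run ok' by simp_all
  have fg [simp]: "f \<in> Hom C (obj p) (obj q)" "g \<in> Hom C (obj p') (obj q')" using valid_run
    by (auto simp: valid_run_def)
  have difs: "others ?u (leaves p) = leaves p' @ r" "others ?u (leaves p') = leaves p @ r"
    "others (leaves q @ leaves p' @ r) (leaves p') = leaves q @ r"
     "others (leaves q' @ leaves p @ r) (leaves p) = leaves q' @ r"
    using dis assms(3-) by (simp_all add: others_append others_disjoint others_self Int_commute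
      Int_Un_distrib)
  have okt: "valid_run \<tau> (leaves q' @ leaves q @ r) ws'"
    using valid_run_Cons(3)[OF valid_run_Cons(3)[OF u(1)], unfolded difs] .
  have okt': "valid_run \<tau> (leaves q @ leaves q' @ r) ws'"
    using valid_run_same_wires[OF pms(5)] okt by simp
  note [simp] = pms(1) pms(2) pms(3) pms(4) pms(5) pms(6) okt okt'
  let ?F = "tarr f p q" let ?G = "tarr g p' q'"
  have tF: "typed ?F p q" and tG: "typed ?G p' q'" by auto
  have atF: "perm (leaves p' @ leaves p @ r) ?u \<bullet> framed ?F p q (leaves p' @ r)
    \<bullet> perm (leaves q @ leaves p' @ r) (leaves p' @ leaves q @ r) = whisker (leaves p') (framed ?F p q r)"
    by (rule whisker_framed[OF tF, symmetric]) (use dis in auto)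
  have atF': "perm (leaves q' @ leaves p @ r) (leaves p @ leaves q' @ r)
    \<bullet> framed ?F p q (leaves q' @ r) \<bullet> perm (leaves q @ leaves q' @ r) (leaves q' @ leaves q @ r) =
      whisker (leaves q') (framed ?F p q r)"
    by (rule whisker_framed[OF tF, symmetric]) (use dis in auto)
  have aw: "whisker (leaves p') (framed ?F p q r) \<bullet> framed ?G p' q' (leaves q @ r)
    = framed ?G p' q' (leaves p @ r) \<bullet> whisker (leaves q') (framed ?F p q r)"
    by (rule framed_whisker[symmetric]) auto
  have dtau: "denote \<tau> (leaves q @ leaves q' @ r) ws'
    = perm (leaves q @ leaves q' @ r) (leaves q' @ leaves q @ r) \<bullet> denote \<tau> (leaves q' @ leaves q @ r) ws'"
    by (rule denote_pre[symmetric]) auto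
  have "same_wires (leaves p' @ leaves p @ r) ?u" using same_wires_sym[OF pms(2)] .
  note [simp] = this
  have "denote ((f, p, q) # (g, p', q') # \<tau>) ?u ws' =
     perm ?u (leaves p' @ leaves p @ r) \<bullet>
       (perm (leaves p' @ leaves p @ r) ?u \<bullet> framed ?F p q (leaves p' @ r) \<bullet> perm
         (leaves q @ leaves p' @ r) (leaves p' @ leaves q @ r)) \<bullet> framed ?G p' q' (leaves q @ r) \<bullet>
           denote \<tau> (leaves q' @ leaves q @ r) ws'"
    using dis by (simp add: difs)
  also have "\<dots> = perm ?u (leaves p' @ leaves p @ r)
    \<bullet> (whisker (leaves p') (framed ?F p q r) \<bullet> framed ?G p' q' (leaves q @ r)) \<bullet> denote \<tau>
      (leaves q' @ leaves q @ r) ws'"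
    unfolding atF by simp
  also have "\<dots> = perm ?u (leaves p' @ leaves p @ r) \<bullet> framed ?G p' q' (leaves p @ r)
    \<bullet> whisker (leaves q') (framed ?F p q r) \<bullet> denote \<tau> (leaves q' @ leaves q @ r) ws'"
    unfolding aw by simp
  also have "\<dots> = denote ((g, p', q') # (f, p, q) # \<tau>) ?u ws'"
    by (simp add: difs dtau flip: atF')
  finally have "denote ((f, p, q) # (g, p', q') # \<tau>) ?u ws' = denote ((g, p', q') # (f, p, q) # \<tau>) ?u ws'" .
  then show ?thesis using denote_pre[OF pms(1)] u by metis
qed

text \<open>
  Starting from wires arranged as \<open>p\<close>, the arrow \<open>e\<close> performs an initial segment of the actions \<open>\<sigma>\<close>,
  leaves \<open>\<sigma>'\<close> to be performed, and arranges the resulting wires as \<open>q\<close>. Quantifying over the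
  remaining wires \<open>r\<close> makes this stable under tensoring with other arrows. The rules below are
    directed by the
  syntax of \<open>e\<close> and determine \<open>q\<close> and \<open>\<sigma>'\<close>, so that resolution executes them.
\<close>
definition evals :: "'m \<Rightarrow> 'o pattern \<Rightarrow> ('o, 'm) action list \<Rightarrow> 'o pattern \<Rightarrow> ('o, 'm) action list
  \<Rightarrow> bool" where
  "evals e p \<sigma> q \<sigma>' \<longleftrightarrow> e \<in> Hom C (obj p) (obj q) \<and> (\<exists>u. \<sigma> = u @ \<sigma>' \<and>
     (\<forall>r. distinct (leaves p @ r) \<longrightarrow> runs u (set (leaves p @ r)) \<longrightarrow>
        valid_run u (leaves p @ r) (leaves q @ r) \<and> framed (tarr e p q) p q r = denote u
          (leaves p @ r) (leaves q @ r)))"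

section \<open>Soundness of the evaluation rules\<close>

lemma evals_Hom: "evals e p \<sigma> q \<sigma>' \<Longrightarrow> e \<in> Hom C (obj p) (obj q)"
  by (simp add: evals_def)

text \<open>A structural arrow performs no action, so the consumed segment is empty and it remains
  to identify the permutation.\<close>

lemma evals_struct:
  assumes e: "e \<in> Hom C (obj p) (obj q)" and same_wires: "\<And>r. distinct (leaves p @ r)
    \<Longrightarrow> same_wires (leaves p @ r) (leaves q @ r)"
    and eq: "\<And>r. distinct (leaves p @ r) \<Longrightarrow>
      (tarr e p q \<boxtimes> idt (wires_obj r)) \<bullet> flat q r = flat p r \<bullet> perm (leaves p @ r) (leaves q @ r)"
  shows "evals e p \<sigma> q \<sigma>"
  unfolding evals_def using e same_wires by (auto simp: framed_def eq valid_run_Nil intro!: exI[of _ "[]"])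

lemma evals_Ide: "obj p = X \<Longrightarrow> evals (Ide C X) p \<sigma> p \<sigma>"
  by (rule evals_struct) (auto simp: Ide_Hom same_wires_refl tarr_def simp flip: idt_def)

lemma tarr_assoc: "tarr (Assoc C (obj p) (obj q) (obj r)) (PT (PT p q) r) (PT p (PT q r))
  = assoc (obj p) (obj q) (obj r)"
  by (simp add: tarr_def assoc_def)

text \<open>As the wires keep their order, \<open>e\<close> flattens to an identity, and hence so
  does its inverse.\<close>

lemma evals_inverse:
  assumes evals: "\<And>\<sigma>. evals e p \<sigma> q \<sigma>" and "inverse_arrows C (obj p) (obj q) e e'" and "leaves p = leaves q"
  shows "evals e' q \<sigma> p \<sigma>"
proof (rule evals_struct)
  fix r assume d: "distinct (leaves q @ r)"
  have e [simp]: "e' \<in> Hom C (obj q) (obj p)" "e \<in> Hom C (obj p) (obj q)"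
     "tarr e' q p \<bullet> tarr e p q = idt (obj q)"
    using assms(2) by (auto simp: inverse_arrows_def tarr_def typed_arrow_defs)
  have "framed (tarr e p q) p q r = idt (wires_obj (leaves q @ r))"
    using evals[of "[]"] d assms(3) unfolding evals_def by auto
  then have "flat p r \<bullet> framed (tarr e p q) p q r = flat p r" using assms(3) by simp
  then have "(tarr e p q \<boxtimes> idt (wires_obj r)) \<bullet> flat q r = flat p r" by (simp add: framed_def)
  then have "(tarr e' q p \<boxtimes> idt (wires_obj r)) \<bullet> flat p r = (tarr e' q p \<boxtimes> idt (wires_obj r))
    \<bullet> (tarr e p q \<boxtimes> idt (wires_obj r)) \<bullet> flat q r"
    by simp
  also have "\<dots> = flat q r" by (simp)
  finally show "(tarr e' q p \<boxtimes> idt (wires_obj r)) \<bullet> flat p r = flat q r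
    \<bullet> perm (leaves q @ r) (leaves p @ r)"
    using d assms(3) by simp
qed (use assms in \<open>auto simp: inverse_arrows_def same_wires_refl\<close>)

text \<open>Both bracketings flatten alike by the pentagon for the three blocks and the remaining
  wires.\<close>

lemma evals_Assoc:
  assumes "obj p = X" "obj q = Y" "obj r = Z"
  shows "evals (Assoc C X Y Z) (PT (PT p q) r) \<sigma> (PT p (PT q r)) \<sigma>"
  unfolding assms[symmetric]
proof (rule evals_struct)
  fix s :: "'o wire list" assume d: "distinct (leaves (PT (PT p q) r) @ s)"
  have "flat (PT (PT p q) r) s = assoc (obj p \<otimes> obj q) (obj r) (wires_obj s)
    \<bullet> ((idt (obj p) \<boxtimes> idt (obj q)) \<boxtimes> flat r s)
     \<bullet> assoc (obj p) (obj q) (wires_obj (leaves r @ s)) \<bullet> (idt (obj p) \<boxtimes> flat q (leaves r @ s)) \<bullet>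
       flat p (leaves q @ leaves r @ s)"
    by simp
  also have "\<dots> = (assoc (obj p \<otimes> obj q) (obj r) (wires_obj s)
    \<bullet> assoc (obj p) (obj q) (obj r \<otimes> wires_obj s)) \<bullet> (idt (obj p) \<boxtimes> (idt (obj q) \<boxtimes> flat r s)) \<bullet>
      (idt (obj p) \<boxtimes> flat q (leaves r @ s)) \<bullet> flat p (leaves q @ leaves r @ s)"
    by (subst cmp_extend[OF assoc_natural]) auto
  also have "\<dots> = (assoc (obj p) (obj q) (obj r) \<boxtimes> idt (wires_obj s)) \<bullet> flat (PT p (PT q r)) s"
    by (subst pentagon_tensor) auto
  finally show "(tarr (Assoc C (obj p) (obj q) (obj r)) (PT (PT p q) r) (PT p (PT q r)) \<boxtimes> idt
    (wires_obj s)) \<bullet> flat (PT p (PT q r)) s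
     = flat (PT (PT p q) r) s \<bullet> perm (leaves (PT (PT p q) r) @ s) (leaves (PT p (PT q r)) @ s)"
    unfolding tarr_assoc using d by simp
qed (use AssocI_inverse in \<open>auto simp: inverse_arrows_def same_wires_refl\<close>)

lemma evals_AssocI: "\<lbrakk>obj p = X; obj q = Y; obj r = Z\<rbrakk> \<Longrightarrow> evals (AssocI C X Y Z) (PT p (PT q r))
  \<sigma> (PT (PT p q) r) \<sigma>"
  by (rule evals_inverse[OF evals_Assoc]) (auto intro: AssocI_inverse)

lemma evals_LUnit: "obj p = X \<Longrightarrow> evals (LUnit C X) (PT PU p) \<sigma> p \<sigma>"
proof (rule evals_struct)
  fix r :: "'o wire list" assume d: "distinct (leaves (PT PU p) @ r)" and X: "obj p = X"
  have g: "tarr (LUnit C X) (PT PU p) p = lunit (obj p)" using X by (simp add: tarr_def lunit_def)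
  have "flat (PT PU p) r = assoc \<one> (obj p) (wires_obj r) \<bullet> lunit (obj p \<otimes> wires_obj r) \<bullet> flat p r"
    by (simp add: lunit_natural)
  also have "\<dots> = (lunit (obj p) \<boxtimes> idt (wires_obj r)) \<bullet> flat p r" by (subst cmp_extend[OF assoc_lunit]) auto
  finally show "(tarr (LUnit C X) (PT PU p) p \<boxtimes> idt (wires_obj r)) \<bullet> flat p r = flat (PT PU p) r
    \<bullet> perm (leaves (PT PU p) @ r) (leaves p @ r)"
    using d X by (simp add: g)
qed (use LUnitI_inverse in \<open>auto simp: inverse_arrows_def same_wires_refl\<close>)

lemma evals_LUnitI: "obj p = X \<Longrightarrow> evals (LUnitI C X) p \<sigma> (PT PU p) \<sigma>"
  by (rule evals_inverse[OF evals_LUnit]) (auto intro: LUnitI_inverse)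

lemma evals_RUnit: "obj p = X \<Longrightarrow> evals (RUnit C X) (PT p PU) \<sigma> p \<sigma>"
proof (rule evals_struct)
  fix r :: "'o wire list" assume d: "distinct (leaves (PT p PU) @ r)" and X: "obj p = X"
  have g: "tarr (RUnit C X) (PT p PU) p = runit (obj p)" using X by (simp add: tarr_def runit_def)
  have "flat (PT p PU) r = (runit (obj p) \<boxtimes> idt (wires_obj r)) \<bullet> flat p r"
    by (simp flip: triangle_tensor)
  then show "(tarr (RUnit C X) (PT p PU) p \<boxtimes> idt (wires_obj r)) \<bullet> flat p r = flat (PT p PU) r
    \<bullet> perm (leaves (PT p PU) @ r) (leaves p @ r)"
    using d X by (simp add: g)
qed (use RUnitI_inverse in \<open>auto simp: inverse_arrows_def same_wires_refl\<close>)

lemma evals_RUnitI: "obj p = X \<Longrightarrow> evals (RUnitI X) p \<sigma> (PT p PU) \<sigma>"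
  by (rule evals_inverse[OF evals_RUnit]) (auto intro: RUnitI_inverse)

lemma evals_Sym:
  assumes "obj p = X" "obj q = Y"
  shows "evals (Sym C X Y) (PT p q) \<sigma> (PT q p) \<sigma>"
  unfolding assms[symmetric]
proof (rule evals_struct)
  fix r :: "'o wire list" assume "distinct (leaves (PT p q) @ r)"
  then have d: "distinct (leaves p @ leaves q @ r)" by simp
  have [simp]: "same_wires (leaves p @ leaves q @ r) (leaves q @ leaves p @ r)" using d
    by (auto simp: same_wires_def)
  have g: "tarr (Sym C (obj p) (obj q)) (PT p q) (PT q p) = symm (obj p) (obj q)"
    by (simp add: tarr_def symm_def)
  have "(symm (obj p) (obj q) \<boxtimes> idt (wires_obj r)) \<bullet> flat (PT q p) r
    = assoc (obj p) (obj q) (wires_obj r) \<bullet> tau (obj p) (obj q) (wires_obj r) \<bullet>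
      (idt (obj q) \<boxtimes> flat p r) \<bullet> flat q (leaves p @ r)"
    by (simp add: tau_def)
  also have "\<dots> = flat (PT p q) r \<bullet> perm (leaves p @ leaves q @ r) (leaves q @ leaves p @ r)"
    by (subst block[OF d]) simp
  finally show "(tarr (Sym C (obj p) (obj q)) (PT p q) (PT q p) \<boxtimes> idt (wires_obj r)) \<bullet> flat (PT q p) r
     = flat (PT p q) r \<bullet> perm (leaves (PT p q) @ r) (leaves (PT q p) @ r)"
    unfolding g by simp
qed (auto simp: Sym_Hom same_wires_def)

text \<open>The only rule that consumes an action. The list \<open>\<sigma>\<close> thereby
  prescribes on which wires an opaque arrow places its results.\<close>

lemma evals_generator: "f \<in> Hom C (obj p) (obj q) \<Longrightarrow> evals f p ((f, p, q) # \<sigma>) q \<sigma>"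
  unfolding evals_def
proof (intro conjI exI[of _ "[(f, p, q)]"] allI impI)
  fix r assume f: "f \<in> Hom C (obj p) (obj q)"
    and d: "distinct (leaves p @ r)" and "runs [(f, p, q)] (set (leaves p @ r))"
  then have "distinct (leaves q @ r)" by auto
  with f d show "framed (tarr f p q) p q r = denote [(f, p, q)] (leaves p @ r) (leaves q @ r)"
    by (simp add: others_append_left)
qed (auto simp: valid_run_def)

lemma evals_Seq:
  assumes "evals e p \<sigma> q \<sigma>'" "evals e' q \<sigma>' s \<sigma>''"
  shows "evals (e \<Zcomp> e') p \<sigma> s \<sigma>''"
proof -
  have [simp]: "e \<in> Hom C (obj p) (obj q)" "e' \<in> Hom C (obj q) (obj s)" using assms evals_Hom by auto
  have g: "tarr (e \<Zcomp> e') p s = tarr e p q \<bullet> tarr e' q s" by (simp add: tarr_def typed_arrow_defs)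
  obtain u where u: "\<sigma> = u @ \<sigma>'" "\<And>r. distinct (leaves p @ r) \<Longrightarrow> runs u (set (leaves p @ r)) \<Longrightarrow>
        valid_run u (leaves p @ r) (leaves q @ r) \<and> framed (tarr e p q) p q r = denote u
          (leaves p @ r) (leaves q @ r)"
    using assms(1) unfolding evals_def by blast
  obtain u' where u': "\<sigma>' = u' @ \<sigma>''" "\<And>r. distinct (leaves q @ r) \<Longrightarrow> runs u' (set (leaves q @ r)) \<Longrightarrow>
        valid_run u' (leaves q @ r) (leaves s @ r) \<and> framed (tarr e' q s) q s r = denote u'
          (leaves q @ r) (leaves s @ r)"
    using assms(2) unfolding evals_def by blast
  have "valid_run (u @ u') (leaves p @ r) (leaves s @ r) \<and> framed (tarr (e \<Zcomp> e') p s) p s r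
    = denote (u @ u') (leaves p @ r) (leaves s @ r)"
    if d: "distinct (leaves p @ r)" and runs: "runs (u @ u') (set (leaves p @ r))" for r
  proof -
    have 1: "valid_run u (leaves p @ r) (leaves q @ r)" "framed (tarr e p q) p q r
      = denote u (leaves p @ r) (leaves q @ r)"
      using u(2)[OF d] runs by (auto simp: runs_append)
    have 2: "valid_run u' (leaves q @ r) (leaves s @ r)" "framed (tarr e' q s) q s r
      = denote u' (leaves q @ r) (leaves s @ r)"
      using u'(2)[of r] 1 runs unfolding valid_run_def runs_append by auto
    have "framed (tarr (e \<Zcomp> e') p s) p s r = framed (tarr e p q) p q r \<bullet> framed (tarr e' q s) q s r"
      unfolding g framed_def by simp
    then show ?thesis using 1 2 by (simp add: denote_append valid_run_append)
  qed
  then show ?thesis unfolding evals_def u(1) u'(1) using Seq_Hom[of e _ "obj q" e']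
    by (auto intro!: exI[of _ "u @ u'"])
qed

lemma framed_tensor:
  assumes "typed e p q" "typed e' p' q'"
  shows "framed (e \<boxtimes> e') (PT p p') (PT q q') r = framed e p q (leaves p' @ r)
    \<bullet> whisker (leaves q) (framed e' p' q' r)"
proof -
  have [simp]: "valid e" "src e = obj p" "tgt e = obj q" "valid e'" "src e' = obj p'" "tgt e' = obj q'"
    using assms by (auto simp: typed_def)
  note framed_simps[OF assms(2), simp]
  have "framed (e \<boxtimes> e') (PT p p') (PT q q') r = unflat p (leaves p' @ r) \<bullet> (idt (obj p) \<boxtimes> unflat p' r) \<bullet>
      assocI (obj p) (obj p') (wires_obj r) \<bullet> ((e \<boxtimes> e') \<boxtimes> idt (wires_obj r)) \<bullet> assoc (obj q)
        (obj q') (wires_obj r) \<bullet> (idt (obj q) \<boxtimes> flat q' r) \<bullet> flat q (leaves q' @ r)"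
    by (simp add: framed_def)
  also have "\<dots> = unflat p (leaves p' @ r) \<bullet> (e \<boxtimes> framed e' p' q' r) \<bullet> flat q (leaves q' @ r)"
    by (subst cmp_extend[OF assoc_natural]) (auto simp: framed_def)
  also have "\<dots> = unflat p (leaves p' @ r) \<bullet> (e \<boxtimes> idt (wires_obj (leaves p' @ r)))
    \<bullet> ((idt (obj q) \<boxtimes> framed e' p' q' r) \<bullet> flat q (leaves q' @ r))"
    by simp
  also have "(idt (obj q) \<boxtimes> framed e' p' q' r) \<bullet> flat q (leaves q' @ r) = flat q (leaves p' @ r)
    \<bullet> whisker (leaves q) (framed e' p' q' r)"
    by (rule flat_whisker) auto
  finally show ?thesis by (simp add: framed_def[of e])
qed

text \<open>The left factor runs first, which fixes the order in which \<open>\<sigma>\<close> has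
  to list the actions. When the right factor runs, the outputs of the left one stand in front; its
  hypothesis is used with \<open>leaves q @ r\<close> as remaining wires, and
  \<open>whisker_framed\<close> relates the two positions.\<close>

lemma evals_Tens:
  assumes "evals e p \<sigma> q \<sigma>'" "evals e' p' \<sigma>' q' \<sigma>''"
  shows "evals (e \<otimes>\<^sub>a e') (PT p p') \<sigma> (PT q q') \<sigma>''"
proof -
  have H [simp]: "e \<in> Hom C (obj p) (obj q)" "e' \<in> Hom C (obj p') (obj q')" using assms evals_Hom by auto
  have g: "tarr (e \<otimes>\<^sub>a e') (PT p p') (PT q q') = tarr e p q \<boxtimes> tarr e' p' q'"
    by (simp add: tarr_def typed_arrow_defs)
  obtain u where u: "\<sigma> = u @ \<sigma>'" "\<And>r. distinct (leaves p @ r) \<Longrightarrow> runs u (set (leaves p @ r)) \<Longrightarrow>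
        valid_run u (leaves p @ r) (leaves q @ r) \<and> framed (tarr e p q) p q r = denote u
          (leaves p @ r) (leaves q @ r)"
    using assms(1) unfolding evals_def by blast
  obtain u' where u': "\<sigma>' = u' @ \<sigma>''" "\<And>r. distinct (leaves p' @ r) \<Longrightarrow> runs u' (set (leaves p' @ r)) \<Longrightarrow>
        valid_run u' (leaves p' @ r) (leaves q' @ r) \<and> framed (tarr e' p' q') p' q' r = denote u'
          (leaves p' @ r) (leaves q' @ r)"
    using assms(2) unfolding evals_def by blast
  have "valid_run (u @ u') (leaves (PT p p') @ r) (leaves (PT q q') @ r) \<and>
    framed (tarr (e \<otimes>\<^sub>a e') (PT p p') (PT q q')) (PT p p') (PT q q') r
       = denote (u @ u') (leaves (PT p p') @ r) (leaves (PT q q') @ r)"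
    if "distinct (leaves (PT p p') @ r)" and "runs (u @ u') (set (leaves (PT p p') @ r))" for r
  proof -
    have d: "distinct (leaves p @ leaves p' @ r)" and runs:
      "runs (u @ u') (set (leaves p @ leaves p' @ r))" using that by (auto simp: Un_assoc)
    have 1: "valid_run u (leaves p @ leaves p' @ r) (leaves q @ leaves p' @ r)"
      "framed (tarr e p q) p q (leaves p' @ r)
        = denote u (leaves p @ leaves p' @ r) (leaves q @ leaves p' @ r)"
      using u(2)[OF d] runs by (auto simp: runs_append)
    have pm1: "same_wires (leaves q @ leaves p' @ r) (leaves p' @ leaves q @ r)" using 1
      by (auto simp: valid_run_def same_wires_def)
    have d2: "distinct (leaves p' @ leaves q @ r)" using pm1 by (simp add: same_wires_def)
    have 2: "valid_run u' (leaves p' @ leaves q @ r) (leaves q' @ leaves q @ r)"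
      "framed (tarr e' p' q') p' q' (leaves q @ r)
        = denote u' (leaves p' @ leaves q @ r) (leaves q' @ leaves q @ r)"
      using u'(2)[OF d2] 1 runs pm1 unfolding valid_run_def runs_append same_wires_def by auto
    have pm2: "same_wires (leaves q' @ leaves q @ r) (leaves q @ leaves q' @ r)" using 2
      by (auto simp: valid_run_def same_wires_def)
    have ok2: "valid_run u' (leaves q @ leaves p' @ r) (leaves q' @ leaves q @ r)"
      "valid_run u' (leaves q @ leaves p' @ r) (leaves q @ leaves q' @ r)"
      "valid_run u' (leaves p' @ leaves q @ r) (leaves q @ leaves q' @ r)"
      using 2 valid_run_same_wires[OF pm1] valid_run_same_wires'[OF pm2] by auto
    have d3: "distinct (leaves q @ leaves q' @ r)" using pm2 by (simp add: same_wires_def)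
    have "whisker (leaves q) (framed (tarr e' p' q') p' q' r)
      = perm (leaves q @ leaves p' @ r) (leaves p' @ leaves q @ r) \<bullet> denote u'
        (leaves p' @ leaves q @ r) (leaves q' @ leaves q @ r) \<bullet> perm (leaves q' @ leaves q @ r)
          (leaves q @ leaves q' @ r)"
      unfolding 2(2)[symmetric] by (rule whisker_framed) (use d2 d3 in auto)
    also have "\<dots> = denote u' (leaves q @ leaves p' @ r) (leaves q @ leaves q' @ r)"
      using 2(1) pm1 pm2 ok2 by (simp add: denote_post denote_pre)
    finally have w: "whisker (leaves q) (framed (tarr e' p' q') p' q' r) = \<dots>" .
    have "framed (tarr (e \<otimes>\<^sub>a e') (PT p p') (PT q q')) (PT p p') (PT q q') r
       = denote u (leaves p @ leaves p' @ r) (leaves q @ leaves p' @ r) \<bullet> denote u'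
         (leaves q @ leaves p' @ r) (leaves q @ leaves q' @ r)"
      unfolding g by (subst framed_tensor) (auto simp: 1 w)
    also have "\<dots> = denote (u @ u') (leaves p @ leaves p' @ r) (leaves q @ leaves q' @ r)"
      using 1(1) ok2(2) by (simp add: denote_append)
    finally show ?thesis using valid_run_append[OF 1(1) ok2(2)] by simp
  qed
  then show ?thesis unfolding evals_def u(1) u'(1) by (auto intro!: exI[of _ "u @ u'"] Tens_Hom)
qed

section \<open>Comparing arrows by their evaluations\<close>

lemma evals_denote:
  assumes "evals e p \<sigma> q []" "distinct (leaves p)" "runs \<sigma> (set (leaves p))"
  shows "valid_run \<sigma> (leaves p) (leaves q)" "framed (tarr e p q) p q [] = denote \<sigma> (leaves p) (leaves q)"
  using assms unfolding evals_def by (metis append_Nil2)+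

text \<open>Without remaining wires, \<open>framed\<close> is the tensor with the unit up to
  isomorphisms, and tensoring with the unit is faithful.\<close>

lemma framed_inj:
  assumes "framed (tarr e p q) p q [] = framed (tarr e' p q) p q []" "e \<in> Hom C (obj p) (obj q)"
    "e' \<in> Hom C (obj p) (obj q)"
  shows "e = e'"
proof -
  have *: "flat p [] \<bullet> framed (tarr f p q) p q [] \<bullet> unflat q [] = tarr f p q \<boxtimes> idt \<one>"
    if "f \<in> Hom C (obj p) (obj q)" for f
    using that by (simp add: framed_def)
  have "tarr e p q \<boxtimes> idt \<one> = tarr e' p q \<boxtimes> idt \<one>"
    using *[OF assms(2)] *[OF assms(3)] assms(1) by simp
  then have "tarr e p q = tarr e' p q" by (rule tensor_idt_one_inj) (use assms in auto)
  then show ?thesis by (simp add: tarr_def)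
qed

text \<open>Callers instantiate \<open>p\<close> and \<open>\<sigma>\<close> only: evaluating the
  first arrow computes \<open>q\<close>, and evaluating the second one checks it.\<close>

lemma evals_unique:
  assumes "evals e p \<sigma> q []" "evals e' p \<sigma> q []" "distinct (leaves p)" "runs \<sigma> (set (leaves p))"
  shows "e = e'"
  using framed_inj evals_denote[OF assms(1,3,4)] evals_denote[OF assms(2,3,4)]
    evals_Hom[OF assms(1)] evals_Hom[OF assms(2)] by metis

lemma evals_unique_swap_aux:
  assumes "evals e p (\<sigma> @ (f, x, y) # (g, x', y') # \<tau>) q []"
    "evals e' p (\<sigma> @ (g, x', y') # (f, x, y) # \<tau>) q []"
    "distinct (leaves p)"
    and runs: "runs (\<sigma> @ (f, x, y) # (g, x', y') # \<tau>) (set (leaves p))"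
      "runs (\<sigma> @ (g, x', y') # (f, x, y) # \<tau>) (set (leaves p))"
    and "set (leaves x) \<inter> set (leaves y') = {}" "set (leaves x') \<inter> set (leaves y)
      = {}" "set (leaves x) \<inter> set (leaves x') = {}"
  shows "e = e'"
proof -
  have 1: "valid_run (\<sigma> @ (f, x, y) # (g, x', y') # \<tau>) (leaves p) (leaves q)"
    "framed (tarr e p q) p q [] = denote (\<sigma> @ (f, x, y) # (g, x', y') # \<tau>) (leaves p) (leaves q)"
    using evals_denote assms by auto
  have 2: "valid_run (\<sigma> @ (g, x', y') # (f, x, y) # \<tau>) (leaves p) (leaves q)"
    "framed (tarr e' p q) p q [] = denote (\<sigma> @ (g, x', y') # (f, x, y) # \<tau>) (leaves p) (leaves q)"
    using evals_denote assms by auto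
  have fin: "finite (final \<sigma> (set (leaves p)))"
  proof -
    have "finite A \<Longrightarrow> finite (final \<sigma> A)" for A
      by (induction \<sigma> A rule: final.induct) auto
    then show ?thesis by simp
  qed
  \<comment> \<open>\<open>final\<close> yields a set, whereas \<open>denote\<close> takes a list;
    any enumeration of the wires present after \<open>\<sigma>\<close> serves to cut both runs at
    that point.\<close>
  then obtain ws where ws: "set ws = final \<sigma> (set (leaves p))" "distinct ws"
    using finite_distinct_list by blast
  have a: "valid_run \<sigma> (leaves p) ws" using ws 1(1) by (auto simp: valid_run_def runs_append)
  have b: "valid_run ((f, x, y) # (g, x', y') # \<tau>) ws (leaves q)"
    "valid_run ((g, x', y') # (f, x, y) # \<tau>) ws (leaves q)"
    using 1(1) 2(1) ws unfolding valid_run_def runs_append final_append by auto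
  have "framed (tarr e p q) p q [] = framed (tarr e' p q) p q []"
    unfolding 1(2) 2(2) denote_append[OF a b(1)] denote_append[OF a b(2)]
    using denote_swap[OF b(1,2)] assms(6-8) by simp
  then show ?thesis using framed_inj evals_Hom assms(1,2) by blast
qed

text \<open>Each exchanged action is a single variable here, so that callers can name the pair by
  instantiating \<open>a\<close> and \<open>b\<close>.\<close>

lemma evals_unique_swap:
  assumes "evals e p (\<sigma> @ a # b # \<tau>) q []" "evals e' p (\<sigma> @ b # a # \<tau>) q []" "distinct (leaves p)"
    "runs (\<sigma> @ a # b # \<tau>) (set (leaves p))" "runs (\<sigma> @ b # a # \<tau>) (set (leaves p))"
    "set (leaves (fst (snd a))) \<inter> set (leaves (snd (snd b)))
      = {}" "set (leaves (fst (snd b))) \<inter> set (leaves (snd (snd a))) = {}"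
    "set (leaves (fst (snd a))) \<inter> set (leaves (fst (snd b))) = {}"
  shows "e = e'"
  using assms by (cases a, cases b) (auto intro: evals_unique_swap_aux)

lemma evals_swap_last: "\<lbrakk>obj p = X; obj q = Y; obj r = Z\<rbrakk>
  \<Longrightarrow> evals (swap_last C X Y Z) (PT (PT p q) r) \<sigma> (PT (PT p r) q) \<sigma>"
  unfolding swap_last_def by (rule evals_Seq evals_Tens evals_Ide evals_Assoc evals_AssocI evals_Sym
    | assumption)+

lemma evals_swap_mid: "\<lbrakk>obj a = A; obj b = B; obj x = X; obj y = Y\<rbrakk>
  \<Longrightarrow> evals (swap_mid C A B X Y) (PT (PT a b) (PT x y)) \<sigma> (PT (PT a x) (PT b y)) \<sigma>"
  unfolding swap_mid_def
  by (rule evals_Seq evals_Tens evals_Ide evals_Assoc evals_AssocI evals_Sym evals_swap_last | simp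
    (no_asm_simp); fail)+

section \<open>Equality of streams\<close>

abbreviation tens_seq (infixr "\<otimes>\<^sub>s" 70) where "X \<otimes>\<^sub>s Y \<equiv> (\<lambda>n. X n \<otimes> Y n)"

text \<open>A single time step of the operation with all objects as parameters. As a constant with
  its own evaluation rule it keeps the routing of wires out of the squares.\<close>

definition seq_act where
  "seq_act A B x y z M N a b = swap_last C A B x \<Zcomp> (a \<otimes>\<^sub>a Ide C B)
     \<Zcomp> Assoc C M y B \<Zcomp> (Ide C M \<otimes>\<^sub>a (Sym C y B \<Zcomp> b)) \<Zcomp> AssocI C M N z"
definition tens_act where
  "tens_act A B x y x' y' M N a b = swap_mid C A B x x' \<Zcomp> (a \<otimes>\<^sub>a b) \<Zcomp> swap_mid C M y N y'"
text \<open>The object \<open>s\<close> read from the store and the object \<open>t\<close> written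
  to it are separate: at time \<open>n\<close> they are \<open>delay_obj C S n\<close> and
  \<open>S n\<close>, so that time 0 is no special case.\<close>

definition fbk_act where
  "fbk_act A s x M t y a = Assoc C A s x \<Zcomp> a \<Zcomp> AssocI C M t y"

lemma evals_seq_act:
  assumes "evals a (PT pa px) \<sigma> (PT pv py) \<sigma>'" "evals b (PT pb py) \<sigma>' (PT pn pz) \<sigma>''"
    "obj pa = A" "obj pb = B" "obj px = x" "obj py = y" "obj pz = z" "obj pv = M" "obj pn = N"
  shows "evals (seq_act A B x y z M N a b) (PT (PT pa pb) px) \<sigma> (PT (PT pv pn) pz) \<sigma>''"
  unfolding seq_act_def
  by (rule evals_Seq evals_Tens evals_Ide evals_swap_last evals_Assoc evals_AssocI evals_Sym assms)+

lemma evals_tens_act: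
  assumes "evals a (PT pa px) \<sigma> (PT pv py) \<sigma>'" "evals b (PT pb px') \<sigma>' (PT pn py') \<sigma>''"
    "obj pa = A" "obj pb = B" "obj px = x" "obj py = y" "obj px' = x'" "obj py' = y'" "obj pv
      = M" "obj pn = N"
  shows "evals (tens_act A B x y x' y' M N a b) (PT (PT pa pb) (PT px px'))
    \<sigma> (PT (PT pv pn) (PT py py')) \<sigma>''"
  unfolding tens_act_def
  by (rule evals_Seq evals_Tens evals_Ide evals_swap_mid assms)+

lemma evals_fbk_act:
  assumes "evals a (PT pa (PT ps px)) \<sigma> (PT pv (PT pattern py)) \<sigma>'"
    "obj pa = A" "obj ps = s" "obj px = x" "obj py = y" "obj pattern = t" "obj pv = M"
  shows "evals (fbk_act A s x M t y a) (PT (PT pa ps) px) \<sigma> (PT (PT pv pattern) py) \<sigma>'"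
  unfolding fbk_act_def
  by (rule evals_Seq evals_Assoc evals_AssocI assms)+

lemmas evals_rules = evals_seq_act evals_tens_act evals_fbk_act evals_Seq evals_Tens evals_Ide
  evals_Assoc evals_AssocI evals_LUnit evals_LUnitI
  evals_RUnit evals_RUnitI evals_Sym evals_swap_last evals_swap_mid evals_generator

lemma struct_Hom [simp]:
  "Ide C X \<in> Hom C X X" "Assoc C X Y Z \<in> Hom C ((X \<otimes> Y) \<otimes> Z) (X \<otimes> (Y \<otimes> Z))"
  "AssocI C X Y Z \<in> Hom C (X \<otimes> (Y \<otimes> Z)) ((X \<otimes> Y) \<otimes> Z)"
  "LUnit C X \<in> Hom C (\<one> \<otimes> X) X" "LUnitI C X \<in> Hom C X (\<one> \<otimes> X)"
  "RUnit C X \<in> Hom C (X \<otimes> \<one>) X" "RUnitI X \<in> Hom C X (X \<otimes> \<one>)" "Sym C X Y \<in> Hom C (X \<otimes> Y) (Y \<otimes> X)"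
  using AssocI_inverse LUnitI_inverse RUnitI_inverse
  by (simp_all add: inverse_arrows_def Ide_Hom Sym_Hom)

section \<open>Typing and equivalence of representatives\<close>

lemma load_simps [simp]: "load C M X 0 = M \<otimes> X 0" "stl (load C M X) = stl X"
  "load C M X (Suc n) = X (Suc n)"
  by (auto simp: load_def)

lemma load_stl: "load C M (stl (load C A X)) = load C M (stl X)" by simp

lemma pre_simps [simp]: "Mem (pre C p f) = Mem f" "Now (pre C p f) = p \<Zcomp> Now f" "Later (pre C p f)
  = Later f"
  by (auto simp: pre_def)

lemma is_istream_iff: "is_istream C X Y f \<longleftrightarrow>
   Now f \<in> Hom C (X 0) (Mem f \<otimes> Y 0) \<and> is_istream C (load C (Mem f) (stl X)) (stl Y) (Later f)"
  by (subst is_istream.simps) auto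

lemma is_istream_coinduct:
  assumes "R X Y f" and step: "\<And>X Y f. R X Y f \<Longrightarrow> Now f \<in> Hom C (X 0) (Mem f \<otimes> Y 0) \<and>
     R (load C (Mem f) (stl X)) (stl Y) (Later f)"
  shows "is_istream C X Y f"
  using assms(1) by (coinduction arbitrary: X Y f) (use step in blast)

lemma is_istream_pre:
  assumes "is_istream C X Y f" "p \<in> Hom C (X' 0) (X 0)" "stl X' = stl X"
  shows "is_istream C X' Y (pre C p f)"
  using assms unfolding is_istream_iff[of X] is_istream_iff[of X'] by (auto intro: Seq_Hom)

lemma istream_eqI: "\<lbrakk>Mem f = Mem g; Now f = Now g; Later f = Later g\<rbrakk> \<Longrightarrow> f = g"
  by (rule istream.expand) simp

lemma pre_pre:
  assumes "is_istream C X Y f" "q \<in> Hom C V (X 0)" "p \<in> Hom C W V"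
  shows "pre C p (pre C q f) = pre C (p \<Zcomp> q) f"
proof -
  have "Now f \<in> Hom C (X 0) (Mem f \<otimes> Y 0)" using assms(1) unfolding is_istream_iff[of X] by blast
  from Seq_assoc[OF assms(3,2) this] show ?thesis by - (rule istream_eqI, simp_all)
qed

lemma pre_Ide:
  assumes "is_istream C X Y f" "X 0 = V"
  shows "pre C (Ide C V) f = f"
proof -
  have "Now f \<in> Hom C V (Mem f \<otimes> Y 0)" using assms unfolding is_istream_iff[of X] by blast
  then show ?thesis by - (rule istream_eqI, simp_all add: Ide_Seq)
qed

lemma equivclp_map:
  assumes "equivclp P x y" and PQ: "\<And>x y. P x y \<Longrightarrow> Q (\<phi> x) (\<phi> y)"
  shows "equivclp Q (\<phi> x) (\<phi> y)"
  using assms(1)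
proof (induction rule: equivclp_induct)
  case base then show ?case by simp
next
  case (step y z)
  then have "symclp Q (\<phi> y) (\<phi> z)" using PQ by (auto simp: symclp_def)
  then have "equivclp Q (\<phi> y) (\<phi> z)" unfolding equivclp_def by blast
  with step.IH show ?case by (rule equivclp_trans)
qed

lemma stream_eq_iff: "stream_eq C X Y f g \<longleftrightarrow> is_istream C X Y f \<and> is_istream C X Y g \<and>
    equivclp (stream_step C (stream_eq C) X Y) f g"
  by (subst stream_eq.simps) auto

text \<open>Chains over the candidate relation alone are enough: \<open>stream_step\<close> is
  monotone in the relation on rests, so they are also chains over its union with
  \<open>stream_eq\<close>.\<close>

lemma stream_eq_coinduct_steps:
  assumes "R X Y f g" and step: "\<And>X Y f g. R X Y f g \<Longrightarrow> is_istream C X Y f \<and> is_istream C X Y g \<and>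
      equivclp (stream_step C R X Y) f g"
  shows "stream_eq C X Y f g"
  using assms(1)
proof (coinduction arbitrary: X Y f g rule: stream_eq.coinduct)
  case (stream_eq X Y f g)
  let ?E = "\<lambda>x xa xb xc. (\<exists>X Y f g. x = X \<and> xa = Y \<and> xb = f \<and> xc = g \<and> R X Y f g) \<or> stream_eq C x xa xb xc"
  have "R \<le> ?E" by (auto simp: le_fun_def)
  from equivclp_stream_step_mono[OF this, of C X Y f g] step[OF stream_eq]
  show ?case by blast
qed

lemma stream_eq_refl [simp]: "stream_eq C X Y f f \<longleftrightarrow> is_istream C X Y f"
  by (subst stream_eq_iff) simp
lemma stream_eq_sym: "stream_eq C X Y f g \<Longrightarrow> stream_eq C X Y g f"
  by (subst (asm) stream_eq_iff, subst stream_eq_iff) (auto intro: equivclp_sym)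
lemma stream_eq_trans: "stream_eq C X Y f g \<Longrightarrow> stream_eq C X Y g h \<Longrightarrow> stream_eq C X Y f h"
  by (subst (asm) (1 2) stream_eq_iff, subst stream_eq_iff) (auto intro: equivclp_trans)
lemma stream_eq_is_istream: "stream_eq C X Y f g \<Longrightarrow> is_istream C X Y f \<and> is_istream C X Y g"
  by (subst (asm) stream_eq_iff) auto

lemma stream_step_is_istream: "stream_step C E X Y f g \<Longrightarrow> is_istream C X Y f \<and> is_istream C X Y g"
  by (simp add: stream_step_def)

lemma stream_eq_step: "stream_step C (stream_eq C) X Y f g \<Longrightarrow> stream_eq C X Y f g"
  by (subst stream_eq_iff) (auto intro: r_into_equivclp dest: stream_step_is_istream)

lemma stream_class_eq:
  assumes "is_istream C X Y f" "is_istream C X Y g"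
  shows "stream_class C X Y f = stream_class C X Y g \<longleftrightarrow> stream_eq C X Y f g"
proof
  assume "stream_class C X Y f = stream_class C X Y g"
  moreover have "g \<in> stream_class C X Y g" using assms by (simp add: stream_class_def)
  ultimately have "g \<in> stream_class C X Y f" by (simp only:)
  then show "stream_eq C X Y f g" by (simp add: stream_class_def)
next
  assume "stream_eq C X Y f g"
  then have "stream_eq C X Y f h \<longleftrightarrow> stream_eq C X Y g h" for h
    using stream_eq_sym stream_eq_trans by blast
  then show "stream_class C X Y f = stream_class C X Y g" by (simp add: stream_class_def)
qed

text \<open>Precomposition changes the first action at its domain, away from the memory, so each
  generating step survives with the same arrow \<open>r\<close>.\<close>

lemma stream_eq_pre:
  assumes "stream_eq C X Y f g" "p \<in> Hom C (X' 0) (X 0)" "stl X' = stl X"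
  shows "stream_eq C X' Y (pre C p f) (pre C p g)"
proof -
  have X1: "X' (Suc 0) = X (Suc 0)" using fun_cong[OF assms(3), of 0] by simp
  have "stream_step C (stream_eq C) X' Y (pre C p f) (pre C p g)" if st:
    "stream_step C (stream_eq C) X Y f g" for f g
  proof -
    have fg: "is_istream C X Y f" "is_istream C X Y g" using st by (auto simp: stream_step_def)
    then have H: "Now g \<in> Hom C (X 0) (Mem g \<otimes> Y 0)" by (simp add: is_istream_iff[of X])
    obtain r where r: "r \<in> Hom C (Mem g) (Mem f)" "Now f = Now g \<Zcomp> (r \<otimes>\<^sub>a Ide C (Y 0))"
      "stream_eq C (load C (Mem g) (stl X)) (stl Y) (pre C (r \<otimes>\<^sub>a Ide C (X 1)) (Later f)) (Later g)"
      using st unfolding stream_step_def by blast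
    have "p \<Zcomp> Now f = (p \<Zcomp> Now g) \<Zcomp> (r \<otimes>\<^sub>a Ide C (Y 0))"
      unfolding r(2) by (rule Seq_assoc[symmetric, OF assms(2) H Tens_Hom[OF r(1) Ide_Hom]])
    then show ?thesis unfolding stream_step_def using r fg assms X1
      by (auto intro: is_istream_pre)
  qed
  then have "equivclp (stream_step C (stream_eq C) X' Y) (pre C p f) (pre C p g)"
    using assms(1) by (subst (asm) stream_eq_iff) (blast intro: equivclp_map[where \<phi>="pre C p"])
  then show ?thesis using assms stream_eq_is_istream[OF assms(1)]
    by (subst stream_eq_iff) (blast intro: is_istream_pre)
qed

lemma Now_seq_mem: "Now (seq_mem C A B X Y Z f g) = seq_act A B (X 0) (Y 0) (Z 0) (Mem f) (Mem g)
  (Now f) (Now g)"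
  by (simp add: seq_act_def)
lemma Now_tens_mem: "Now (tens_mem C A B X Y X' Y' f g)
  = tens_act A B (X 0) (Y 0) (X' 0) (Y' 0) (Mem f) (Mem g) (Now f) (Now g)"
  by (simp add: tens_act_def)

lemma seq_act_Hom:
  assumes "a \<in> Hom C (A \<otimes> x) (M \<otimes> y)" "b \<in> Hom C (B \<otimes> y) (N \<otimes> z)"
  shows "seq_act A B x y z M N a b \<in> Hom C ((A \<otimes> B) \<otimes> x) ((M \<otimes> N) \<otimes> z)"
proof -
  have "evals (seq_act A B x y z M N a b) (PT (PT (PW 0 A) (PW 1 B)) (PW 2 x))
     [(a, PT (PW 0 A) (PW 2 x), PT (PW 3 M) (PW 4 y)), (b, PT (PW 1 B) (PW 4 y), PT (PW 5 N) (PW 6 z))]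
     (PT (PT (PW 3 M) (PW 5 N)) (PW 6 z)) []"
    by (rule evals_rules | (simp add: assms; fail))+
  from evals_Hom[OF this] show ?thesis by simp
qed

lemma tens_act_Hom:
  assumes "a \<in> Hom C (A \<otimes> x) (M \<otimes> y)" "b \<in> Hom C (B \<otimes> x') (N \<otimes> y')"
  shows "tens_act A B x y x' y' M N a b \<in> Hom C ((A \<otimes> B) \<otimes> (x \<otimes> x')) ((M \<otimes> N) \<otimes> (y \<otimes> y'))"
proof -
  have "evals (tens_act A B x y x' y' M N a b) (PT (PT (PW 0 A) (PW 1 B)) (PT (PW 2 x) (PW 3 x')))
     [(a, PT (PW 0 A) (PW 2 x), PT (PW 4 M) (PW 5 y)), (b, PT (PW 1 B) (PW 3 x'), PT (PW 6 N) (PW 7 y'))]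
     (PT (PT (PW 4 M) (PW 6 N)) (PT (PW 5 y) (PW 7 y'))) []"
    by (rule evals_rules | (simp add: assms; fail))+
  from evals_Hom[OF this] show ?thesis by simp
qed

lemma fbk_act_Hom:
  assumes "a \<in> Hom C (A \<otimes> (s \<otimes> x)) (M \<otimes> (t \<otimes> y))"
  shows "fbk_act A s x M t y a \<in> Hom C ((A \<otimes> s) \<otimes> x) ((M \<otimes> t) \<otimes> y)"
  unfolding fbk_act_def by (rule Seq_Hom[OF Seq_Hom[OF _ assms]]) simp_all

lemma seq_mem_is_istream:
  assumes "is_istream C (load C A X) Y f" "is_istream C (load C B Y) Z g"
  shows "is_istream C (load C (A \<otimes> B) X) Z (seq_mem C A B X Y Z f g)"
proof -
  let ?R = "\<lambda>V Z h. \<exists>A B X Y f g. V = load C (A \<otimes> B) X \<and> h = seq_mem C A B X Y Z f g \<and>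
     is_istream C (load C A X) Y f \<and> is_istream C (load C B Y) Z g"
  have "?R (load C (A \<otimes> B) X) Z (seq_mem C A B X Y Z f g)" using assms by blast
  then show ?thesis
  proof (rule is_istream_coinduct[where R="?R"])
    fix V Z h assume "?R V Z h"
    then obtain A B X Y f g where V: "V = load C (A \<otimes> B) X" and h: "h = seq_mem C A B X Y Z f g"
       and f: "is_istream C (load C A X) Y f" and g: "is_istream C (load C B Y) Z g" by blast
    note f' = f[unfolded is_istream_iff[of "load C A X"] load_simps] and g' =
      g[unfolded is_istream_iff[of "load C B Y"] load_simps]
    have "?R (load C (Mem f \<otimes> Mem g) (stl X)) (stl Z)
      (seq_mem C (Mem f) (Mem g) (stl X) (stl Y) (stl Z) (Later f) (Later g))"
      by (intro exI conjI, rule refl, rule refl) (use f' g' in auto)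
    then show "Now h \<in> Hom C (V 0) (Mem h \<otimes> Z 0) \<and> ?R (load C (Mem h) (stl V)) (stl Z) (Later h)"
      unfolding h V Now_seq_mem load_simps seq_mem.sel(1) seq_mem.sel(3)
      using f' g' seq_act_Hom by blast
  qed
qed

lemma tens_mem_is_istream:
  assumes "is_istream C (load C A X) Y f" "is_istream C (load C B X') Y' g"
  shows "is_istream C (load C (A \<otimes> B) (X \<otimes>\<^sub>s X')) (Y \<otimes>\<^sub>s Y') (tens_mem C A B X Y X' Y' f g)"
proof -
  let ?R = "\<lambda>V W h. \<exists>A B X Y X' Y' f g. V = load C (A \<otimes> B) (X \<otimes>\<^sub>s X') \<and> W = (Y \<otimes>\<^sub>s Y') \<and>
     h = tens_mem C A B X Y X' Y' f g \<and> is_istream C (load C A X) Y f \<and> is_istream C (load C B X') Y' g"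
  have "?R (load C (A \<otimes> B) (X \<otimes>\<^sub>s X')) (Y \<otimes>\<^sub>s Y') (tens_mem C A B X Y X' Y' f g)" using assms by blast
  then show ?thesis
  proof (rule is_istream_coinduct[where R="?R"])
    fix V W h assume "?R V W h"
    then obtain A B X Y X' Y' f g where V: "V = load C (A \<otimes> B) (X \<otimes>\<^sub>s X')" "W = (Y \<otimes>\<^sub>s Y')"
       and h: "h = tens_mem C A B X Y X' Y' f g"
       and f: "is_istream C (load C A X) Y f" and g: "is_istream C (load C B X') Y' g" by blast
    note f' = f[unfolded is_istream_iff[of "load C A X"] load_simps] and g' =
      g[unfolded is_istream_iff[of "load C B X'"] load_simps]
    have "?R (load C (Mem f \<otimes> Mem g) (\<lambda>n. X (Suc n) \<otimes> X' (Suc n))) (\<lambda>n. Y (Suc n) \<otimes> Y' (Suc n))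
      (tens_mem C (Mem f) (Mem g) (stl X) (stl Y) (stl X') (stl Y') (Later f) (Later g))"
      by (intro exI conjI, rule refl, rule refl, rule refl) (use f' g' in auto)
    then show "Now h \<in> Hom C (V 0) (Mem h \<otimes> W 0) \<and> ?R (load C (Mem h) (stl V)) (stl W) (Later h)"
      unfolding h V Now_tens_mem load_simps tens_mem.sel(1) tens_mem.sel(3)
      using f' g' tens_act_Hom by blast
  qed
qed

text \<open>A generating step slides an arrow into the rest. For coinduction the operation has to
  hand that arrow on to the rests of its arguments, which this equation between representatives
  provides.\<close>

lemma seq_mem_pre:
  assumes f: "is_istream C (load C A X) Y f" and g: "is_istream C (load C B Y) Z g"
    and p: "p \<in> Hom C A' A" and q: "q \<in> Hom C B' B"
  shows "pre C ((p \<otimes>\<^sub>a q) \<otimes>\<^sub>a Ide C (X 0)) (seq_mem C A B X Y Z f g)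
    = seq_mem C A' B' X Y Z (pre C (p \<otimes>\<^sub>a Ide C (X 0)) f) (pre C (q \<otimes>\<^sub>a Ide C (Y 0)) g)"
proof (rule istream_eqI)
  have H: "Now f \<in> Hom C (A \<otimes> X 0) (Mem f \<otimes> Y 0)" "Now g \<in> Hom C (B \<otimes> Y 0) (Mem g \<otimes> Z 0)"
    using f[unfolded is_istream_iff[of "load C A X"]] g[unfolded is_istream_iff[of "load C B Y"]] by auto
  show "Now (pre C ((p \<otimes>\<^sub>a q) \<otimes>\<^sub>a Ide C (X 0)) (seq_mem C A B X Y Z f g))
    = Now (seq_mem C A' B' X Y Z (pre C (p \<otimes>\<^sub>a Ide C (X 0)) f) (pre C (q \<otimes>\<^sub>a Ide C (Y 0)) g))"
    unfolding Now_seq_mem pre_simps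
    \<comment> \<open>The left side runs \<open>p\<close> and \<open>q\<close> before
      \<open>Now f\<close>, the right side runs \<open>q\<close> just before \<open>Now g\<close>;
      hence one exchange of \<open>q\<close> with \<open>Now f\<close>.\<close>
    by (rule evals_unique_swap[where p="PT (PT (PW 0 A') (PW 1 B')) (PW 2 (X 0))"
      and \<sigma>="[(p, PW 0 A', PW 3 A)]"
        and a="(q, PW 1 B', PW 4 B)"
          and b="(Now f, PT (PW 3 A) (PW 2 (X 0)), PT (PW 5 (Mem f)) (PW 6 (Y 0)))"
        and \<tau>="[(Now g, PT (PW 4 B) (PW 6 (Y 0)), PT (PW 7 (Mem g)) (PW 8 (Z 0)))]", unfolded append.simps],
        (rule evals_rules | (simp add: H p q; fail))+)
qed simp_all

lemma tens_mem_pre: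
  assumes f: "is_istream C (load C A X) Y f" and g: "is_istream C (load C B X') Y' g"
    and p: "p \<in> Hom C A' A" and q: "q \<in> Hom C B' B"
  shows "pre C ((p \<otimes>\<^sub>a q) \<otimes>\<^sub>a Ide C (X 0 \<otimes> X' 0)) (tens_mem C A B X Y X' Y' f g)
    = tens_mem C A' B' X Y X' Y' (pre C (p \<otimes>\<^sub>a Ide C (X 0)) f) (pre C (q \<otimes>\<^sub>a Ide C (X' 0)) g)"
proof (rule istream_eqI)
  have H: "Now f \<in> Hom C (A \<otimes> X 0) (Mem f \<otimes> Y 0)" "Now g \<in> Hom C (B \<otimes> X' 0) (Mem g \<otimes> Y' 0)"
    using f[unfolded is_istream_iff[of "load C A X"]] g[unfolded is_istream_iff[of "load C B X'"]] by auto
  show "Now (pre C ((p \<otimes>\<^sub>a q) \<otimes>\<^sub>a Ide C (X 0 \<otimes> X' 0)) (tens_mem C A B X Y X' Y' f g))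
    = Now (tens_mem C A' B' X Y X' Y' (pre C (p \<otimes>\<^sub>a Ide C (X 0)) f) (pre C (q \<otimes>\<^sub>a Ide C (X' 0)) g))"
    unfolding Now_tens_mem pre_simps
    by (rule evals_unique_swap[where p="PT (PT (PW 0 A') (PW 1 B')) (PT (PW 2 (X 0)) (PW 3 (X' 0)))"
      and \<sigma>="[(p, PW 0 A', PW 4 A)]"
        and a="(q, PW 1 B', PW 5 B)"
          and b="(Now f, PT (PW 4 A) (PW 2 (X 0)), PT (PW 6 (Mem f)) (PW 7 (Y 0)))"
        and \<tau>="[(Now g, PT (PW 5 B) (PW 3 (X' 0)), PT (PW 8 (Mem g)) (PW 9 (Y' 0)))]", unfolded
          append.simps],
        (rule evals_rules | (simp add: H p q; fail))+)
qed simp_all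

section \<open>The operations respect the equivalence\<close>

lemma stream_stepE:
  assumes "stream_step C E X Y f g"
  obtains r where "is_istream C X Y f" "is_istream C X Y g" "r \<in> Hom C (Mem g) (Mem f)"
    "Now f = Now g \<Zcomp> (r \<otimes>\<^sub>a Ide C (Y 0))"
    "E (load C (Mem g) (stl X)) (stl Y) (pre C (r \<otimes>\<^sub>a Ide C (X 1)) (Later f)) (Later g)"
  using assms unfolding stream_step_def by blast

text \<open>
  Congruence for a family \<open>\<phi>\<close> of corecursive operations. Chains of generating steps are mapped
  step by step, so that only a single step has to be considered.
\<close>
lemma stream_eq_map:
  assumes R: "R X Y V W \<phi>" and eq: "stream_eq C V W f g"
    and typed: "\<And>X Y V W \<phi> f. \<lbrakk>R X Y V W \<phi>; is_istream C V W f\<rbrakk> \<Longrightarrow> is_istream C X Y (\<phi> f)"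
    and step: "\<And>X Y V W \<phi> f g r. \<lbrakk>R X Y V W \<phi>; is_istream C V W f; is_istream C V W g; r \<in> Hom C
      (Mem g) (Mem f);
        Now f = Now g \<Zcomp> (r \<otimes>\<^sub>a Ide C (W 0));
        stream_eq C (load C (Mem g) (stl V)) (stl W) (pre C (r \<otimes>\<^sub>a Ide C (V 1)) (Later f)) (Later g)\<rbrakk> \<Longrightarrow>
       \<exists>s V' W' \<phi>' f' g'. s \<in> Hom C (Mem (\<phi> g)) (Mem (\<phi> f)) \<and> Now (\<phi> f) = Now (\<phi> g) \<Zcomp> (s \<otimes>\<^sub>a Ide C (Y 0)) \<and>
         pre C (s \<otimes>\<^sub>a Ide C (X 1)) (Later (\<phi> f)) = \<phi>' f' \<and> Later (\<phi> g) = \<phi>' g' \<and>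
         R (load C (Mem (\<phi> g)) (stl X)) (stl Y) V' W' \<phi>' \<and> stream_eq C V' W' f' g'"
  shows "stream_eq C X Y (\<phi> f) (\<phi> g)"
proof -
  let ?R = "\<lambda>X Y h h'. \<exists>V W \<phi> f g. h = \<phi> f \<and> h' = \<phi> g \<and> R X Y V W \<phi> \<and> stream_eq C V W f g"
  have "?R X Y (\<phi> f) (\<phi> g)" using R eq by blast
  then show ?thesis
  proof (rule stream_eq_coinduct_steps[where R="?R"])
    fix X Y h h' assume "?R X Y h h'"
    then obtain V W \<phi> f g where h: "h = \<phi> f" "h' = \<phi> g" and R: "R X Y V W \<phi>" and eq:
      "stream_eq C V W f g" by blast
    have "stream_step C ?R X Y (\<phi> f) (\<phi> g)" if "stream_step C (stream_eq C) V W f g" for f g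
      using that
    proof (rule stream_stepE)
      fix r assume a: "is_istream C V W f" "is_istream C V W g" "r \<in> Hom C (Mem g) (Mem f)"
        "Now f = Now g \<Zcomp> (r \<otimes>\<^sub>a Ide C (W 0))"
        "stream_eq C (load C (Mem g) (stl V)) (stl W) (pre C (r \<otimes>\<^sub>a Ide C (V 1)) (Later f)) (Later g)"
      from step[OF R a] typed[OF R a(1)] typed[OF R a(2)] show ?thesis
        unfolding stream_step_def by blast
    qed
    then have "equivclp (stream_step C ?R X Y) h h'" unfolding h
      by (rule equivclp_map[where \<phi>=\<phi>, rotated]) (use eq stream_eq_iff[of V] in blast)+
    then show "is_istream C X Y h \<and> is_istream C X Y h' \<and> equivclp (stream_step C ?R X Y) h h'"
      using typed[OF R] eq stream_eq_is_istream unfolding h by blast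
  qed
qed

lemma stream_eq_map_stepI:
  assumes "s \<in> Hom C (Mem (\<phi> g)) (Mem (\<phi> f))" "Now (\<phi> f) = Now (\<phi> g) \<Zcomp> (s \<otimes>\<^sub>a Ide C (Y 0))"
    "pre C (s \<otimes>\<^sub>a Ide C (X 1)) (Later (\<phi> f)) = \<phi>' f'" "Later (\<phi> g) = \<phi>' g'"
    "R (load C (Mem (\<phi> g)) (stl X)) (stl Y) V' W' \<phi>'" "stream_eq C V' W' f' g'"
  shows "\<exists>s V' W' \<phi>' f' g'. s \<in> Hom C (Mem (\<phi> g)) (Mem (\<phi> f)) \<and> Now (\<phi> f) = Now (\<phi> g)
    \<Zcomp> (s \<otimes>\<^sub>a Ide C (Y 0)) \<and>
         pre C (s \<otimes>\<^sub>a Ide C (X 1)) (Later (\<phi> f)) = \<phi>' f' \<and> Later (\<phi> g) = \<phi>' g' \<and>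
         R (load C (Mem (\<phi> g)) (stl X)) (stl Y) V' W' \<phi>' \<and> stream_eq C V' W' f' g'"
  using assms by blast

lemma is_istream_loadD:
  assumes "is_istream C (load C A X) Y f"
  shows "Now f \<in> Hom C (A \<otimes> X 0) (Mem f \<otimes> Y 0)" "is_istream C (load C (Mem f) (stl X)) (stl Y) (Later f)"
  using assms unfolding is_istream_iff[of "load C A X"] by auto

text \<open>A step along \<open>r\<close> becomes a step along
  \<open>r \<otimes>\<^sub>a Ide C (Mem g)\<close>. As \<open>r\<close> touches only the new memory
  of the first factor, it may be postponed until after \<open>Now g\<close>.\<close>

lemma stream_eq_seq_mem_left:
  assumes eq: "stream_eq C (load C A X) Y f f'" and g: "is_istream C (load C B Y) Z g"
  shows "stream_eq C (load C (A \<otimes> B) X) Z (seq_mem C A B X Y Z f g) (seq_mem C A B X Y Z f' g)"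
proof -
  let ?R = "\<lambda>U Z V Y \<phi>. \<exists>A B X g. U = load C (A \<otimes> B) X \<and> V = load C A X \<and> \<phi>
    = (\<lambda>f. seq_mem C A B X Y Z f g) \<and>
    is_istream C (load C B Y) Z g"
  have "?R (load C (A \<otimes> B) X) Z (load C A X) Y (\<lambda>f. seq_mem C A B X Y Z f g)" using g by blast
  from this eq show ?thesis
  proof (rule stream_eq_map[where R="?R" and \<phi>="\<lambda>f. seq_mem C A B X Y Z f g"], goal_cases)
    case 1 then show ?case using seq_mem_is_istream by auto
  next
    case (2 U Z V Y \<phi> f f' r)
    then obtain A B X g where U: "U = load C (A \<otimes> B) X" "V = load C A X" "\<phi> = (\<lambda>f. seq_mem C A B X Y Z f g)"
      and g: "is_istream C (load C B Y) Z g" by blast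
    note r = 2(4,5) and eq = 2(6)
    note f = 2(2,3)[unfolded U, THEN is_istream_loadD(1)] 2(2,3)[unfolded U, THEN is_istream_loadD(2)]
    note g = is_istream_loadD[OF g]
    let ?\<phi> = "\<lambda>h. seq_mem C (Mem f') (Mem g) (stl X) (stl Y) (stl Z) h (Later g)"
    have N: "Now (\<phi> f) = Now (\<phi> f') \<Zcomp> ((r \<otimes>\<^sub>a Ide C (Mem g)) \<otimes>\<^sub>a Ide C (Z 0))"
      unfolding U Now_seq_mem r(2)
      by (rule evals_unique_swap[where p="PT (PT (PW 0 A) (PW 1 B)) (PW 2 (X 0))"
          and \<sigma>="[(Now f', PT (PW 0 A) (PW 2 (X 0)), PT (PW 3 (Mem f')) (PW 4 (Y 0)))]"
          and a="(r, PW 3 (Mem f'), PW 5 (Mem f))"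
            and b="(Now g, PT (PW 1 B) (PW 4 (Y 0)), PT (PW 6 (Mem g)) (PW 7 (Z 0)))"
          and \<tau>="[]", unfolded append.simps],
          (rule evals_rules | (simp add: f g r(1); fail))+)
    have L: "pre C ((r \<otimes>\<^sub>a Ide C (Mem g)) \<otimes>\<^sub>a Ide C (U 1)) (Later (\<phi> f))
      = ?\<phi> (pre C (r \<otimes>\<^sub>a Ide C (V 1)) (Later f))"
      using seq_mem_pre[OF f(3) g(2) r(1) Ide_Hom] pre_Ide[OF g(2)] by (simp add: U Tens_Ide)
    have RR: "?R (load C (Mem (\<phi> f')) (stl U)) (stl Z) (load C (Mem f') (stl V)) (stl Y) ?\<phi>"
      unfolding U load_stl seq_mem.sel(1) by (intro exI conjI, (rule refl g(2))+)
    have Ls: "Later (\<phi> f') = ?\<phi> (Later f')" by (simp add: U)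
    have hom: "r \<otimes>\<^sub>a Ide C (Mem g) \<in> Hom C (Mem (\<phi> f')) (Mem (\<phi> f))" using r(1) by (simp add: U Tens_Hom)
    show ?case
      by (rule stream_eq_map_stepI[where R="?R" and X=U and Y=Z and \<phi>=\<phi> and \<phi>'="?\<phi>" and f=f
        and g=f', OF hom N L Ls RR eq])
  qed
qed

text \<open>The varying factor acts last, so \<open>r\<close> already follows everything else and no
  exchange occurs. Its codomain is that of the composite, whence \<open>Z' = Z\<close> in the
  relation.\<close>

lemma stream_eq_seq_mem_right:
  assumes eq: "stream_eq C (load C B Y) Z g g'" and f: "is_istream C (load C A X) Y f"
  shows "stream_eq C (load C (A \<otimes> B) X) Z (seq_mem C A B X Y Z f g) (seq_mem C A B X Y Z f g')"
proof -
  let ?R = "\<lambda>U Z V Z' \<phi>. Z' = Z \<and> (\<exists>A B X Y f. U = load C (A \<otimes> B) X \<and> V = load C B Y \<and>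
    \<phi> = (\<lambda>g. seq_mem C A B X Y Z f g) \<and> is_istream C (load C A X) Y f)"
  have "?R (load C (A \<otimes> B) X) Z (load C B Y) Z (\<lambda>g. seq_mem C A B X Y Z f g)" using f by blast
  from this eq show ?thesis
  proof (rule stream_eq_map[where R="?R" and \<phi>="\<lambda>g. seq_mem C A B X Y Z f g"], goal_cases)
    case 1 then show ?case using seq_mem_is_istream by auto
  next
    case (2 U Z V Z' \<phi> g g' r)
    then obtain A B X Y f where Z: "Z' = Z" and U: "U = load C (A \<otimes> B) X" "V = load C B Y" "\<phi>
      = (\<lambda>g. seq_mem C A B X Y Z f g)"
      and f: "is_istream C (load C A X) Y f" by blast
    note r = 2(4,5) and eq = 2(6)
    note g = 2(2,3)[unfolded U Z, THEN is_istream_loadD(1)] 2(2,3)[unfolded U Z, THEN is_istream_loadD(2)]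
    note eq = eq[unfolded Z] note r = r[unfolded Z]
    note f = is_istream_loadD[OF f]
    let ?\<phi> = "\<lambda>h. seq_mem C (Mem f) (Mem g') (stl X) (stl Y) (stl Z) (Later f) h"
    have N: "Now (\<phi> g) = Now (\<phi> g') \<Zcomp> ((Ide C (Mem f) \<otimes>\<^sub>a r) \<otimes>\<^sub>a Ide C (Z 0))"
      unfolding U Now_seq_mem r(2)
      by (rule evals_unique[where p="PT (PT (PW 0 A) (PW 1 B)) (PW 2 (X 0))"
          and \<sigma>="[(Now f, PT (PW 0 A) (PW 2 (X 0)), PT (PW 3 (Mem f)) (PW 4 (Y 0))),
            (Now g', PT (PW 1 B) (PW 4 (Y 0)), PT (PW 5 (Mem g')) (PW 6 (Z 0))),
              (r, PW 5 (Mem g'), PW 7 (Mem g))]"],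
          (rule evals_rules | (simp add: f g r(1); fail))+)
    have L: "pre C ((Ide C (Mem f) \<otimes>\<^sub>a r) \<otimes>\<^sub>a Ide C (U 1)) (Later (\<phi> g))
      = ?\<phi> (pre C (r \<otimes>\<^sub>a Ide C (V 1)) (Later g))"
      using seq_mem_pre[OF f(2) g(3) Ide_Hom r(1)] pre_Ide[OF f(2)] by (simp add: U Tens_Ide)
    have RR: "?R (load C (Mem (\<phi> g')) (stl U)) (stl Z) (load C (Mem g') (stl V)) (stl Z) ?\<phi>"
      unfolding U load_stl seq_mem.sel(1) by (intro exI conjI, (rule refl f(2))+)
    have Ls: "Later (\<phi> g') = ?\<phi> (Later g')" by (simp add: U)
    have hom: "Ide C (Mem f) \<otimes>\<^sub>a r \<in> Hom C (Mem (\<phi> g')) (Mem (\<phi> g))" using r(1) by (simp add: U Tens_Hom)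
    show ?case
      by (rule stream_eq_map_stepI[where R="?R" and X=U and Y=Z and \<phi>=\<phi> and \<phi>'="?\<phi>" and f=g
        and g=g', OF hom N L Ls RR eq])
  qed
qed

lemma stream_eq_tens_mem_left:
  assumes eq: "stream_eq C (load C A X) Y f f'" and g: "is_istream C (load C B X') Y' g"
  shows "stream_eq C (load C (A \<otimes> B) (X \<otimes>\<^sub>s X')) (Y \<otimes>\<^sub>s Y')
    (tens_mem C A B X Y X' Y' f g) (tens_mem C A B X Y X' Y' f' g)"
proof -
  let ?R = "\<lambda>U Z V Y \<phi>. \<exists>A B X X' Y' g. Z = (Y \<otimes>\<^sub>s Y') \<and> U = load C (A \<otimes> B) (X \<otimes>\<^sub>s X') \<and> V = load C A X \<and>
    \<phi> = (\<lambda>f. tens_mem C A B X Y X' Y' f g) \<and> is_istream C (load C B X') Y' g"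
  have "?R (load C (A \<otimes> B) (X \<otimes>\<^sub>s X')) (Y \<otimes>\<^sub>s Y') (load C A X) Y (\<lambda>f. tens_mem C A B X Y X' Y' f g)"
    using g by blast
  from this eq show ?thesis
  proof (rule stream_eq_map[where R="?R" and \<phi>="\<lambda>f. tens_mem C A B X Y X' Y' f g"], goal_cases)
    case 1 then show ?case using tens_mem_is_istream by auto
  next
    case (2 U Z V Y \<phi> f f' r)
    then obtain A B X X' Y' g where U: "U = load C (A \<otimes> B) (X \<otimes>\<^sub>s X')" "V = load C A X" "\<phi>
      = (\<lambda>f. tens_mem C A B X Y X' Y' f g)"
      and Z: "Z = (Y \<otimes>\<^sub>s Y')" and g: "is_istream C (load C B X') Y' g" by blast
    note r = 2(4,5) and eq = 2(6)
    note f = 2(2,3)[unfolded U, THEN is_istream_loadD(1)] 2(2,3)[unfolded U, THEN is_istream_loadD(2)]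
    note g = is_istream_loadD[OF g]
    let ?\<phi> = "\<lambda>h. tens_mem C (Mem f') (Mem g) (stl X) (stl Y) (stl X') (stl Y') h (Later g)"
    have N: "Now (\<phi> f) = Now (\<phi> f') \<Zcomp> ((r \<otimes>\<^sub>a Ide C (Mem g)) \<otimes>\<^sub>a Ide C (Z 0))"
      unfolding U Z Now_tens_mem r(2)
      by (rule evals_unique_swap[where p="PT (PT (PW 0 A) (PW 1 B)) (PT (PW 2 (X 0)) (PW 3 (X' 0)))"
          and \<sigma>="[(Now f', PT (PW 0 A) (PW 2 (X 0)), PT (PW 4 (Mem f')) (PW 5 (Y 0)))]"
          and a="(r, PW 4 (Mem f'), PW 6 (Mem f))"
            and b="(Now g, PT (PW 1 B) (PW 3 (X' 0)), PT (PW 7 (Mem g)) (PW 8 (Y' 0)))"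
          and \<tau>="[]", unfolded append.simps],
          (rule evals_rules | (simp add: f g r(1); fail))+)
    have L: "pre C ((r \<otimes>\<^sub>a Ide C (Mem g)) \<otimes>\<^sub>a Ide C (U 1)) (Later (\<phi> f))
      = ?\<phi> (pre C (r \<otimes>\<^sub>a Ide C (V 1)) (Later f))"
      using tens_mem_pre[OF f(3) g(2) r(1) Ide_Hom] pre_Ide[OF g(2)] by (simp add: U Tens_Ide)
    have RR: "?R (load C (Mem (\<phi> f')) (stl U)) (stl Z) (load C (Mem f') (stl V)) (stl Y) ?\<phi>"
      unfolding U Z load_stl tens_mem.sel(1) by (intro exI conjI, (rule refl g(2))+)
    have Ls: "Later (\<phi> f') = ?\<phi> (Later f')" by (simp add: U)
    have hom: "r \<otimes>\<^sub>a Ide C (Mem g) \<in> Hom C (Mem (\<phi> f')) (Mem (\<phi> f))" using r(1) by (simp add: U Tens_Hom)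
    show ?case
      by (rule stream_eq_map_stepI[where R="?R" and X=U and Y=Z and \<phi>=\<phi> and \<phi>'="?\<phi>" and f=f
        and g=f', OF hom N L Ls RR eq])
  qed
qed

lemma stream_eq_tens_mem_right:
  assumes eq: "stream_eq C (load C B X') Y' g g'" and f: "is_istream C (load C A X) Y f"
  shows "stream_eq C (load C (A \<otimes> B) (X \<otimes>\<^sub>s X')) (Y \<otimes>\<^sub>s Y')
    (tens_mem C A B X Y X' Y' f g) (tens_mem C A B X Y X' Y' f g')"
proof -
  let ?R = "\<lambda>U Z V Y' \<phi>. \<exists>A B X X' Y f. Z = (Y \<otimes>\<^sub>s Y') \<and> U = load C (A \<otimes> B) (X \<otimes>\<^sub>s X') \<and> V = load C B X' \<and>
    \<phi> = (\<lambda>g. tens_mem C A B X Y X' Y' f g) \<and> is_istream C (load C A X) Y f"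
  have "?R (load C (A \<otimes> B) (X \<otimes>\<^sub>s X')) (Y \<otimes>\<^sub>s Y') (load C B X') Y'
    (\<lambda>g. tens_mem C A B X Y X' Y' f g)" using f by blast
  from this eq show ?thesis
  proof (rule stream_eq_map[where R="?R" and \<phi>="\<lambda>g. tens_mem C A B X Y X' Y' f g"], goal_cases)
    case 1 then show ?case using tens_mem_is_istream by auto
  next
    case (2 U Z V Y' \<phi> g g' r)
    then obtain A B X X' Y f where U: "U = load C (A \<otimes> B) (X \<otimes>\<^sub>s X')" "V = load C B X'" "\<phi>
      = (\<lambda>g. tens_mem C A B X Y X' Y' f g)"
      and Z: "Z = (Y \<otimes>\<^sub>s Y')" and f: "is_istream C (load C A X) Y f" by blast
    note r = 2(4,5) and eq = 2(6)
    note g = 2(2,3)[unfolded U, THEN is_istream_loadD(1)] 2(2,3)[unfolded U, THEN is_istream_loadD(2)]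
    note f = is_istream_loadD[OF f]
    let ?\<phi> = "\<lambda>h. tens_mem C (Mem f) (Mem g') (stl X) (stl Y) (stl X') (stl Y') (Later f) h"
    have N: "Now (\<phi> g) = Now (\<phi> g') \<Zcomp> ((Ide C (Mem f) \<otimes>\<^sub>a r) \<otimes>\<^sub>a Ide C (Z 0))"
      unfolding U Z Now_tens_mem r(2)
      by (rule evals_unique[where p="PT (PT (PW 0 A) (PW 1 B)) (PT (PW 2 (X 0)) (PW 3 (X' 0)))"
          and \<sigma>="[(Now f, PT (PW 0 A) (PW 2 (X 0)), PT (PW 4 (Mem f)) (PW 5 (Y 0))),
            (Now g', PT (PW 1 B) (PW 3 (X' 0)), PT (PW 6 (Mem g')) (PW 7 (Y' 0))),
              (r, PW 6 (Mem g'), PW 8 (Mem g))]"],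
          (rule evals_rules | (simp add: f g r(1); fail))+)
    have L: "pre C ((Ide C (Mem f) \<otimes>\<^sub>a r) \<otimes>\<^sub>a Ide C (U 1)) (Later (\<phi> g))
      = ?\<phi> (pre C (r \<otimes>\<^sub>a Ide C (V 1)) (Later g))"
      using tens_mem_pre[OF f(2) g(3) Ide_Hom r(1)] pre_Ide[OF f(2)] by (simp add: U Tens_Ide)
    have RR: "?R (load C (Mem (\<phi> g')) (stl U)) (stl Z) (load C (Mem g') (stl V)) (stl Y') ?\<phi>"
      unfolding U Z load_stl tens_mem.sel(1) by (intro exI conjI, (rule refl f(2))+)
    have Ls: "Later (\<phi> g') = ?\<phi> (Later g')" by (simp add: U)
    have hom: "Ide C (Mem f) \<otimes>\<^sub>a r \<in> Hom C (Mem (\<phi> g')) (Mem (\<phi> g))" using r(1) by (simp add: U Tens_Hom)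
    show ?case
      by (rule stream_eq_map_stepI[where R="?R" and X=U and Y=Z and \<phi>=\<phi> and \<phi>'="?\<phi>" and f=g
        and g=g', OF hom N L Ls RR eq])
  qed
qed

lemma delay_obj_simps [simp]: "delay_obj C X 0 = \<one>" "delay_obj C X (Suc n) = X n"
  by (auto simp: delay_obj_def)

abbreviation fbk_dom where "fbk_dom S X \<equiv> (\<lambda>n. delay_obj C S n \<otimes> X n)"

text \<open>The rearrangement inside \<open>Later\<close> of \<open>fbk_mem\<close>: it takes the
  stored value out of the memory and puts it in place of the unit in the input.\<close>

definition fbk_rest where
  "fbk_rest M s x = Assoc C M s (\<one> \<otimes> x) \<Zcomp> (Ide C M \<otimes>\<^sub>a (Ide C s \<otimes>\<^sub>a LUnit C x))"

lemma evals_fbk_rest: "\<lbrakk>obj pv = M; obj ps = s; obj px = x\<rbrakk> \<Longrightarrow>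
    evals (fbk_rest M s x) (PT (PT pv ps) (PT PU px)) \<sigma> (PT pv (PT ps px)) \<sigma>"
  unfolding fbk_rest_def by (rule evals_rules | simp; fail)+

lemma fbk_rest_Hom: "fbk_rest M s x \<in> Hom C ((M \<otimes> s) \<otimes> (\<one> \<otimes> x)) (M \<otimes> (s \<otimes> x))"
  using evals_Hom[OF evals_fbk_rest[of "PW 0 M" M "PW 1 s" s "PW 2 x" x "[]"]] by simp

lemma Later_fbk_mem: "Later (fbk_mem C N S X Y f) =
   fbk_mem C (Mem f \<otimes> S 0) (stl S) (stl X) (stl Y) (pre C (fbk_rest (Mem f) (S 0) (X 1)) (Later f))"
  by (simp add: fbk_rest_def)

lemma fbk_is_istreamD:
  assumes "is_istream C (load C N (fbk_dom S X)) (S \<otimes>\<^sub>s Y) f"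
  shows "Now f \<in> Hom C (N \<otimes> (\<one> \<otimes> X 0)) (Mem f \<otimes> (S 0 \<otimes> Y 0))"
    "is_istream C (load C (Mem f) (\<lambda>n. S n \<otimes> X (Suc n))) (\<lambda>n. S (Suc n) \<otimes> Y (Suc n)) (Later f)"
    "is_istream C (load C (Mem f \<otimes> S 0) (fbk_dom (stl S) (stl X))) (\<lambda>n. S (Suc n) \<otimes> Y (Suc n))
      (pre C (fbk_rest (Mem f) (S 0) (X 1)) (Later f))"
proof -
  show "Now f \<in> Hom C (N \<otimes> (\<one> \<otimes> X 0)) (Mem f \<otimes> (S 0 \<otimes> Y 0))"
    "is_istream C (load C (Mem f) (\<lambda>n. S n \<otimes> X (Suc n))) (\<lambda>n. S (Suc n) \<otimes> Y (Suc n)) (Later f)"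
    using is_istream_loadD[OF assms] by simp_all
  then show "is_istream C (load C (Mem f \<otimes> S 0) (fbk_dom (stl S) (stl X)))
    (\<lambda>n. S (Suc n) \<otimes> Y (Suc n)) (pre C (fbk_rest (Mem f) (S 0) (X 1)) (Later f))"
    by (elim is_istream_pre) (simp_all add: fbk_rest_Hom)
qed

lemma fbk_mem_is_istream:
  assumes "is_istream C (load C N (fbk_dom S X)) (S \<otimes>\<^sub>s Y) f"
  shows "is_istream C (load C N X) Y (fbk_mem C N S X Y f)"
proof -
  let ?R = "\<lambda>U Y h. \<exists>N S X f. U = load C N X \<and> h = fbk_mem C N S X Y f \<and>
    is_istream C (load C N (fbk_dom S X)) (S \<otimes>\<^sub>s Y) f"
  have "?R (load C N X) Y (fbk_mem C N S X Y f)" using assms by blast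
  then show ?thesis
  proof (rule is_istream_coinduct[where R="?R"])
    fix U Y h assume "?R U Y h"
    then obtain N S X f where U: "U = load C N X" "h = fbk_mem C N S X Y f"
      and f: "is_istream C (load C N (fbk_dom S X)) (S \<otimes>\<^sub>s Y) f" by blast
    note f = fbk_is_istreamD[OF f]
    have "?R (load C (Mem h) (stl U)) (stl Y) (Later h)"
      unfolding U Later_fbk_mem load_stl fbk_mem.sel(1) by (intro exI conjI, (rule refl f(3))+)
    moreover have "Now h \<in> Hom C (U 0) (Mem h \<otimes> Y 0)"
      unfolding U fbk_mem.sel(1,2) load_simps
      by (rule Seq_Hom[OF Seq_Hom[OF Tens_Hom f(1)]]) simp_all
    ultimately show "Now h \<in> Hom C (U 0) (Mem h \<otimes> Y 0) \<and>
      ?R (load C (Mem h) (stl U)) (stl Y) (Later h)" by blast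
  qed
qed

lemma fbk_mem_pre:
  assumes f: "is_istream C (load C N (fbk_dom S X)) (S \<otimes>\<^sub>s Y) f" and p: "p \<in> Hom C N' N"
  shows "pre C (p \<otimes>\<^sub>a Ide C (X 0)) (fbk_mem C N S X Y f)
    = fbk_mem C N' S X Y (pre C (p \<otimes>\<^sub>a Ide C (\<one> \<otimes> X 0)) f)"
proof (rule istream_eqI)
  note f = fbk_is_istreamD[OF f]
  show "Now (pre C (p \<otimes>\<^sub>a Ide C (X 0)) (fbk_mem C N S X Y f))
    = Now (fbk_mem C N' S X Y (pre C (p \<otimes>\<^sub>a Ide C (\<one> \<otimes> X 0)) f))"
    unfolding fbk_mem.sel(2) pre_simps
    by (rule evals_unique[where p="PT (PW 0 N') (PW 1 (X 0))" and \<sigma>="[(p, PW 0 N', PW 2 N),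
       (Now f, PT (PW 2 N) (PT PU (PW 1 (X 0))), PT (PW 3 (Mem f)) (PT (PW 4 (S 0)) (PW 5 (Y 0))))]"],
      (rule evals_rules | (simp add: f p; fail))+)
qed simp_all

text \<open>The value fed back is part of the memory, so a step along \<open>r\<close> becomes one
  along \<open>r \<otimes>\<^sub>a Ide C (S 0)\<close>.\<close>

lemma stream_eq_fbk_mem:
  assumes "stream_eq C (load C N (fbk_dom S X)) (S \<otimes>\<^sub>s Y) f f'"
  shows "stream_eq C (load C N X) Y (fbk_mem C N S X Y f) (fbk_mem C N S X Y f')"
proof -
  let ?R = "\<lambda>U Y V W \<phi>. \<exists>N S X. U = load C N X \<and> \<phi> = (\<lambda>f. fbk_mem C N S X Y f) \<and> V
    = load C N (fbk_dom S X) \<and>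
     W = (S \<otimes>\<^sub>s Y)"
  have "?R (load C N X) Y (load C N (fbk_dom S X)) (S \<otimes>\<^sub>s Y) (\<lambda>f. fbk_mem C N S X Y f)" by blast
  from this assms show ?thesis
  proof (rule stream_eq_map[where R="?R" and \<phi>="\<lambda>f. fbk_mem C N S X Y f"], goal_cases)
    case 1 then show ?case using fbk_mem_is_istream by auto
  next
    case (2 U Y V W \<phi> f f' r)
    then obtain N S X where U: "U = load C N X" "\<phi> = (\<lambda>f. fbk_mem C N S X Y f)" and V: "V
      = load C N (fbk_dom S X)"
      "W = (S \<otimes>\<^sub>s Y)" by blast
    note r = 2(4,5) and eq = 2(6)
    note f = fbk_is_istreamD[OF 2(2)[unfolded V]] and f' = fbk_is_istreamD[OF 2(3)[unfolded V]]
    let ?\<phi> = "\<lambda>h. fbk_mem C (Mem f' \<otimes> S 0) (stl S) (stl X) (stl Y) h"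
    let ?c = "fbk_rest (Mem f) (S 0) (X 1)" and ?c' = "fbk_rest (Mem f') (S 0) (X 1)"
    let ?r = "r \<otimes>\<^sub>a Ide C (S 0)"
    have N: "Now (\<phi> f) = Now (\<phi> f') \<Zcomp> (?r \<otimes>\<^sub>a Ide C (Y 0))"
      unfolding U V fbk_mem.sel(2) r(2)
      by (rule evals_unique[where p="PT (PW 0 N) (PW 1 (X 0))" and \<sigma>="[
       (Now f', PT (PW 0 N) (PT PU (PW 1 (X 0))), PT (PW 3 (Mem f')) (PT (PW 4 (S 0)) (PW 5 (Y 0)))),
        (r, PW 3 (Mem f'), PW 6 (Mem f))]"],
        (rule evals_rules | (simp add: f f' r(1); fail))+)
    have hom: "?r \<in> Hom C (Mem (\<phi> f')) (Mem (\<phi> f))" using r(1) by (simp add: U Tens_Hom)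
    \<comment> \<open>Naturality of the rearrangement in the memory. After it, \<open>r\<close> acts
      directly on \<open>Later f\<close>, which is the form in which \<open>eq\<close> compares the
      rests.\<close>
    have c: "(?r \<otimes>\<^sub>a Ide C (\<one> \<otimes> X 1)) \<Zcomp> ?c = ?c' \<Zcomp> (r \<otimes>\<^sub>a Ide C (S 0 \<otimes> X 1))"
      by (rule evals_unique[where p="PT (PT (PW 0 (Mem f')) (PW 1 (S 0))) (PT PU (PW 2 (X 1)))"
        and \<sigma>="[(r, PW 0 (Mem f'), PW 3 (Mem f))]"],
        (rule evals_fbk_rest evals_rules | (simp add: r(1); fail))+)
    have "pre C (?r \<otimes>\<^sub>a Ide C (U 1)) (Later (\<phi> f))
      = ?\<phi> (pre C (?r \<otimes>\<^sub>a Ide C (\<one> \<otimes> X 1)) (pre C ?c (Later f)))"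
      using fbk_mem_pre[OF f(3), of ?r "Mem f' \<otimes> S 0"] r(1) unfolding U Later_fbk_mem
        by (simp add: Tens_Hom)
    also have "pre C (?r \<otimes>\<^sub>a Ide C (\<one> \<otimes> X 1)) (pre C ?c (Later f))
      = pre C ((?r \<otimes>\<^sub>a Ide C (\<one> \<otimes> X 1)) \<Zcomp> ?c) (Later f)"
      by (rule pre_pre[where W="(Mem f' \<otimes> S 0) \<otimes> (\<one> \<otimes> X 1)" and V="(Mem f \<otimes> S 0) \<otimes> (\<one> \<otimes> X 1)",
        OF f(2)]) (simp_all add: r(1) fbk_rest_Hom Tens_Hom)
    also have "\<dots> = pre C ?c' (pre C (r \<otimes>\<^sub>a Ide C (V 1)) (Later f))"
      unfolding c by (subst pre_pre[OF f(2)]) (use r(1) in \<open>auto simp: V intro!: fbk_rest_Hom Tens_Hom\<close>)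
    finally have L: "pre C (?r \<otimes>\<^sub>a Ide C (U 1)) (Later (\<phi> f))
      = ?\<phi> (pre C ?c' (pre C (r \<otimes>\<^sub>a Ide C (V 1)) (Later f)))" .
    have Ls: "Later (\<phi> f') = ?\<phi> (pre C ?c' (Later f'))" unfolding U Later_fbk_mem by simp
    have RR: "?R (load C (Mem (\<phi> f')) (stl U)) (stl Y)
      (load C (Mem f' \<otimes> S 0) (fbk_dom (stl S) (stl X))) (\<lambda>n. S (Suc n) \<otimes> Y (Suc n)) ?\<phi>"
      unfolding U load_stl fbk_mem.sel(1) by (intro exI conjI, (rule refl)+)
    have eq': "stream_eq C (load C (Mem f' \<otimes> S 0) (fbk_dom (stl S) (stl X))) (\<lambda>n. S (Suc n) \<otimes> Y (Suc n))
        (pre C ?c' (pre C (r \<otimes>\<^sub>a Ide C (V 1)) (Later f))) (pre C ?c' (Later f'))"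
      using eq unfolding V by (elim stream_eq_pre) (simp_all add: fbk_rest_Hom)
    show ?case
      by (rule stream_eq_map_stepI[where R="?R" and X=U and Y=Y and \<phi>=\<phi> and \<phi>'="?\<phi>" and f=f
        and g=f', OF hom N L Ls RR eq'])
  qed
qed

section \<open>Machines\<close>
abbreviation "seq_acts X Y Z M N a b \<equiv>
  (\<lambda>n. seq_act (M n) (N n) (X n) (Y n) (Z n) (M (Suc n)) (N (Suc n)) (a n) (b n))"
abbreviation "tens_acts X Y X' Y' M N a b \<equiv>
  (\<lambda>n. tens_act (M n) (N n) (X n) (Y n) (X' n) (Y' n) (M (Suc n)) (N (Suc n)) (a n) (b n))"
abbreviation "fbk_acts S X Y M a \<equiv>
  (\<lambda>n. fbk_act (M n) (delay_obj C S n) (X n) (M (Suc n)) (S n) (Y n) (a n))"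

definition actions where
  "actions X Y M a \<longleftrightarrow> (\<forall>n. a n \<in> Hom C (M n \<otimes> X n) (M (Suc n) \<otimes> Y n))"

lemma actionsD: "actions X Y M a \<Longrightarrow> a n \<in> Hom C (M n \<otimes> X n) (M (Suc n) \<otimes> Y n)"
  by (simp add: actions_def)

lemma actions_stl: "actions X Y M a \<Longrightarrow> actions (stl X) (stl Y) (stl M) (stl a)"
  by (simp add: actions_def)

lemma behaviour_is_istream:
  assumes "actions X Y M a" shows "is_istream C (load C (M 0) X) Y (behaviour M a)"
proof -
  let ?R = "\<lambda>U Y f. \<exists>X M a. U = load C (M 0) X \<and> f = behaviour M a \<and> actions X Y M a"
  have "?R (load C (M 0) X) Y (behaviour M a)" using assms by blast
  then show ?thesis
  proof (rule is_istream_coinduct[where R="?R"])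
    fix U Y f assume "?R U Y f"
    then obtain X M a where U: "U = load C (M 0) X" "f = behaviour M a" and a: "actions X Y M a" by blast
    have "?R (load C (Mem f) (stl U)) (stl Y) (Later f)"
      using actions_stl[OF a] unfolding U load_stl behaviour.sel by (metis One_nat_def)
    then show "Now f \<in> Hom C (U 0) (Mem f \<otimes> Y 0) \<and> ?R (load C (Mem f) (stl U)) (stl Y) (Later f)"
      using actionsD[OF a, of 0] by (simp add: U)
  qed
qed

text \<open>The precomposed \<open>r 0\<close> is what the preceding step has slid in. The square at
  0 turns it, past the first action, into a step along \<open>r 1\<close>, which leaves the same
  situation for the tails.\<close>

lemma stream_eq_behaviour:
  assumes "actions X Y M a" "actions X Y N b" and r: "\<And>n. r n \<in> Hom C (N n) (M n)"
    "\<And>n. (r n \<otimes>\<^sub>a Ide C (X n)) \<Zcomp> a n = b n \<Zcomp> (r (Suc n) \<otimes>\<^sub>a Ide C (Y n))"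
  shows "stream_eq C (load C (N 0) X) Y (pre C (r 0 \<otimes>\<^sub>a Ide C (X 0)) (behaviour M a)) (behaviour N b)"
proof -
  let ?R = "\<lambda>U Y f g. \<exists>X M N a b r. U = load C (N 0) X \<and> f
    = pre C (r 0 \<otimes>\<^sub>a Ide C (X 0)) (behaviour M a) \<and> g = behaviour N b \<and>
    actions X Y M a \<and> actions X Y N b \<and> (\<forall>n. r n \<in> Hom C (N n) (M n)) \<and>
    (\<forall>n. (r n \<otimes>\<^sub>a Ide C (X n)) \<Zcomp> a n = b n \<Zcomp> (r (Suc n) \<otimes>\<^sub>a Ide C (Y n)))"
  have "?R (load C (N 0) X) Y (pre C (r 0 \<otimes>\<^sub>a Ide C (X 0)) (behaviour M a)) (behaviour N b)"
    using assms by blast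
  then show ?thesis
  proof (rule stream_eq_coinduct_steps[where R="?R"])
    fix U Y f g assume "?R U Y f g"
    then obtain X M N a b r where U: "U = load C (N 0) X" "f
      = pre C (r 0 \<otimes>\<^sub>a Ide C (X 0)) (behaviour M a)" "g = behaviour N b"
      and a: "actions X Y M a" and b: "actions X Y N b" and r: "\<forall>n. r n \<in> Hom C (N n) (M n)"
       "\<forall>n. (r n \<otimes>\<^sub>a Ide C (X n)) \<Zcomp> a n = b n \<Zcomp> (r (Suc n) \<otimes>\<^sub>a Ide C (Y n))" by blast
    have i: "is_istream C U Y f" "is_istream C U Y g"
      using behaviour_is_istream[OF b]
        is_istream_pre[OF behaviour_is_istream[OF a], of "r 0 \<otimes>\<^sub>a Ide C (X 0)" U] r(1)
      by (auto simp: U Tens_Hom)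
    have "?R (load C (Mem g) (stl U)) (stl Y) (pre C (r 1 \<otimes>\<^sub>a Ide C (U 1)) (Later f)) (Later g)"
      unfolding U load_stl behaviour.sel pre_simps
      using r actions_stl[OF a] actions_stl[OF b]
      by - (rule exI[of _ "stl X"], rule exI[of _ "stl M"], rule exI[of _ "stl N"],
        rule exI[of _ "stl a"], rule exI[of _ "stl b"], rule exI[of _ "stl r"], simp)
    moreover have "r 1 \<in> Hom C (Mem g) (Mem f)" "Now f = Now g \<Zcomp> (r 1 \<otimes>\<^sub>a Ide C (Y 0))"
      using r by (simp_all add: U)
    ultimately have "stream_step C ?R U Y f g" using i unfolding stream_step_def by blast
    then show "is_istream C U Y f \<and> is_istream C U Y g \<and> equivclp (stream_step C ?R U Y) f g"
      using i by blast
  qed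
qed

lemma behaviour_seq:
  "seq_mem C (M 0) (N 0) X Y Z (behaviour M a) (behaviour N b) = behaviour (M \<otimes>\<^sub>s N)
     (seq_acts X Y Z M N a b)"
proof (coinduction arbitrary: M N X Y Z a b)
  case Eq_istream
  show ?case
  proof (intro conjI)
    show "\<exists>M' N' X' Y' Z' a' b'. Later (seq_mem C (M 0) (N 0) X Y Z (behaviour M a) (behaviour N b))
      = seq_mem C (M' 0) (N' 0) X' Y' Z' (behaviour M' a') (behaviour N' b') \<and>
       Later (behaviour (M \<otimes>\<^sub>s N) (seq_acts X Y Z M N a b)) =
         behaviour (M' \<otimes>\<^sub>s N') (\<lambda>n. seq_act (M' n) (N' n) (X' n) (Y' n) (Z' n) (M' (Suc n))
           (N' (Suc n)) (a' n) (b' n))"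
      by (rule exI[of _ "stl M"], rule exI[of _ "stl N"], rule exI[of _ "stl X"],
        rule exI[of _ "stl Y"], rule exI[of _ "stl Z"], rule exI[of _ "stl a"],
          rule exI[of _ "stl b"], simp)
  qed (simp_all add: seq_act_def)
qed

lemma behaviour_tens:
  "tens_mem C (M 0) (N 0) X Y X' Y' (behaviour M a) (behaviour N b) = behaviour (M \<otimes>\<^sub>s N)
     (tens_acts X Y X' Y' M N a b)"
proof (coinduction arbitrary: M N X Y X' Y' a b)
  case Eq_istream
  show ?case
  proof (intro conjI)
    show "\<exists>M1 N1 X1 Y1 X2 Y2 a1 b1. Later
      (tens_mem C (M 0) (N 0) X Y X' Y' (behaviour M a) (behaviour N b)) = tens_mem C (M1 0) (N1 0)
        X1 Y1 X2 Y2 (behaviour M1 a1) (behaviour N1 b1) \<and>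
       Later (behaviour (M \<otimes>\<^sub>s N) (tens_acts X Y X' Y' M N a b)) =
         behaviour (\<lambda>n. M1 n \<otimes> N1 n)
           (\<lambda>n. tens_act (M1 n) (N1 n) (X1 n) (Y1 n) (X2 n) (Y2 n) (M1 (Suc n)) (N1 (Suc n)) (a1 n) (b1 n))"
      by (rule exI[of _ "stl M"], rule exI[of _ "stl N"], rule exI[of _ "stl X"],
        rule exI[of _ "stl Y"], rule exI[of _ "stl X'"], rule exI[of _ "stl Y'"],
          rule exI[of _ "stl a"], rule exI[of _ "stl b"], simp)
  qed (simp_all add: tens_act_def)
qed

text \<open>After one step a value is stored, so coinduction needs an arbitrary object in the store.
  \<open>T\<close> lists these objects; with \<open>T = delay_obj C S\<close> one gets
  \<open>stl T = S\<close> and the unit as \<open>T 0\<close>.\<close>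

lemma behaviour_fbk:
  assumes "actions (T \<otimes>\<^sub>s X) (\<lambda>n. stl T n \<otimes> Y n) M a"
  shows "fbk_mem C (M 0 \<otimes> T 0) (stl T) X Y (pre C (fbk_rest (M 0) (T 0) (X 0)) (behaviour M a)) =
    behaviour (M \<otimes>\<^sub>s T) (\<lambda>n. fbk_act (M n) (T n) (X n) (M (Suc n)) (T (Suc n)) (Y n) (a n))"
  using assms
proof (coinduction arbitrary: M X Y T a)
  case (Eq_istream M X Y T a)
  have a: "a 0 \<in> Hom C (M 0 \<otimes> (T 0 \<otimes> X 0)) (M (Suc 0) \<otimes> (T (Suc 0) \<otimes> Y 0))"
    using actionsD[OF Eq_istream, of 0] by simp
  show ?case
  proof (intro conjI)
    show "Now (fbk_mem C (M 0 \<otimes> T 0) (stl T) X Y (pre C (fbk_rest (M 0) (T 0) (X 0)) (behaviour M a)))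
      = Now (behaviour (M \<otimes>\<^sub>s T) (\<lambda>n. fbk_act (M n) (T n) (X n) (M (Suc n)) (T (Suc n)) (Y n) (a n)))"
      unfolding fbk_mem.sel(2) behaviour.sel pre_simps
      by (rule evals_unique[where p="PT (PT (PW 0 (M 0)) (PW 1 (T 0))) (PW 2 (X 0))" and
           \<sigma>="[(a 0, PT (PW 0 (M 0)) (PT (PW 1 (T 0)) (PW 2 (X 0))),
             PT (PW 3 (M (Suc 0))) (PT (PW 4 (T (Suc 0))) (PW 5 (Y 0))))]"],
          (rule evals_fbk_rest evals_rules | (simp add: a; fail))+)
    show "\<exists>M1 X1 Y1 T1 a1. Later
      (fbk_mem C (M 0 \<otimes> T 0) (stl T) X Y (pre C (fbk_rest (M 0) (T 0) (X 0)) (behaviour M a))) =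
         fbk_mem C (M1 0 \<otimes> T1 0) (stl T1) X1 Y1 (pre C (fbk_rest (M1 0) (T1 0) (X1 0)) (behaviour M1 a1)) \<and>
       Later (behaviour (M \<otimes>\<^sub>s T) (\<lambda>n. fbk_act (M n) (T n) (X n) (M (Suc n)) (T (Suc n)) (Y n) (a n))) =
         behaviour (\<lambda>n. M1 n \<otimes> T1 n)
           (\<lambda>n. fbk_act (M1 n) (T1 n) (X1 n) (M1 (Suc n)) (T1 (Suc n)) (Y1 n) (a1 n)) \<and>
         actions (\<lambda>n. T1 n \<otimes> X1 n) (\<lambda>n. stl T1 n \<otimes> Y1 n) M1 a1"
      using actions_stl[OF Eq_istream]
      by - (rule exI[of _ "stl M"], rule exI[of _ "stl X"], rule exI[of _ "stl Y"],
        rule exI[of _ "stl T"], rule exI[of _ "stl a"], simp add: Later_fbk_mem del: fbk_mem.sel)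
  qed simp
qed

lemma behaviour_pure: "pure_mem C \<phi> = behaviour (\<lambda>n. \<one>) (\<lambda>n. Ide C \<one> \<otimes>\<^sub>a \<phi> n)"
  by (coinduction arbitrary: \<phi>) (auto intro: exI[of _ "stl _"])

text \<open>The memory at time 0 belongs to the domain and not to the representative, so any
  \<open>A\<close> may stand there; the memory at time \<open>k + 1\<close> is found
  \<open>k\<close> rests deep.\<close>

lemma behaviour_istream: "g = behaviour (case_nat A (\<lambda>k. Mem ((Later ^^ k) g))) (\<lambda>n. Now ((Later ^^ n) g))"
proof (coinduction arbitrary: g A)
  case Eq_istream
  have "\<And>n. Mem ((Later ^^ n) g) = case_nat (Mem g) (\<lambda>k. Mem ((Later ^^ k) (Later g))) n"
    by (simp split: nat.split add: funpow_swap1)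
  then show ?case by (auto simp: funpow_swap1 intro!: exI[of _ "Mem g"] arg_cong2[where f=behaviour])
qed

section \<open>Machines with an initial state as representatives\<close>

definition machine where
  "machine X Y M i a \<longleftrightarrow> i \<in> Hom C \<one> (M 0) \<and> actions X Y M a"

definition mrep where
  "mrep X M i a = pre C (LUnitI C (X 0) \<Zcomp> (i \<otimes>\<^sub>a Ide C (X 0))) (behaviour M a)"

definition marrow where
  "marrow X Y M i a = (X, Y, stream_class C X Y (mrep X M i a))"

lemma machineD: "machine X Y M i a \<Longrightarrow> i \<in> Hom C \<one> (M 0)" "machine X Y M i a \<Longrightarrow> actions X Y M a"
  "machine X Y M i a \<Longrightarrow> a n \<in> Hom C (M n \<otimes> X n) (M (Suc n) \<otimes> Y n)"
  by (auto simp: machine_def actionsD)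

lemma start_Hom: "i \<in> Hom C \<one> A \<Longrightarrow> LUnitI C x \<Zcomp> (i \<otimes>\<^sub>a Ide C x) \<in> Hom C x (A \<otimes> x)"
  by (rule Seq_Hom[OF struct_Hom(5) Tens_Hom[OF _ Ide_Hom]])

lemma mrep_is_istream: "machine X Y M i a \<Longrightarrow> is_istream C X Y (mrep X M i a)"
  unfolding mrep_def machine_def by (rule is_istream_pre[OF behaviour_is_istream]) (auto simp: start_Hom)

text \<open>The operations insert a unit by \<open>LUnit\<close> before they act. On a machine this
  cancels against \<open>LUnitI\<close> and exposes the initial state as an arrow into the loaded
  memory.\<close>

lemma LUnit_mrep:
  assumes "machine X Y M i a"
  shows "pre C (LUnit C (X 0)) (mrep X M i a) = pre C (i \<otimes>\<^sub>a Ide C (X 0)) (behaviour M a)"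
proof -
  note i = machineD[OF assms]
  have "LUnit C (X 0) \<Zcomp> (LUnitI C (X 0) \<Zcomp> (i \<otimes>\<^sub>a Ide C (X 0))) = i \<otimes>\<^sub>a Ide C (X 0)"
    by (rule evals_unique[where p="PT PU (PW 0 (X 0))" and \<sigma>="[(i, PU, PW 1 (M 0))]"],
        (rule evals_rules | (simp add: i; fail))+)
  moreover have "pre C (LUnit C (X 0)) (mrep X M i a)
    = pre C (LUnit C (X 0) \<Zcomp> (LUnitI C (X 0) \<Zcomp> (i \<otimes>\<^sub>a Ide C (X 0)))) (behaviour M a)"
    unfolding mrep_def
    by (rule pre_pre[where W="\<one> \<otimes> X 0" and V="X 0", OF behaviour_is_istream[OF i(2)]])
      (simp_all add: start_Hom i(1))
  ultimately show ?thesis by simp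
qed

text \<open>The equation \<open>init\<close> factors \<open>r 0\<close> out of the initial state
  \<open>i\<close>; what remains is \<open>stream_eq_behaviour\<close>, precomposed with the start
  of the second machine.\<close>

lemma mrep_simI:
  assumes a: "machine X Y M i a" and b: "machine X Y N j b" and r: "\<And>n. r n \<in> Hom C (N n) (M n)"
    and init: "j \<Zcomp> r 0 = i"
    and step: "\<And>n. (r n \<otimes>\<^sub>a Ide C (X n)) \<Zcomp> a n = b n \<Zcomp> (r (Suc n) \<otimes>\<^sub>a Ide C (Y n))"
  shows "stream_eq C X Y (mrep X M i a) (mrep X N j b)"
proof -
  note i = machineD[OF a] and j = machineD[OF b]
  have "LUnitI C (X 0) \<Zcomp> (i \<otimes>\<^sub>a Ide C (X 0)) = (LUnitI C (X 0) \<Zcomp> (j \<otimes>\<^sub>a Ide C (X 0)))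
    \<Zcomp> (r 0 \<otimes>\<^sub>a Ide C (X 0))"
    unfolding init[symmetric]
    by (rule evals_unique[where p="PW 0 (X 0)"
      and \<sigma>="[(j, PU, PW 1 (N 0)), (r 0, PW 1 (N 0), PW 2 (M 0))]"],
        (rule evals_rules | (simp add: i j r; fail))+)
  then have "mrep X M i a = pre C (LUnitI C (X 0) \<Zcomp> (j \<otimes>\<^sub>a Ide C (X 0)))
    (pre C (r 0 \<otimes>\<^sub>a Ide C (X 0)) (behaviour M a))"
    unfolding mrep_def by (subst
      pre_pre[where W="X 0" and V="N 0 \<otimes> X 0", OF behaviour_is_istream[OF i(2)]])
        (simp_all add: start_Hom[OF j(1)] Tens_Hom r)
  then show ?thesis unfolding mrep_def[of X N]
    using stream_eq_pre[OF stream_eq_behaviour[OF i(2) j(2) r step]] by (simp add: start_Hom j(1))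
qed

lemma marrow_eqI:
  assumes "machine X Y M i a" "machine X Y N j b" "\<And>n. r n \<in> Hom C (N n) (M n)"
    "j \<Zcomp> r 0 = i"
    "\<And>n. (r n \<otimes>\<^sub>a Ide C (X n)) \<Zcomp> a n = b n \<Zcomp> (r (Suc n) \<otimes>\<^sub>a Ide C (Y n))"
  shows "marrow X Y M i a = marrow X Y N j b"
  using mrep_simI[OF assms] stream_class_eq mrep_is_istream assms(1,2) unfolding marrow_def by blast

lemma istream_mrep:
  assumes "is_istream C X Y f"
  obtains M i a where "machine X Y M i a" "f = mrep X M i a"
proof
  \<comment> \<open>The initial memory is the unit and the initial state its identity. The first
    action therefore has to discard a unit, and all later data are shifted by one.\<close>
  let ?M = "case_nat \<one> (\<lambda>k. Mem ((Later ^^ k) f))"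
  let ?a = "case_nat (LUnit C (X 0) \<Zcomp> Now f) (\<lambda>k. Now ((Later ^^ Suc k) f))"
  have f0: "Now f \<in> Hom C (X 0) (Mem f \<otimes> Y 0)" "is_istream C (load C (Mem f) (stl X)) (stl Y) (Later f)"
    using assms unfolding is_istream_iff[of X] by blast+
  have i: "is_istream C (load C (?M (Suc k)) (\<lambda>n. X (Suc k + n))) (\<lambda>n. Y (Suc k + n))
    ((Later ^^ Suc k) f)" for k
  proof (induction k)
    case 0 then show ?case using f0(2) by simp
  next
    case (Suc k)
    from is_istream_loadD(2)[OF this] show ?case by simp
  qed
  have "?a n \<in> Hom C (?M n \<otimes> X n) (?M (Suc n) \<otimes> Y n)" for n
  proof (cases n)
    case 0 then show ?thesis using Seq_Hom[OF struct_Hom(4) f0(1)] by simp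
  next
    case (Suc k) then show ?thesis using is_istream_loadD(1)[OF i[of k]] by simp
  qed
  then show "machine X Y ?M (Ide C \<one>) ?a" unfolding machine_def actions_def
    by (simp only: nat.case struct_Hom simp_thms)
  show "f = mrep X ?M (Ide C \<one>) ?a"
  proof (rule istream_eqI)
    have "(LUnitI C (X 0) \<Zcomp> (Ide C \<one> \<otimes>\<^sub>a Ide C (X 0))) \<Zcomp> (LUnit C (X 0) \<Zcomp> Now f) = Now f"
      by (rule evals_unique[where p="PW 0 (X 0)"
        and \<sigma>="[(Now f, PW 0 (X 0), PT (PW 1 (Mem f)) (PW 2 (Y 0)))]"],
        (rule evals_rules | (simp add: f0; fail))+)
    then show "Now f = Now (mrep X ?M (Ide C \<one>) ?a)" by (simp add: mrep_def)
    have "stl ?M = case_nat (Mem f) (\<lambda>k. Mem ((Later ^^ k) (Later f)))"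
      by (auto split: nat.split simp: funpow_swap1)
    moreover have "stl ?a = (\<lambda>n. Now ((Later ^^ n) (Later f)))" by (simp add: funpow_swap1)
    ultimately show "Later f = Later (mrep X ?M (Ide C \<one>) ?a)"
      unfolding mrep_def pre_simps behaviour.sel using behaviour_istream[of "Later f" "Mem f"] by simp
  qed (simp add: mrep_def)
qed

abbreviation "shom \<equiv> Hom (STREAM C)"
abbreviation "side \<equiv> Ide (STREAM C)"
abbreviation "sseq \<equiv> Seq (STREAM C)"
abbreviation "stens \<equiv> TensA (STREAM C)"

section \<open>Operations on equivalence classes\<close>

lemma stream_eq_LUnit:
  "stream_eq C X Y f f' \<Longrightarrow> X 0 = x \<Longrightarrow> stream_eq C (load C \<one> X) Y (pre C (LUnit C x) f) (pre C (LUnit C x) f')"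
  by (rule stream_eq_pre) auto
lemma is_istream_LUnit:
  "is_istream C X Y f \<Longrightarrow> X 0 = x \<Longrightarrow> is_istream C (load C \<one> X) Y (pre C (LUnit C x) f)"
  by (rule is_istream_pre) auto

lemma start2_Hom: "LUnitI C x \<Zcomp> (LUnitI C \<one> \<otimes>\<^sub>a Ide C x) \<in> Hom C x ((\<one> \<otimes> \<one>) \<otimes> x)"
  by (rule start_Hom) simp

lemma stream_eq_seq_rep:
  assumes f: "stream_eq C X Y f f'" and g: "stream_eq C Y Z g g'"
  shows "stream_eq C X Z (seq_rep C X Y Z f g) (seq_rep C X Y Z f' g')"
proof -
  note f = stream_eq_LUnit[OF f refl] and g = stream_eq_LUnit[OF g refl]
  have "stream_eq C (load C (\<one> \<otimes> \<one>) X) Z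
    (seq_mem C \<one> \<one> X Y Z (pre C (LUnit C (X 0)) f) (pre C (LUnit C (Y 0)) g))
    (seq_mem C \<one> \<one> X Y Z (pre C (LUnit C (X 0)) f') (pre C (LUnit C (Y 0)) g'))"
    using stream_eq_seq_mem_left[OF f] stream_eq_seq_mem_right[OF g] f g stream_eq_is_istream
      stream_eq_trans by meson
  then show ?thesis unfolding seq_rep_def by (rule stream_eq_pre) (simp_all add: start2_Hom)
qed

text \<open>\<open>tens_rep\<close> is defined without inserting units. Brought into the loaded
  form, it inherits what is known about \<open>tens_mem\<close>.\<close>

lemma tens_rep_tens_mem:
  assumes f: "is_istream C X Y f" and g: "is_istream C X' Y' g"
  shows "tens_rep C X Y X' Y' f g = pre C (LUnitI C (X 0 \<otimes> X' 0) \<Zcomp> (LUnitI C \<one> \<otimes>\<^sub>a Ide C (X 0 \<otimes> X' 0)))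
     (tens_mem C \<one> \<one> X Y X' Y' (pre C (LUnit C (X 0)) f) (pre C (LUnit C (X' 0)) g))"
proof (rule istream_eqI)
  have H: "Now f \<in> Hom C (X 0) (Mem f \<otimes> Y 0)" "Now g \<in> Hom C (X' 0) (Mem g \<otimes> Y' 0)"
    using f g unfolding is_istream_iff[of X] is_istream_iff[of X'] by blast+
  show "Now (tens_rep C X Y X' Y' f g)
    = Now (pre C (LUnitI C (X 0 \<otimes> X' 0) \<Zcomp> (LUnitI C \<one> \<otimes>\<^sub>a Ide C (X 0 \<otimes> X' 0)))
     (tens_mem C \<one> \<one> X Y X' Y' (pre C (LUnit C (X 0)) f) (pre C (LUnit C (X' 0)) g)))"
    unfolding Now_tens_mem pre_simps tens_rep_def istream.sel
    by (rule evals_unique[where p="PT (PW 0 (X 0)) (PW 1 (X' 0))"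
      and \<sigma>="[(Now f, PW 0 (X 0), PT (PW 2 (Mem f)) (PW 3 (Y 0))),
         (Now g, PW 1 (X' 0), PT (PW 4 (Mem g)) (PW 5 (Y' 0)))]"],
        (rule evals_rules | (simp add: H; fail))+)
qed (simp_all add: tens_rep_def)

lemma stream_eq_tens_rep:
  assumes f: "stream_eq C X Y f f'" and g: "stream_eq C X' Y' g g'"
  shows "stream_eq C (X \<otimes>\<^sub>s X') (Y \<otimes>\<^sub>s Y') (tens_rep C X Y X' Y' f g) (tens_rep C X Y X' Y' f' g')"
proof -
  note i = stream_eq_is_istream[OF f] stream_eq_is_istream[OF g]
  note f = stream_eq_LUnit[OF f refl] and g = stream_eq_LUnit[OF g refl]
  have "stream_eq C (load C (\<one> \<otimes> \<one>) (X \<otimes>\<^sub>s X')) (Y \<otimes>\<^sub>s Y')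
    (tens_mem C \<one> \<one> X Y X' Y' (pre C (LUnit C (X 0)) f) (pre C (LUnit C (X' 0)) g))
    (tens_mem C \<one> \<one> X Y X' Y' (pre C (LUnit C (X 0)) f') (pre C (LUnit C (X' 0)) g'))"
    using stream_eq_tens_mem_left[OF f] stream_eq_tens_mem_right[OF g] f g stream_eq_is_istream
      stream_eq_trans by meson
  then show ?thesis using i tens_rep_tens_mem
    by (auto elim!: stream_eq_pre simp: start2_Hom)
qed

lemma stream_eq_fbk_rep:
  assumes "stream_eq C (fbk_dom S X) (S \<otimes>\<^sub>s Y) f f'"
  shows "stream_eq C X Y (fbk_rep C S X Y f) (fbk_rep C S X Y f')"
  unfolding fbk_rep_def
  by (rule stream_eq_pre[OF stream_eq_fbk_mem[OF stream_eq_LUnit[OF assms]]]) simp_all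

lemma delay_rep_is_istream:
  assumes "is_istream C X Y f"
  shows "is_istream C (delay_obj C X) (delay_obj C Y) (delay_rep C X f)"
  using is_istream_LUnit[OF assms refl] unfolding delay_rep_def is_istream_iff[of "delay_obj C X"] by simp

text \<open>Both sides have the same memory and first action, so one step along an identity reduces
  the claim to the rests.\<close>

lemma stream_eq_delay_rep:
  assumes f: "stream_eq C X Y f f'"
  shows "stream_eq C (delay_obj C X) (delay_obj C Y) (delay_rep C X f) (delay_rep C X f')"
proof (rule stream_eq_step)
  note g = stream_eq_LUnit[OF f refl]
  have "LUnitI C \<one> = LUnitI C \<one> \<Zcomp> (Ide C \<one> \<otimes>\<^sub>a Ide C \<one>)"
    using Seq_Ide[OF struct_Hom(5)] by (simp add: Tens_Ide)
  moreover have "pre C (Ide C \<one> \<otimes>\<^sub>a Ide C (X 0)) (pre C (LUnit C (X 0)) f) = pre C (LUnit C (X 0)) f"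
    unfolding Tens_Ide by (rule pre_Ide[of "load C \<one> X" Y]) (use g stream_eq_is_istream in auto)
  ultimately show "stream_step C (stream_eq C) (delay_obj C X) (delay_obj C Y) (delay_rep C X f)
    (delay_rep C X f')"
    using g delay_rep_is_istream stream_eq_is_istream[OF f] unfolding stream_step_def delay_rep_def
    by (auto intro!: bexI[of _ "Ide C \<one>"])
qed

lemma stream_class_UN:
  assumes f: "is_istream C X Y f" and op: "\<And>f'. stream_eq C X Y f f' \<Longrightarrow> stream_eq C V W (\<phi> f) (\<phi> f')"
  shows "(\<Union>f'\<in>stream_class C X Y f. stream_class C V W (\<phi> f')) = stream_class C V W (\<phi> f)"
proof -
  have "stream_class C V W (\<phi> f') = stream_class C V W (\<phi> f)" if "f' \<in> stream_class C X Y f" for f'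
  proof -
    have "stream_eq C V W (\<phi> f) (\<phi> f')" using that op by (simp add: stream_class_def)
    then show ?thesis using stream_class_eq stream_eq_is_istream by blast
  qed
  moreover have "f \<in> stream_class C X Y f" using f by (simp add: stream_class_def)
  ultimately show ?thesis by blast
qed

lemma stream_class_UN2:
  assumes f: "is_istream C X Y f" and g: "is_istream C X' Y' g"
    and op: "\<And>f' g'. stream_eq C X Y f f' \<Longrightarrow> stream_eq C X' Y' g g' \<Longrightarrow> stream_eq C V W (\<phi> f g) (\<phi> f' g')"
  shows "(\<Union>f'\<in>stream_class C X Y f. \<Union>g'\<in>stream_class C X' Y' g. stream_class C V W (\<phi> f' g'))
    = stream_class C V W (\<phi> f g)"
proof -
  have "stream_class C V W (\<phi> f' g') = stream_class C V W (\<phi> f g)" if "f' \<in> stream_class C X Y f"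
    "g' \<in> stream_class C X' Y' g" for f' g'
  proof -
    have "stream_eq C V W (\<phi> f g) (\<phi> f' g')" using that op by (simp add: stream_class_def)
    then show ?thesis using stream_class_eq stream_eq_is_istream by blast
  qed
  moreover have "f \<in> stream_class C X Y f" "g \<in> stream_class C X' Y' g" using f g
    by (simp_all add: stream_class_def)
  ultimately show ?thesis by blast
qed

lemma marrow_Hom: "machine X Y M i a \<Longrightarrow> marrow X Y M i a \<in> shom X Y"
  using mrep_is_istream by (fastforce simp: marrow_def STREAM_def streams_def)

text \<open>Every arrow of streams is thereby replaced by a machine, after which a law becomes an
  instance of \<open>marrow_eqI\<close>.\<close>

lemma marrow_cases:
  assumes "F \<in> shom X Y"
  obtains M i a where "machine X Y M i a" "F = marrow X Y M i a"
proof -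
  obtain f where f: "is_istream C X Y f" "F = (X, Y, stream_class C X Y f)"
    using assms by (auto simp: STREAM_def streams_def)
  then show ?thesis using istream_mrep[OF f(1)] that unfolding marrow_def by metis
qed

section \<open>Operations on machines\<close>

lemma machine_seq:
  assumes "machine X Y M i a" "machine Y Z N j b"
  shows "machine X Z (M \<otimes>\<^sub>s N) (LUnitI C \<one> \<Zcomp> (i \<otimes>\<^sub>a j))
     (seq_acts X Y Z M N a b)"
  using machineD[OF assms(1)] machineD[OF assms(2)] Seq_Hom[OF struct_Hom(5) Tens_Hom]
  unfolding machine_def actions_def by (auto intro: seq_act_Hom)

lemma machine_tens:
  assumes "machine X Y M i a" "machine X' Y' N j b"
  shows "machine (X \<otimes>\<^sub>s X') (Y \<otimes>\<^sub>s Y') (M \<otimes>\<^sub>s N) (LUnitI C \<one> \<Zcomp> (i \<otimes>\<^sub>a j))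
     (tens_acts X Y X' Y' M N a b)"
  using machineD[OF assms(1)] machineD[OF assms(2)] Seq_Hom[OF struct_Hom(5) Tens_Hom]
  unfolding machine_def actions_def by (auto intro: tens_act_Hom)

text \<open>
  The value fed back is stored in the memory. As \<open>\<partial>S\<close> starts with the unit, nothing is stored
  initially and one formula covers all times.
\<close>
lemma machine_fbk:
  assumes "machine (fbk_dom S X) (S \<otimes>\<^sub>s Y) M i a"
  shows "machine X Y (\<lambda>n. M n \<otimes> delay_obj C S n) (i \<Zcomp> RUnitI (M 0))
     (fbk_acts S X Y M a)"
  using machineD[OF assms] Seq_Hom[OF _ struct_Hom(7)]
  unfolding machine_def actions_def by (auto intro: fbk_act_Hom)

text \<open>The delayed machine spends its first step on creating the initial state.\<close>
lemma machine_delay: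
  assumes "machine X Y M i a"
  shows "machine (delay_obj C X) (delay_obj C Y) (case_nat \<one> M) (Ide C \<one>) (case_nat (i \<otimes>\<^sub>a Ide C \<one>) a)"
  using machineD[OF assms] unfolding machine_def actions_def by (auto split: nat.split intro: Tens_Hom)

lemma machine_pure:
  assumes "\<And>n. \<phi> n \<in> Hom C (X n) (Y n)"
  shows "machine X Y (\<lambda>n. \<one>) (Ide C \<one>) (\<lambda>n. Ide C \<one> \<otimes>\<^sub>a \<phi> n)"
  using assms unfolding machine_def actions_def by (auto intro: Tens_Hom)

lemma seq_rep_mrep:
  assumes a: "machine X Y M i a" and b: "machine Y Z N j b"
  shows "seq_rep C X Y Z (mrep X M i a) (mrep Y N j b) = mrep X (M \<otimes>\<^sub>s N) (LUnitI C \<one> \<Zcomp> (i \<otimes>\<^sub>a j))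
     (seq_acts X Y Z M N a b)"
proof -
  note i = machineD[OF a] and j = machineD[OF b]
  have s: "is_istream C (load C (M 0 \<otimes> N 0) X) Z
    (seq_mem C (M 0) (N 0) X Y Z (behaviour M a) (behaviour N b))"
    by (rule seq_mem_is_istream) (auto intro: behaviour_is_istream i j)
  have e: "(LUnitI C (X 0) \<Zcomp> (LUnitI C \<one> \<otimes>\<^sub>a Ide C (X 0))) \<Zcomp> ((i \<otimes>\<^sub>a j) \<otimes>\<^sub>a Ide C (X 0))
    = LUnitI C (X 0) \<Zcomp> ((LUnitI C \<one> \<Zcomp> (i \<otimes>\<^sub>a j)) \<otimes>\<^sub>a Ide C (X 0))"
    by (rule evals_unique[where p="PW 0 (X 0)" and \<sigma>="[(i, PU, PW 1 (M 0)), (j, PU, PW 2 (N 0))]"],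
        (rule evals_rules | (simp add: i j; fail))+)
  show ?thesis
    unfolding seq_rep_def LUnit_mrep[OF a] LUnit_mrep[OF b]
      seq_mem_pre[OF behaviour_is_istream[OF i(2)] behaviour_is_istream[OF j(2)] i(1) j(1), symmetric]
    by (subst pre_pre[where W="X 0" and V="(\<one> \<otimes> \<one>) \<otimes> X 0", OF s])
      (simp_all add: start2_Hom i j Tens_Hom e mrep_def behaviour_seq)
qed

lemma tens_rep_mrep:
  assumes a: "machine X Y M i a" and b: "machine X' Y' N j b"
  shows "tens_rep C X Y X' Y' (mrep X M i a) (mrep X' N j b)
    = mrep (X \<otimes>\<^sub>s X') (M \<otimes>\<^sub>s N) (LUnitI C \<one> \<Zcomp> (i \<otimes>\<^sub>a j))
     (tens_acts X Y X' Y' M N a b)"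
proof -
  note i = machineD[OF a] and j = machineD[OF b]
  let ?x = "X 0 \<otimes> X' 0"
  have s: "is_istream C (load C (M 0 \<otimes> N 0) (X \<otimes>\<^sub>s X')) (Y \<otimes>\<^sub>s Y')
    (tens_mem C (M 0) (N 0) X Y X' Y' (behaviour M a) (behaviour N b))"
    by (rule tens_mem_is_istream) (auto intro: behaviour_is_istream i j)
  have e: "(LUnitI C ?x \<Zcomp> (LUnitI C \<one> \<otimes>\<^sub>a Ide C ?x)) \<Zcomp> ((i \<otimes>\<^sub>a j) \<otimes>\<^sub>a Ide C ?x) = LUnitI C ?x
    \<Zcomp> ((LUnitI C \<one> \<Zcomp> (i \<otimes>\<^sub>a j)) \<otimes>\<^sub>a Ide C ?x)"
    by (rule evals_unique[where p="PW 0 ?x" and \<sigma>="[(i, PU, PW 1 (M 0)), (j, PU, PW 2 (N 0))]"],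
        (rule evals_rules | (simp add: i j; fail))+)
  show ?thesis
    unfolding tens_rep_tens_mem[OF mrep_is_istream[OF a] mrep_is_istream[OF b]] LUnit_mrep[OF a]
      LUnit_mrep[OF b]
      tens_mem_pre[OF behaviour_is_istream[OF i(2)] behaviour_is_istream[OF j(2)] i(1) j(1), symmetric]
    by (subst pre_pre[where W="?x" and V="(\<one> \<otimes> \<one>) \<otimes> ?x", OF s])
      (simp_all add: start2_Hom i j Tens_Hom e mrep_def behaviour_tens)
qed

lemma fbk_rep_mrep:
  assumes a: "machine (fbk_dom S X) (S \<otimes>\<^sub>s Y) M i a"
  shows "fbk_rep C S X Y (mrep (fbk_dom S X) M i a) = mrep X (\<lambda>n. M n \<otimes> delay_obj C S n) (i \<Zcomp> RUnitI (M 0))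
     (fbk_acts S X Y M a)"
proof -
  note i = machineD[OF a]
  let ?c = "fbk_rest (M 0) \<one> (X 0)" and ?r = "i \<Zcomp> RUnitI (M 0)"
  have r: "?r \<in> Hom C \<one> (M 0 \<otimes> \<one>)" by (rule Seq_Hom[OF i(1)]) simp
  have b: "is_istream C (load C (M 0) (fbk_dom S X)) (S \<otimes>\<^sub>s Y) (behaviour M a)"
    by (rule behaviour_is_istream[OF i(2)])
  have s: "is_istream C (load C (M 0 \<otimes> \<one>) (fbk_dom S X)) (S \<otimes>\<^sub>s Y) (pre C ?c (behaviour M a))"
    using b by (rule is_istream_pre) (simp_all add: fbk_rest_Hom)
  \<comment> \<open>At time 0 the object in the store is a unit, so \<open>fbk_rest\<close> only
    removes the unit that \<open>RUnitI\<close> has created in the initial state.\<close>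
  have e: "(?r \<otimes>\<^sub>a Ide C (\<one> \<otimes> X 0)) \<Zcomp> ?c = i \<otimes>\<^sub>a Ide C (\<one> \<otimes> X 0)"
    by (rule evals_unique[where p="PT PU (PT PU (PW 0 (X 0)))" and \<sigma>="[(i, PU, PW 1 (M 0))]"],
        (rule evals_fbk_rest evals_rules | (simp add: i; fail))+)
  have "pre C (i \<otimes>\<^sub>a Ide C (\<one> \<otimes> X 0)) (behaviour M a)
    = pre C (?r \<otimes>\<^sub>a Ide C (\<one> \<otimes> X 0)) (pre C ?c (behaviour M a))"
    by (subst pre_pre[where W="\<one> \<otimes> (\<one> \<otimes> X 0)" and V="(M 0 \<otimes> \<one>) \<otimes> (\<one> \<otimes> X 0)", OF b])
      (simp_all add: fbk_rest_Hom Tens_Hom r e)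
  then have 1: "fbk_mem C \<one> S X Y (pre C (LUnit C (\<one> \<otimes> X 0)) (mrep (fbk_dom S X) M i a))
    = pre C (?r \<otimes>\<^sub>a Ide C (X 0)) (fbk_mem C (M 0 \<otimes> \<one>) S X Y (pre C ?c (behaviour M a)))"
    using LUnit_mrep[OF a] fbk_mem_pre[OF s r] by simp
  have "actions (\<lambda>n. delay_obj C S n \<otimes> X n) (\<lambda>n. stl (delay_obj C S) n \<otimes> Y n) M a" using i(2) by simp
  from behaviour_fbk[OF this] have 2: "fbk_mem C (M 0 \<otimes> \<one>) S X Y (pre C ?c (behaviour M a))
    = behaviour (\<lambda>n. M n \<otimes> delay_obj C S n)
     (fbk_acts S X Y M a)" by simp
  have "pre C (LUnitI C (X 0))
    (pre C (?r \<otimes>\<^sub>a Ide C (X 0)) (fbk_mem C (M 0 \<otimes> \<one>) S X Y (pre C ?c (behaviour M a))))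
     = pre C (LUnitI C (X 0) \<Zcomp> (?r \<otimes>\<^sub>a Ide C (X 0))) (fbk_mem C (M 0 \<otimes> \<one>) S X Y (pre C ?c (behaviour M a)))"
    by (rule pre_pre[where W="X 0" and V="\<one> \<otimes> X 0", OF fbk_mem_is_istream[OF s]]) (simp_all add: Tens_Hom r)
  then show ?thesis unfolding fbk_rep_def 1 2 unfolding mrep_def .
qed

text \<open>The representatives differ: after its first action \<open>delay_rep\<close> still has
  the trivial memory, whereas the machine has created \<open>M 0\<close> by then. One generating
  step along \<open>i\<close> relates them.\<close>

lemma delay_rep_mrep:
  assumes a: "machine X Y M i a"
  shows "stream_eq C (delay_obj C X) (delay_obj C Y) (delay_rep C X (mrep X M i a))
    (mrep (delay_obj C X) (case_nat \<one> M) (Ide C \<one>) (case_nat (i \<otimes>\<^sub>a Ide C \<one>) a))"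
proof (rule stream_eq_sym[OF stream_eq_step])
  note i = machineD[OF a]
  let ?d = "mrep (delay_obj C X) (case_nat \<one> M) (Ide C \<one>) (case_nat (i \<otimes>\<^sub>a Ide C \<one>) a)"
  have "(LUnitI C \<one> \<Zcomp> (Ide C \<one> \<otimes>\<^sub>a Ide C \<one>)) \<Zcomp> (i \<otimes>\<^sub>a Ide C \<one>) = LUnitI C \<one> \<Zcomp> (i \<otimes>\<^sub>a Ide C \<one>)"
    by (rule evals_unique[where p="PU" and \<sigma>="[(i, PU, PW 1 (M 0))]"],
        (rule evals_rules | (simp add: i; fail))+)
  then have N: "Now ?d = Now (delay_rep C X (mrep X M i a)) \<Zcomp> (i \<otimes>\<^sub>a Ide C \<one>)"
    by (simp add: mrep_def delay_rep_def)
  have L: "Later (delay_rep C X (mrep X M i a)) = pre C (i \<otimes>\<^sub>a Ide C (X 0)) (Later ?d)"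
    using LUnit_mrep[OF a] by (simp add: delay_rep_def mrep_def)
  have "is_istream C (load C \<one> X) Y (pre C (i \<otimes>\<^sub>a Ide C (X 0)) (Later ?d))"
    using is_istream_LUnit[OF mrep_is_istream[OF a] refl] LUnit_mrep[OF a] by (simp add: mrep_def)
  then show "stream_step C (stream_eq C) (delay_obj C X) (delay_obj C Y) ?d (delay_rep C X (mrep X M i a))"
    using N mrep_is_istream[OF machine_delay[OF a]] delay_rep_is_istream[OF mrep_is_istream[OF a]] i(1)
    unfolding stream_step_def L by (auto intro!: bexI[of _ i] simp: delay_rep_def mrep_def)
qed

lemma pure_rep_mrep: "pure_rep C X \<phi> = mrep X (\<lambda>n. \<one>) (Ide C \<one>) (\<lambda>n. Ide C \<one> \<otimes>\<^sub>a \<phi> n)"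
  unfolding pure_rep_def mrep_def behaviour_pure Tens_Ide Seq_Ide[OF struct_Hom(5)] ..

lemma STREAM_Seq:
  assumes "machine X Y M i a" "machine Y Z N j b"
  shows "sseq (marrow X Y M i a) (marrow Y Z N j b) = marrow X Z (M \<otimes>\<^sub>s N) (LUnitI C \<one> \<Zcomp> (i \<otimes>\<^sub>a j))
     (seq_acts X Y Z M N a b)"
  using stream_class_UN2[where \<phi>="seq_rep C X Y Z", OF mrep_is_istream[OF assms(1)]
    mrep_is_istream[OF assms(2)] stream_eq_seq_rep] seq_rep_mrep[OF assms]
  by (simp add: STREAM_def marrow_def)

lemma STREAM_Tens:
  assumes "machine X Y M i a" "machine X' Y' N j b"
  shows "stens (marrow X Y M i a) (marrow X' Y' N j b)
    = marrow (X \<otimes>\<^sub>s X') (Y \<otimes>\<^sub>s Y') (M \<otimes>\<^sub>s N) (LUnitI C \<one> \<Zcomp> (i \<otimes>\<^sub>a j))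
     (tens_acts X Y X' Y' M N a b)"
  using stream_class_UN2[where \<phi>="tens_rep C X Y X' Y'", OF mrep_is_istream[OF assms(1)]
    mrep_is_istream[OF assms(2)] stream_eq_tens_rep] tens_rep_mrep[OF assms]
  by (simp add: STREAM_def marrow_def)

lemma feedback_marrow:
  assumes "machine (fbk_dom S X) (S \<otimes>\<^sub>s Y) M i a"
  shows "feedback C S X Y (marrow (fbk_dom S X) (S \<otimes>\<^sub>s Y) M i a)
    = marrow X Y (\<lambda>n. M n \<otimes> delay_obj C S n) (i \<Zcomp> RUnitI (M 0))
     (fbk_acts S X Y M a)"
  using stream_class_UN[where \<phi>="fbk_rep C S X Y", OF mrep_is_istream[OF assms] stream_eq_fbk_rep]
    fbk_rep_mrep[OF assms]
  by (simp add: feedback_def marrow_def)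

lemma delay_marrow:
  assumes "machine X Y M i a"
  shows "delay C (marrow X Y M i a) = marrow (delay_obj C X) (delay_obj C Y) (case_nat \<one> M)
    (Ide C \<one>) (case_nat (i \<otimes>\<^sub>a Ide C \<one>) a)"
  using stream_class_UN[where \<phi>="delay_rep C X", OF mrep_is_istream[OF assms] stream_eq_delay_rep]
    delay_rep_mrep[OF assms] stream_class_eq stream_eq_is_istream[OF delay_rep_mrep[OF assms]]
  by (simp add: delay_def marrow_def)

lemma pure_arrow_marrow: "pure_arrow C X Y \<phi> = marrow X Y (\<lambda>n. \<one>) (Ide C \<one>) (\<lambda>n. Ide C \<one> \<otimes>\<^sub>a \<phi> n)"
  by (simp add: pure_arrow_def marrow_def pure_rep_mrep)

section \<open>The symmetric monoidal category of streams\<close>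
lemma STREAM_Unit [simp]: "Unit (STREAM C) = (\<lambda>n. \<one>)"
  and STREAM_TensO [simp]: "TensO (STREAM C) X Y = (X \<otimes>\<^sub>s Y)"
  and STREAM_Ide: "side X = pure_arrow C X X (\<lambda>n. Ide C (X n))"
  and STREAM_Assoc: "Assoc (STREAM C) X Y Z = pure_arrow C (\<lambda>n. (X n \<otimes> Y n) \<otimes> Z n) (\<lambda>n. X n \<otimes> (Y n \<otimes> Z n))
       (\<lambda>n. Assoc C (X n) (Y n) (Z n))"
  and STREAM_LUnit: "LUnit (STREAM C) X = pure_arrow C (\<lambda>n. \<one> \<otimes> X n) X (\<lambda>n. LUnit C (X n))"
  and STREAM_RUnit: "RUnit (STREAM C) X = pure_arrow C (\<lambda>n. X n \<otimes> \<one>) X (\<lambda>n. RUnit C (X n))"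
  and STREAM_Sym: "Sym (STREAM C) X Y = pure_arrow C (X \<otimes>\<^sub>s Y) (Y \<otimes>\<^sub>s X) (\<lambda>n. Sym C (X n) (Y n))"
  by (simp_all add: STREAM_def)

lemmas STREAM_struct = STREAM_Ide STREAM_Assoc STREAM_LUnit STREAM_RUnit STREAM_Sym

lemma pure_arrow_Hom: "(\<And>n. \<phi> n \<in> Hom C (X n) (Y n)) \<Longrightarrow> pure_arrow C X Y \<phi> \<in> shom X Y"
  unfolding pure_arrow_marrow by (rule marrow_Hom[OF machine_pure])

text \<open>The composite machine carries the trivial memories of both factors, that is, a product
  of two units; \<open>r\<close> compares it with the single unit of the pure arrow on the
  right.\<close>

lemma pure_Seq:
  assumes \<phi>: "\<And>n. \<phi> n \<in> Hom C (X n) (Y n)" and \<psi>: "\<And>n. \<psi> n \<in> Hom C (Y n) (Z n)"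
  shows "sseq (pure_arrow C X Y \<phi>) (pure_arrow C Y Z \<psi>) = pure_arrow C X Z (\<lambda>n. \<phi> n \<Zcomp> \<psi> n)"
proof -
  note f = machine_pure[of \<phi> X Y, OF \<phi>] and g = machine_pure[of \<psi> Y Z, OF \<psi>]
  show ?thesis unfolding pure_arrow_marrow STREAM_Seq[OF f g]
  proof (rule marrow_eqI[OF machine_seq[OF f g] machine_pure, where r="\<lambda>n. LUnitI C \<one>"])
    show "Ide C \<one> \<Zcomp> LUnitI C \<one> = LUnitI C \<one> \<Zcomp> (Ide C \<one> \<otimes>\<^sub>a Ide C \<one>)"
      by (rule evals_unique[where p="PU" and \<sigma>="[]"], (rule evals_rules | (simp; fail))+)
    show "(LUnitI C \<one> \<otimes>\<^sub>a Ide C (X n)) \<Zcomp> seq_act \<one> \<one> (X n) (Y n) (Z n) \<one> \<one> (Ide C \<one> \<otimes>\<^sub>a \<phi> n)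
      (Ide C \<one> \<otimes>\<^sub>a \<psi> n) =
         (Ide C \<one> \<otimes>\<^sub>a (\<phi> n \<Zcomp> \<psi> n)) \<Zcomp> (LUnitI C \<one> \<otimes>\<^sub>a Ide C (Z n))" for n
      by (rule evals_unique[where p="PT PU (PW 0 (X n))"
        and \<sigma>="[(\<phi> n, PW 0 (X n), PW 1 (Y n)), (\<psi> n, PW 1 (Y n), PW 2 (Z n))]"],
        (rule evals_rules | (simp add: \<phi> \<psi>; fail))+)
  qed (use Seq_Hom[OF \<phi> \<psi>] in simp_all)
qed

lemma pure_Tens:
  assumes \<phi>: "\<And>n. \<phi> n \<in> Hom C (X n) (Y n)" and \<psi>: "\<And>n. \<psi> n \<in> Hom C (X' n) (Y' n)"
  shows "stens (pure_arrow C X Y \<phi>) (pure_arrow C X' Y' \<psi>)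
    = pure_arrow C (X \<otimes>\<^sub>s X') (Y \<otimes>\<^sub>s Y') (\<lambda>n. \<phi> n \<otimes>\<^sub>a \<psi> n)"
proof -
  note f = machine_pure[of \<phi> X Y, OF \<phi>] and g = machine_pure[of \<psi> X' Y', OF \<psi>]
  show ?thesis unfolding pure_arrow_marrow STREAM_Tens[OF f g]
  proof (rule marrow_eqI[OF machine_tens[OF f g] machine_pure, where r="\<lambda>n. LUnitI C \<one>"])
    show "Ide C \<one> \<Zcomp> LUnitI C \<one> = LUnitI C \<one> \<Zcomp> (Ide C \<one> \<otimes>\<^sub>a Ide C \<one>)"
      by (rule evals_unique[where p="PU" and \<sigma>="[]"], (rule evals_rules | (simp; fail))+)
    show "(LUnitI C \<one> \<otimes>\<^sub>a Ide C (X n \<otimes> X' n)) \<Zcomp> tens_act \<one> \<one> (X n) (Y n) (X' n) (Y' n) \<one>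
      \<one> (Ide C \<one> \<otimes>\<^sub>a \<phi> n) (Ide C \<one> \<otimes>\<^sub>a \<psi> n) =
         (Ide C \<one> \<otimes>\<^sub>a (\<phi> n \<otimes>\<^sub>a \<psi> n)) \<Zcomp> (LUnitI C \<one> \<otimes>\<^sub>a Ide C (Y n \<otimes> Y' n))" for n
      by (rule evals_unique[where p="PT PU (PT (PW 0 (X n)) (PW 1 (X' n)))"
        and \<sigma>="[(\<phi> n, PW 0 (X n), PW 2 (Y n)), (\<psi> n, PW 1 (X' n), PW 3 (Y' n))]"],
        (rule evals_rules | (simp add: \<phi> \<psi>; fail))+)
  qed (use Tens_Hom[OF \<phi> \<psi>] in simp_all)
qed

lemma pure_delay:
  assumes \<phi>: "\<And>n. \<phi> n \<in> Hom C (X n) (Y n)"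
  shows "delay C (pure_arrow C X Y \<phi>) = pure_arrow C (delay_obj C X) (delay_obj C Y) (case_nat (Ide C \<one>) \<phi>)"
proof -
  have "case_nat \<one> (\<lambda>n. \<one>) = (\<lambda>n. \<one>)" "case_nat (Ide C \<one> \<otimes>\<^sub>a Ide C \<one>) (\<lambda>n. Ide C \<one> \<otimes>\<^sub>a \<phi> n)
    = (\<lambda>n. Ide C \<one> \<otimes>\<^sub>a case_nat (Ide C \<one>) \<phi> n)"
    by (auto split: nat.split)
  then show ?thesis unfolding pure_arrow_marrow delay_marrow[OF machine_pure[of \<phi> X Y, OF \<phi>]] by simp
qed

lemma pure_iso:
  assumes "\<And>n. inverse_arrows C (X n) (Y n) (\<phi> n) (\<psi> n)"
  shows "inverse_arrows (STREAM C) X Y (pure_arrow C X Y \<phi>) (pure_arrow C Y X \<psi>)"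
proof -
  have H: "\<And>n. \<phi> n \<in> Hom C (X n) (Y n)" "\<And>n. \<psi> n \<in> Hom C (Y n) (X n)"
    and e: "\<And>n. \<phi> n \<Zcomp> \<psi> n = Ide C (X n)" "\<And>n. \<psi> n \<Zcomp> \<phi> n = Ide C (Y n)"
    using assms by (auto simp: inverse_arrows_def)
  show ?thesis unfolding inverse_arrows_def pure_Seq[OF H(1) H(2)] pure_Seq[OF H(2) H(1)] e STREAM_Ide
    using pure_arrow_Hom[OF H(1)] pure_arrow_Hom[OF H(2)] by simp
qed

section \<open>The laws of a symmetric monoidal category\<close>

lemma STREAM_Ide_Seq:
  assumes "F \<in> shom X Y" shows "sseq (side X) F = F"
  using assms
proof (rule marrow_cases)
  fix M i a assume f: "machine X Y M i a" and F: "F = marrow X Y M i a"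
  note H = machineD[OF f]
  note p = machine_pure[of "\<lambda>n. Ide C (X n)" X X, OF Ide_Hom]
  show ?thesis unfolding F STREAM_Ide pure_arrow_marrow STREAM_Seq[OF p f]
  proof (rule marrow_eqI[OF machine_seq[OF p f] f, where r="\<lambda>n. LUnitI C (M n)"])
    show "i \<Zcomp> LUnitI C (M 0) = LUnitI C \<one> \<Zcomp> (Ide C \<one> \<otimes>\<^sub>a i)"
      by (rule evals_unique[where p="PU" and \<sigma>="[(i, PU, PW 0 (M 0))]"],
        (rule evals_rules | (simp add: H; fail))+)
    show "(LUnitI C (M n) \<otimes>\<^sub>a Ide C (X n)) \<Zcomp> seq_act \<one> (M n) (X n) (X n) (Y n) \<one> (M (Suc n))
      (Ide C \<one> \<otimes>\<^sub>a Ide C (X n)) (a n)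
       = a n \<Zcomp> (LUnitI C (M (Suc n)) \<otimes>\<^sub>a Ide C (Y n))" for n
      by (rule evals_unique[where p="PT (PW 0 (M n)) (PW 1 (X n))"
        and \<sigma>="[(a n, PT (PW 0 (M n)) (PW 1 (X n)), PT (PW 2 (M (Suc n))) (PW 3 (Y n)))]"],
        (rule evals_rules | (simp add: H; fail))+)
  qed simp
qed

lemma STREAM_Seq_Ide:
  assumes "F \<in> shom X Y" shows "sseq F (side Y) = F"
  using assms
proof (rule marrow_cases)
  fix M i a assume f: "machine X Y M i a" and F: "F = marrow X Y M i a"
  note H = machineD[OF f]
  note p = machine_pure[of "\<lambda>n. Ide C (Y n)" Y Y, OF Ide_Hom]
  show ?thesis unfolding F STREAM_Ide pure_arrow_marrow STREAM_Seq[OF f p]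
  proof (rule marrow_eqI[OF machine_seq[OF f p] f, where r="\<lambda>n. RUnitI (M n)"])
    show "i \<Zcomp> RUnitI (M 0) = LUnitI C \<one> \<Zcomp> (i \<otimes>\<^sub>a Ide C \<one>)"
      by (rule evals_unique[where p="PU" and \<sigma>="[(i, PU, PW 0 (M 0))]"],
        (rule evals_rules | (simp add: H; fail))+)
    show "(RUnitI (M n) \<otimes>\<^sub>a Ide C (X n)) \<Zcomp> seq_act (M n) \<one> (X n) (Y n) (Y n) (M (Suc n)) \<one> (a n)
      (Ide C \<one> \<otimes>\<^sub>a Ide C (Y n))
       = a n \<Zcomp> (RUnitI (M (Suc n)) \<otimes>\<^sub>a Ide C (Y n))" for n
      by (rule evals_unique[where p="PT (PW 0 (M n)) (PW 1 (X n))"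
        and \<sigma>="[(a n, PT (PW 0 (M n)) (PW 1 (X n)), PT (PW 2 (M (Suc n))) (PW 3 (Y n)))]"],
        (rule evals_rules | (simp add: H; fail))+)
  qed simp
qed

lemma STREAM_Seq_Hom:
  assumes "F \<in> shom X Y" "G \<in> shom Y Z" shows "sseq F G \<in> shom X Z"
  using assms(1)
proof (rule marrow_cases)
  fix M i a assume f: "machine X Y M i a" and F: "F = marrow X Y M i a"
  show ?thesis using assms(2)
  proof (rule marrow_cases)
    fix N j b assume g: "machine Y Z N j b" and G: "G = marrow Y Z N j b"
    show ?thesis unfolding F G STREAM_Seq[OF f g] by (rule marrow_Hom[OF machine_seq[OF f g]])
  qed
qed

lemma STREAM_Tens_Hom:
  assumes "F \<in> shom X Y" "G \<in> shom X' Y'"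
  shows "stens F G \<in> shom (X \<otimes>\<^sub>s X') (Y \<otimes>\<^sub>s Y')"
  using assms(1)
proof (rule marrow_cases)
  fix M i a assume f: "machine X Y M i a" and F: "F = marrow X Y M i a"
  show ?thesis using assms(2)
  proof (rule marrow_cases)
    fix N j b assume g: "machine X' Y' N j b" and G: "G = marrow X' Y' N j b"
    show ?thesis unfolding F G STREAM_Tens[OF f g] by (rule marrow_Hom[OF machine_tens[OF f g]])
  qed
qed

lemma STREAM_Seq_assoc:
  assumes "F \<in> shom V X" "G \<in> shom X Y" "H \<in> shom Y Z"
  shows "sseq (sseq F G) H = sseq F (sseq G H)"
proof -
  obtain M i a where f: "machine V X M i a" and F: "F = marrow V X M i a"
    using marrow_cases[OF assms(1)] by blast
  obtain N j b where g: "machine X Y N j b" and G: "G = marrow X Y N j b"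
    using marrow_cases[OF assms(2)] by blast
  obtain P k c where h: "machine Y Z P k c" and H: "H = marrow Y Z P k c"
    using marrow_cases[OF assms(3)] by blast
  note D = machineD[OF f] machineD[OF g] machineD[OF h]
  show ?thesis unfolding F G H STREAM_Seq[OF f g] STREAM_Seq[OF g h]
    STREAM_Seq[OF machine_seq[OF f g] h] STREAM_Seq[OF f machine_seq[OF g h]]
    apply (rule marrow_eqI[OF machine_seq[OF machine_seq[OF f g] h]
      machine_seq[OF f machine_seq[OF g h]], where r="\<lambda>n. AssocI C (M n) (N n) (P n)"])
    subgoal by simp
    subgoal
      by (rule evals_unique[where p="PU"
        and \<sigma>="[(i, PU, PW 0 (M 0)), (j, PU, PW 1 (N 0)), (k, PU, PW 2 (P 0))]"],
        (rule evals_rules | (simp add: D; fail))+)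
    subgoal for n
      by (rule evals_unique[where p="PT (PT (PW 0 (M n)) (PT (PW 1 (N n)) (PW 2 (P n)))) (PW 3 (V n))"
         and \<sigma>="[(a n, PT (PW 0 (M n)) (PW 3 (V n)), PT (PW 4 (M (Suc n))) (PW 5 (X n))),
          (b n, PT (PW 1 (N n)) (PW 5 (X n)), PT (PW 6 (N (Suc n))) (PW 7 (Y n))),
          (c n, PT (PW 2 (P n)) (PW 7 (Y n)), PT (PW 8 (P (Suc n))) (PW 9 (Z n)))]"],
        (rule evals_rules | (simp add: D; fail))+)
    done
qed

text \<open>The memories are related by \<open>swap_mid\<close>. The tensor of composites runs
  \<open>b\<close> before \<open>a'\<close>, the composite of tensors runs \<open>a'\<close> before
  \<open>b\<close>; these act on different factors and are exchanged, as are the initial states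
  \<open>j\<close> and \<open>i'\<close>.\<close>

lemma STREAM_Tens_Seq:
  assumes "F \<in> shom X Y" "G \<in> shom Y Z" "F' \<in> shom X' Y'" "G' \<in> shom Y' Z'"
  shows "stens (sseq F G) (sseq F' G') = sseq (stens F F') (stens G G')"
proof -
  obtain M i a where f: "machine X Y M i a" and F: "F = marrow X Y M i a"
    using marrow_cases[OF assms(1)] by blast
  obtain N j b where g: "machine Y Z N j b" and G: "G = marrow Y Z N j b"
    using marrow_cases[OF assms(2)] by blast
  obtain M' i' a' where f': "machine X' Y' M' i' a'" and F': "F' = marrow X' Y' M' i' a'"
    using marrow_cases[OF assms(3)] by blast
  obtain N' j' b' where g': "machine Y' Z' N' j' b'" and G': "G' = marrow Y' Z' N' j' b'"
    using marrow_cases[OF assms(4)] by blast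
  note D = machineD[OF f] machineD[OF g] machineD[OF f'] machineD[OF g']
  note fg = machine_seq[OF f g] and fg' = machine_seq[OF f' g'] and ff = machine_tens[OF f f']
    and gg = machine_tens[OF g g']
  show ?thesis unfolding F G F' G' STREAM_Seq[OF f g] STREAM_Seq[OF f' g'] STREAM_Tens[OF fg fg']
      STREAM_Tens[OF f f'] STREAM_Tens[OF g g'] STREAM_Seq[OF ff gg]
    apply (rule marrow_eqI[OF machine_tens[OF fg fg'] machine_seq[OF ff gg],
      where r="\<lambda>n. swap_mid C (M n) (M' n) (N n) (N' n)"])
    subgoal for n using evals_Hom[OF evals_swap_mid[of "PW 0 (M n)" _ "PW 1 (M' n)" _ "PW 2 (N n)" _
      "PW 3 (N' n)" _ "[]"]] by simp
    subgoal
      by (rule evals_unique_swap[where p="PU" and \<sigma>="[(i, PU, PW 0 (M 0))]"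
        and a="(i', PU, PW 1 (M' 0))" and b="(j, PU, PW 2 (N 0))"
          and \<tau>="[(j', PU, PW 3 (N' 0))]", unfolded append.simps],
        (rule evals_rules | (simp add: D; fail))+)
    subgoal for n
      by (rule evals_unique_swap[where p="PT
        (PT (PT (PW 0 (M n)) (PW 1 (M' n))) (PT (PW 2 (N n)) (PW 3 (N' n))))
          (PT (PW 4 (X n)) (PW 5 (X' n)))"
         and \<sigma>="[(a n, PT (PW 0 (M n)) (PW 4 (X n)), PT (PW 6 (M (Suc n))) (PW 7 (Y n)))]"
         and a="(b n, PT (PW 2 (N n)) (PW 7 (Y n)), PT (PW 8 (N (Suc n))) (PW 9 (Z n)))"
         and b="(a' n, PT (PW 1 (M' n)) (PW 5 (X' n)), PT (PW 10 (M' (Suc n))) (PW 11 (Y' n)))"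
         and \<tau>="[(b' n, PT (PW 3 (N' n)) (PW 11 (Y' n)), PT (PW 12 (N' (Suc n))) (PW 13 (Z' n)))]",
           unfolded append.simps],
        (rule evals_rules | (simp add: D; fail))+)
    done
qed

lemma STREAM_Assoc_natural:
  assumes "F \<in> shom X X'" "G \<in> shom Y Y'" "H \<in> shom Z Z'"
  shows "sseq (stens (stens F G) H) (Assoc (STREAM C) X' Y' Z') =
    sseq (Assoc (STREAM C) X Y Z) (stens F (stens G H))"
proof -
  obtain M i a where f: "machine X X' M i a" and F: "F = marrow X X' M i a"
    using marrow_cases[OF assms(1)] by blast
  obtain N j b where g: "machine Y Y' N j b" and G: "G = marrow Y Y' N j b"
    using marrow_cases[OF assms(2)] by blast
  obtain P k c where h: "machine Z Z' P k c" and H: "H = marrow Z Z' P k c"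
    using marrow_cases[OF assms(3)] by blast
  note D = machineD[OF f] machineD[OF g] machineD[OF h]
  note p = machine_pure[of "\<lambda>n. Assoc C (X n) (Y n) (Z n)" "\<lambda>n. (X n \<otimes> Y n) \<otimes> Z n"
    "\<lambda>n. X n \<otimes> (Y n \<otimes> Z n)", OF struct_Hom(2)]
  note p' = machine_pure[of "\<lambda>n. Assoc C (X' n) (Y' n) (Z' n)" "\<lambda>n. (X' n \<otimes> Y' n) \<otimes> Z' n"
    "\<lambda>n. X' n \<otimes> (Y' n \<otimes> Z' n)", OF struct_Hom(2)]
  note fg = machine_tens[OF machine_tens[OF f g] h] and gh = machine_tens[OF f machine_tens[OF g h]]
  show ?thesis unfolding F G H STREAM_Tens[OF f g] STREAM_Tens[OF g h]
    STREAM_Tens[OF machine_tens[OF f g] h]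
      STREAM_Tens[OF f machine_tens[OF g h]] STREAM_Assoc pure_arrow_marrow STREAM_Seq[OF fg p']
        STREAM_Seq[OF p gh]
    \<comment> \<open>The pure associator contributes a unit memory, in front if it comes first and
      at the back if it comes last. Hence \<open>r\<close> drops one unit, rebrackets and adds
      another.\<close>
    apply (rule marrow_eqI[OF machine_seq[OF fg p'] machine_seq[OF p gh],
       where r="\<lambda>n. LUnit C (M n \<otimes> (N n \<otimes> P n)) \<Zcomp> AssocI C (M n) (N n) (P n) \<Zcomp> RUnitI ((M n \<otimes> N n) \<otimes> P n)"])
    subgoal by (rule Seq_Hom[OF Seq_Hom[OF struct_Hom(4) struct_Hom(3)] struct_Hom(7)])
    subgoal
      by (rule evals_unique[where p="PU"
        and \<sigma>="[(i, PU, PW 0 (M 0)), (j, PU, PW 1 (N 0)), (k, PU, PW 2 (P 0))]"],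
        (rule evals_rules | (simp add: D; fail))+)
    subgoal for n
      by (rule evals_unique[where p="PT (PT PU (PT (PW 0 (M n)) (PT (PW 1 (N n)) (PW 2 (P n)))))
        (PT (PT (PW 3 (X n)) (PW 4 (Y n))) (PW 5 (Z n)))"
         and \<sigma>="[(a n, PT (PW 0 (M n)) (PW 3 (X n)), PT (PW 6 (M (Suc n))) (PW 7 (X' n))),
          (b n, PT (PW 1 (N n)) (PW 4 (Y n)), PT (PW 8 (N (Suc n))) (PW 9 (Y' n))),
          (c n, PT (PW 2 (P n)) (PW 5 (Z n)), PT (PW 10 (P (Suc n))) (PW 11 (Z' n)))]"],
        (rule evals_rules | (simp add: D; fail))+)
    done
qed

lemma STREAM_LUnit_natural:
  assumes "F \<in> shom X Y"
  shows "sseq (stens (side (\<lambda>n. \<one>)) F) (LUnit (STREAM C) Y) = sseq (LUnit (STREAM C) X) F"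
proof -
  obtain M i a where f: "machine X Y M i a" and F: "F = marrow X Y M i a"
    using marrow_cases[OF assms(1)] by blast
  note D = machineD[OF f]
  note e = machine_pure[of "\<lambda>n. Ide C \<one>" "\<lambda>n. \<one>" "\<lambda>n. \<one>", OF struct_Hom(1)]
  note p = machine_pure[of "\<lambda>n. LUnit C (X n)" "\<lambda>n. \<one> \<otimes> X n" X, OF struct_Hom(4)]
  note p' = machine_pure[of "\<lambda>n. LUnit C (Y n)" "\<lambda>n. \<one> \<otimes> Y n" Y, OF struct_Hom(4)]
  show ?thesis unfolding F STREAM_struct pure_arrow_marrow STREAM_Tens[OF e f]
    STREAM_Seq[OF machine_tens[OF e f] p'] STREAM_Seq[OF p f]
    apply (rule marrow_eqI[OF machine_seq[OF machine_tens[OF e f] p'] machine_seq[OF p f],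
      where r="\<lambda>n. RUnitI (\<one> \<otimes> M n)"])
    subgoal by simp
    subgoal
      by (rule evals_unique[where p="PU" and \<sigma>="[(i, PU, PW 0 (M 0))]"],
        (rule evals_rules | (simp add: D; fail))+)
    subgoal for n
      by (rule evals_unique[where p="PT (PT PU (PW 0 (M n))) (PT PU (PW 1 (X n)))"
         and \<sigma>="[(a n, PT (PW 0 (M n)) (PW 1 (X n)), PT (PW 2 (M (Suc n))) (PW 3 (Y n)))]"],
        (rule evals_rules | (simp add: D; fail))+)
    done
qed

lemma STREAM_RUnit_natural:
  assumes "F \<in> shom X Y"
  shows "sseq (stens F (side (\<lambda>n. \<one>))) (RUnit (STREAM C) Y) = sseq (RUnit (STREAM C) X) F"
proof -
  obtain M i a where f: "machine X Y M i a" and F: "F = marrow X Y M i a"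
    using marrow_cases[OF assms(1)] by blast
  note D = machineD[OF f]
  note e = machine_pure[of "\<lambda>n. Ide C \<one>" "\<lambda>n. \<one>" "\<lambda>n. \<one>", OF struct_Hom(1)]
  note p = machine_pure[of "\<lambda>n. RUnit C (X n)" "\<lambda>n. X n \<otimes> \<one>" X, OF struct_Hom(6)]
  note p' = machine_pure[of "\<lambda>n. RUnit C (Y n)" "\<lambda>n. Y n \<otimes> \<one>" Y, OF struct_Hom(6)]
  show ?thesis unfolding F STREAM_struct pure_arrow_marrow STREAM_Tens[OF f e]
    STREAM_Seq[OF machine_tens[OF f e] p'] STREAM_Seq[OF p f]
    apply (rule marrow_eqI[OF machine_seq[OF machine_tens[OF f e] p'] machine_seq[OF p f],
      where r="\<lambda>n. LUnit C (M n) \<Zcomp> RUnitI (M n) \<Zcomp> RUnitI (M n \<otimes> \<one>)"])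
    subgoal by (rule Seq_Hom[OF Seq_Hom[OF struct_Hom(4) struct_Hom(7)] struct_Hom(7)])
    subgoal
      by (rule evals_unique[where p="PU" and \<sigma>="[(i, PU, PW 0 (M 0))]"],
        (rule evals_rules | (simp add: D; fail))+)
    subgoal for n
      by (rule evals_unique[where p="PT (PT PU (PW 0 (M n))) (PT (PW 1 (X n)) PU)"
         and \<sigma>="[(a n, PT (PW 0 (M n)) (PW 1 (X n)), PT (PW 2 (M (Suc n))) (PW 3 (Y n)))]"],
        (rule evals_rules | (simp add: D; fail))+)
    done
qed

text \<open>Exchanging the tensor factors also exchanges their memories, so \<open>r\<close>
  contains \<open>Sym\<close>, and the two sides perform \<open>a\<close> and \<open>b\<close> in
  opposite orders.\<close>

lemma STREAM_Sym_natural: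
  assumes "F \<in> shom X X'" "G \<in> shom Y Y'"
  shows "sseq (stens F G) (Sym (STREAM C) X' Y') = sseq (Sym (STREAM C) X Y) (stens G F)"
proof -
  obtain M i a where f: "machine X X' M i a" and F: "F = marrow X X' M i a"
    using marrow_cases[OF assms(1)] by blast
  obtain N j b where g: "machine Y Y' N j b" and G: "G = marrow Y Y' N j b"
    using marrow_cases[OF assms(2)] by blast
  note D = machineD[OF f] machineD[OF g]
  note p = machine_pure[of "\<lambda>n. Sym C (X n) (Y n)" "\<lambda>n. X n \<otimes> Y n" "\<lambda>n. Y n \<otimes> X n", OF struct_Hom(8)]
  note p' = machine_pure[of "\<lambda>n. Sym C (X' n) (Y' n)" "\<lambda>n. X' n \<otimes> Y' n" "\<lambda>n. Y' n \<otimes> X' n", OF struct_Hom(8)]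
  note fg = machine_tens[OF f g] and gf = machine_tens[OF g f]
  show ?thesis unfolding F G STREAM_Tens[OF f g] STREAM_Tens[OF g f] STREAM_Sym pure_arrow_marrow
    STREAM_Seq[OF fg p'] STREAM_Seq[OF p gf]
    apply (rule marrow_eqI[OF machine_seq[OF fg p'] machine_seq[OF p gf],
       where r="\<lambda>n. LUnit C (N n \<otimes> M n) \<Zcomp> Sym C (N n) (M n) \<Zcomp> RUnitI (M n \<otimes> N n)"])
    subgoal by (rule Seq_Hom[OF Seq_Hom[OF struct_Hom(4) struct_Hom(8)] struct_Hom(7)])
    subgoal
      by (rule evals_unique_swap[where p="PU" and \<sigma>="[]" and a="(j, PU, PW 0 (N 0))"
        and b="(i, PU, PW 1 (M 0))" and \<tau>="[]", unfolded append.simps],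
        (rule evals_rules | (simp add: D; fail))+)
    subgoal for n
      by (rule evals_unique_swap[where p="PT (PT PU (PT (PW 0 (N n)) (PW 1 (M n))))
        (PT (PW 2 (X n)) (PW 3 (Y n)))" and \<sigma>="[]"
         and a="(a n, PT (PW 1 (M n)) (PW 2 (X n)), PT (PW 4 (M (Suc n))) (PW 5 (X' n)))"
         and b="(b n, PT (PW 0 (N n)) (PW 3 (Y n)), PT (PW 6 (N (Suc n))) (PW 7 (Y' n)))"
           and \<tau>="[]", unfolded append.simps],
        (rule evals_rules | (simp add: D; fail))+)
    done
qed

lemma STREAM_symmetric_monoidal_category: "symmetric_monoidal_category (STREAM C)"
proof (unfold_locales, goal_cases)
  case 1 show ?case unfolding STREAM_Ide by (rule pure_arrow_Hom) simp
next
  case 2 then show ?case by (rule STREAM_Seq_Hom)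
next
  case 3 then show ?case by (rule STREAM_Ide_Seq)
next
  case 4 then show ?case by (rule STREAM_Seq_Ide)
next
  case 5 then show ?case by (rule STREAM_Seq_assoc)
next
  case 6 then show ?case unfolding STREAM_TensO by (rule STREAM_Tens_Hom)
next
  case 7 show ?case unfolding STREAM_Ide by (subst pure_Tens) (simp_all add: Tens_Ide)
next
  case 8 then show ?case by (rule STREAM_Tens_Seq)
next
  case (9 X Y Z)
  show ?case unfolding iso_arrow_def STREAM_Assoc STREAM_TensO
    using pure_iso[of "\<lambda>n. (X n \<otimes> Y n) \<otimes> Z n" "\<lambda>n. X n \<otimes> (Y n \<otimes> Z n)", OF AssocI_inverse] by blast
next
  case (10 X)
  show ?case unfolding iso_arrow_def STREAM_LUnit STREAM_TensO STREAM_Unit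
    using pure_iso[of "\<lambda>n. \<one> \<otimes> X n" X, OF LUnitI_inverse] by blast
next
  case (11 X)
  show ?case unfolding iso_arrow_def STREAM_RUnit STREAM_TensO STREAM_Unit
    using pure_iso[of "\<lambda>n. X n \<otimes> \<one>" X, OF RUnitI_inverse] by blast
next
  case 12 show ?case unfolding STREAM_Sym STREAM_TensO by (rule pure_arrow_Hom) simp
next
  case 13 then show ?case by (rule STREAM_Assoc_natural)
next
  case 14 then show ?case unfolding STREAM_Unit by (rule STREAM_LUnit_natural)
next
  case 15 then show ?case unfolding STREAM_Unit by (rule STREAM_RUnit_natural)
next
  case 16 then show ?case by (rule STREAM_Sym_natural)
next
  case (17 W X Y Z)
  \<comment> \<open>The typing of the inner composite is given explicitly, since the middle object
    of \<open>Seq_Hom\<close> occurs only in its premises and is not found by rewriting.\<close>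
  have "\<And>n. (Assoc C (W n) (X n) (Y n) \<otimes>\<^sub>a Ide C (Z n)) \<Zcomp> Assoc C (W n) (X n \<otimes> Y n) (Z n)
      \<in> Hom C (((W n \<otimes> X n) \<otimes> Y n) \<otimes> Z n) (W n \<otimes> ((X n \<otimes> Y n) \<otimes> Z n))"
    by (rule Seq_Hom[OF Tens_Hom[OF struct_Hom(2,1)] struct_Hom(2)])
  then show ?case unfolding STREAM_struct STREAM_TensO
    by (simp add: pure_Seq pure_Tens Seq_Hom Tens_Hom pentagon)
next
  case (18 X Y) show ?case unfolding STREAM_struct STREAM_TensO STREAM_Unit
    by (simp add: pure_Seq pure_Tens Seq_Hom Tens_Hom triangle)
next
  case (19 X Y Z)
  have "\<And>n. (Sym C (X n) (Y n) \<otimes>\<^sub>a Ide C (Z n)) \<Zcomp> Assoc C (Y n) (X n) (Z n)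
      \<in> Hom C ((X n \<otimes> Y n) \<otimes> Z n) (Y n \<otimes> (X n \<otimes> Z n))"
    and "\<And>n. Assoc C (X n) (Y n) (Z n) \<Zcomp> Sym C (X n) (Y n \<otimes> Z n)
      \<in> Hom C ((X n \<otimes> Y n) \<otimes> Z n) ((Y n \<otimes> Z n) \<otimes> X n)"
    by (rule Seq_Hom[OF Tens_Hom[OF struct_Hom(8,1)] struct_Hom(2)], rule Seq_Hom[OF struct_Hom(2,8)])
  then show ?case unfolding STREAM_struct STREAM_TensO
    by (simp add: pure_Seq pure_Tens Seq_Hom Tens_Hom hexagon)
next
  case (20 X Y) show ?case unfolding STREAM_struct STREAM_TensO
    by (simp add: pure_Seq pure_Tens Seq_Hom Tens_Hom Sym_Sym)
qed

section \<open>Delay and feedback\<close>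
lemma delay_Hom:
  assumes "F \<in> shom X Y" shows "delay C F \<in> shom (delay_obj C X) (delay_obj C Y)"
  using assms
proof (rule marrow_cases)
  fix M i a assume f: "machine X Y M i a" and F: "F = marrow X Y M i a"
  show ?thesis unfolding F delay_marrow[OF f] by (rule marrow_Hom[OF machine_delay[OF f]])
qed

lemma delay_Ide: "delay C (side X) = side (delay_obj C X)"
proof -
  have "case_nat (Ide C \<one>) (\<lambda>n. Ide C (X n)) = (\<lambda>n. Ide C (delay_obj C X n))"
    by (auto simp: delay_obj_def split: nat.split)
  then show ?thesis unfolding STREAM_Ide by (simp add: pure_delay)
qed

text \<open>Initially the delayed composite has one trivial memory and the composite of delays has
  two; afterwards the memories coincide. Thus \<open>r\<close> is a unitor at time 0 and an identity
  later, and the squares split accordingly.\<close>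

lemma delay_Seq:
  assumes "F \<in> shom X Y" "G \<in> shom Y Z"
  shows "delay C (sseq F G) = sseq (delay C F) (delay C G)"
proof -
  obtain M i a where f: "machine X Y M i a" and F: "F = marrow X Y M i a"
    using marrow_cases[OF assms(1)] by blast
  obtain N j b where g: "machine Y Z N j b" and G: "G = marrow Y Z N j b"
    using marrow_cases[OF assms(2)] by blast
  note D = machineD[OF f] machineD[OF g]
  note fg = machine_delay[OF machine_seq[OF f g]] and gf =
    machine_seq[OF machine_delay[OF f] machine_delay[OF g]]
  have zero: "(LUnit C \<one> \<otimes>\<^sub>a Ide C \<one>) \<Zcomp> ((LUnitI C \<one> \<Zcomp> (i \<otimes>\<^sub>a j)) \<otimes>\<^sub>a Ide C \<one>)
     = seq_act \<one> \<one> \<one> \<one> \<one> (M 0) (N 0) (i \<otimes>\<^sub>a Ide C \<one>) (j \<otimes>\<^sub>a Ide C \<one>) \<Zcomp> (Ide C (M 0 \<otimes> N 0) \<otimes>\<^sub>a Ide C \<one>)"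
    by (rule evals_unique[where p="PT (PT PU PU) PU" and \<sigma>="[(i, PU, PW 0 (M 0)), (j, PU, PW 1 (N 0))]"],
        (rule evals_rules | (simp add: D; fail))+)
  have suc: "(Ide C (M k \<otimes> N k) \<otimes>\<^sub>a Ide C (X k)) \<Zcomp> seq_act (M k) (N k) (X k) (Y k) (Z k) (M (Suc k))
    (N (Suc k)) (a k) (b k)
     = seq_act (M k) (N k) (X k) (Y k) (Z k) (M (Suc k)) (N (Suc k)) (a k) (b k) \<Zcomp>
       (Ide C (M (Suc k) \<otimes> N (Suc k)) \<otimes>\<^sub>a Ide C (Z k))" for k
    unfolding Tens_Ide using seq_act_Hom[OF D(3) D(6), of k] Ide_Seq Seq_Ide by metis
  show ?thesis unfolding F G STREAM_Seq[OF f g] delay_marrow[OF f] delay_marrow[OF g]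
    delay_marrow[OF machine_seq[OF f g]]
       STREAM_Seq[OF machine_delay[OF f] machine_delay[OF g]]
    apply (rule marrow_eqI[OF fg gf, where r="case_nat (LUnit C \<one>) (\<lambda>k. Ide C (M k \<otimes> N k))"])
    subgoal by (simp split: nat.split)
    subgoal unfolding nat.case
      by (rule evals_unique[where p="PU" and \<sigma>="[]"], (rule evals_rules | (simp; fail))+)
    subgoal for n using zero suc by (cases n) simp_all
    done
qed

section \<open>The structure arrows of the delay functor\<close>

definition delay_mu_inv where "delay_mu_inv S T n = (case n of 0 \<Rightarrow> LUnitI C \<one> | Suc k \<Rightarrow> Ide C (S k \<otimes> T k))"

lemma delay_mu_inv_simps: "delay_mu_inv S T 0 = LUnitI C \<one>" "delay_mu_inv S T (Suc n) = Ide C (S n \<otimes> T n)"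
  by (simp_all add: delay_mu_inv_def)

text \<open>With a typing that is uniform in \<open>n\<close>, the family can serve as one opaque
  action in a square, which spares \<open>feedback_joining\<close> a case distinction.\<close>

lemma delay_mu_inv_Hom: "delay_mu_inv S T n \<in> Hom C (delay_obj C (S \<otimes>\<^sub>s T) n)
  (delay_obj C S n \<otimes> delay_obj C T n)"
  by (cases n) (simp_all add: delay_mu_inv_def)

definition delay_mu_act where "delay_mu_act S T n = (case n of 0 \<Rightarrow> LUnit C \<one> | Suc k \<Rightarrow> Ide C (S k \<otimes> T k))"

lemma delay_mu_act_simps: "delay_mu_act S T 0 = LUnit C \<one>" "delay_mu_act S T (Suc n) = Ide C (S n \<otimes> T n)"
  by (simp_all add: delay_mu_act_def)

lemma delay_mu_act_Hom: "delay_mu_act S T n \<in> Hom C (delay_obj C S n \<otimes> delay_obj C T n)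
  (delay_obj C (S \<otimes>\<^sub>s T) n)"
  by (cases n) (simp_all add: delay_mu_act_def)

lemma delay_mu_pure: "delay_mu C X Y = pure_arrow C (\<lambda>n. delay_obj C X n \<otimes> delay_obj C Y n)
  (delay_obj C (X \<otimes>\<^sub>s Y)) (delay_mu_act X Y)"
  unfolding delay_mu_def delay_mu_act_def ..

lemma delay_mu_inverse:
  "inverse_arrows (STREAM C) (\<lambda>n. delay_obj C X n \<otimes> delay_obj C Y n) (delay_obj C (X \<otimes>\<^sub>s Y))
    (delay_mu C X Y) (pure_arrow C (delay_obj C (X \<otimes>\<^sub>s Y)) (\<lambda>n. delay_obj C X n \<otimes> delay_obj C Y n)
      (delay_mu_inv X Y))"
  unfolding delay_mu_pure
proof (rule pure_iso)
  show "inverse_arrows C (delay_obj C X n \<otimes> delay_obj C Y n) (delay_obj C (X \<otimes>\<^sub>s Y) n)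
     (delay_mu_act X Y n) (delay_mu_inv X Y n)" for n
    using LUnitI_inverse[of \<one>] Ide_Seq[OF Ide_Hom] by (cases n)
      (simp_all add: inverse_arrows_def delay_mu_inv_def delay_mu_act_def)
qed

lemma delay_obj_unit: "delay_obj C (\<lambda>n. \<one>) = (\<lambda>n. \<one>)"
  by (auto simp: delay_obj_def split: nat.split)

lemma delay_eps_Ide: "delay_eps C = side (\<lambda>n. \<one>)"
  by (simp add: delay_eps_def delay_obj_unit STREAM_Ide)

text \<open>At time 0 the tensor of delays has two trivial memories where the delayed tensor has
  one, so \<open>r\<close> splits a unit there. Later the memories differ only in the position of
  the unit contributed by the pure arrow.\<close>

lemma delay_mu_natural:
  assumes "F \<in> shom X X'" "G \<in> shom Y Y'"
  shows "sseq (stens (delay C F) (delay C G)) (delay_mu C X' Y') =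
    sseq (delay_mu C X Y) (delay C (stens F G))"
proof -
  obtain M i a where f: "machine X X' M i a" and F: "F = marrow X X' M i a"
    using marrow_cases[OF assms(1)] by blast
  obtain N j b where g: "machine Y Y' N j b" and G: "G = marrow Y Y' N j b"
    using marrow_cases[OF assms(2)] by blast
  note D = machineD[OF f] machineD[OF g]
  note p = machine_pure[of "delay_mu_act X Y" "\<lambda>n. delay_obj C X n \<otimes> delay_obj C Y n"
    "delay_obj C (X \<otimes>\<^sub>s Y)", OF delay_mu_act_Hom]
  note p' = machine_pure[of "delay_mu_act X' Y'" "\<lambda>n. delay_obj C X' n \<otimes> delay_obj C Y' n"
    "delay_obj C (X' \<otimes>\<^sub>s Y')", OF delay_mu_act_Hom]
  note df = machine_delay[OF f] and dg = machine_delay[OF g] and fg = machine_tens[OF f g]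
  note dfg = machine_delay[OF fg] and tdf = machine_tens[OF df dg]
  have zero: "((LUnit C \<one> \<Zcomp> LUnitI C \<one> \<Zcomp> RUnitI (\<one> \<otimes> \<one>)) \<otimes>\<^sub>a Ide C (\<one> \<otimes> \<one>))
     \<Zcomp> seq_act (\<one> \<otimes> \<one>) \<one> (\<one> \<otimes> \<one>) (\<one> \<otimes> \<one>) \<one> (M 0 \<otimes> N 0) \<one>
       (tens_act \<one> \<one> \<one> \<one> \<one> \<one> (M 0) (N 0) (i \<otimes>\<^sub>a Ide C \<one>) (j \<otimes>\<^sub>a Ide C \<one>)) (Ide C \<one> \<otimes>\<^sub>a LUnit C \<one>) =
    seq_act \<one> \<one> (\<one> \<otimes> \<one>) \<one> \<one> \<one> (M 0 \<otimes> N 0) (Ide C \<one> \<otimes>\<^sub>a LUnit C \<one>) ((LUnitI C \<one> \<Zcomp> (i \<otimes>\<^sub>a j)) \<otimes>\<^sub>a Ide C \<one>)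
      \<Zcomp> ((LUnit C (M 0 \<otimes> N 0) \<Zcomp> RUnitI (M 0 \<otimes> N 0)) \<otimes>\<^sub>a Ide C \<one>)"
    by (rule evals_unique[where p="PT (PT PU PU) (PT PU PU)"
      and \<sigma>="[(i, PU, PW 0 (M 0)), (j, PU, PW 1 (N 0))]"],
        (rule evals_rules | (simp add: D; fail))+)
  have suc: "((LUnit C (M k \<otimes> N k) \<Zcomp> RUnitI (M k \<otimes> N k)) \<otimes>\<^sub>a Ide C (X k \<otimes> Y k))
      \<Zcomp> seq_act (M k \<otimes> N k) \<one> (X k \<otimes> Y k) (X' k \<otimes> Y' k) (X' k \<otimes> Y' k) (M (Suc k) \<otimes> N (Suc k)) \<one>
       (tens_act (M k) (N k) (X k) (X' k) (Y k) (Y' k) (M (Suc k)) (N (Suc k)) (a k) (b k))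
         (Ide C \<one> \<otimes>\<^sub>a Ide C (X' k \<otimes> Y' k)) =
     seq_act \<one> (M k \<otimes> N k) (X k \<otimes> Y k) (X k \<otimes> Y k) (X' k \<otimes> Y' k) \<one> (M (Suc k) \<otimes> N (Suc k))
       (Ide C \<one> \<otimes>\<^sub>a Ide C (X k \<otimes> Y k))
        (tens_act (M k) (N k) (X k) (X' k) (Y k) (Y' k) (M (Suc k)) (N (Suc k)) (a k) (b k))
      \<Zcomp> ((LUnit C (M (Suc k) \<otimes> N (Suc k)) \<Zcomp> RUnitI (M (Suc k) \<otimes> N (Suc k))) \<otimes>\<^sub>a Ide C (X' k \<otimes> Y' k))" for k
    by (rule evals_unique[where p="PT (PT PU (PT (PW 0 (M k)) (PW 1 (N k)))) (PT (PW 2 (X k)) (PW 3 (Y k)))"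
        and \<sigma>="[(a k, PT (PW 0 (M k)) (PW 2 (X k)), PT (PW 4 (M (Suc k))) (PW 5 (X' k))),
         (b k, PT (PW 1 (N k)) (PW 3 (Y k)), PT (PW 6 (N (Suc k))) (PW 7 (Y' k)))]"],
        (rule evals_rules | (simp add: D; fail))+)
  show ?thesis unfolding F G delay_mu_pure pure_arrow_marrow delay_marrow[OF f] delay_marrow[OF g]
    STREAM_Tens[OF f g] delay_marrow[OF fg]
      STREAM_Tens[OF df dg] STREAM_Seq[OF tdf p'] STREAM_Seq[OF p dfg]
    apply (rule marrow_eqI[OF machine_seq[OF tdf p'] machine_seq[OF p dfg],
      where r="case_nat (LUnit C \<one> \<Zcomp> LUnitI C \<one> \<Zcomp> RUnitI (\<one> \<otimes> \<one>))
        (\<lambda>k. LUnit C (M k \<otimes> N k) \<Zcomp> RUnitI (M k \<otimes> N k))"])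
    subgoal for n using Seq_Hom[OF struct_Hom(4,7)]
      Seq_Hom[OF Seq_Hom[OF struct_Hom(4,5)] struct_Hom(7)] by (simp split: nat.split)
    subgoal unfolding nat.case
      by (rule evals_unique[where p="PU" and \<sigma>="[]"], (rule evals_rules | (simp; fail))+)
    subgoal for n using zero suc by (cases n) (simp_all add: delay_mu_act_simps)
    done
qed

lemma delay_act_Hom:
  "(\<And>n. \<phi> n \<in> Hom C (X n) (Y n)) \<Longrightarrow> case_nat (Ide C \<one>) \<phi> n \<in> Hom C (delay_obj C X n) (delay_obj C Y n)"
  by (cases n) simp_all

text \<open>All arrows are pure, so the law reduces to an equation at each time: coherence among
  units at time 0, and later an equation in which all components of \<open>delay_mu\<close> are
  identities.\<close>

lemma delay_mu_Assoc:
  "sseq (sseq (stens (delay_mu C X Y) (side (delay_obj C Z))) (delay_mu C (X \<otimes>\<^sub>s Y) Z))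
      (delay C (Assoc (STREAM C) X Y Z)) =
   sseq (sseq (Assoc (STREAM C) (delay_obj C X) (delay_obj C Y) (delay_obj C Z))
      (stens (side (delay_obj C X)) (delay_mu C Y Z))) (delay_mu C X (Y \<otimes>\<^sub>s Z))"
proof -
  let ?a = "case_nat (Ide C \<one>) (\<lambda>n. Assoc C (X n) (Y n) (Z n))"
  note d = delay_act_Hom[of "\<lambda>n. Assoc C (X n) (Y n) (Z n)" "\<lambda>n. (X n \<otimes> Y n) \<otimes> Z n"
    "\<lambda>n. X n \<otimes> (Y n \<otimes> Z n)", OF struct_Hom(2)]
  note c1 = Seq_Hom[OF Tens_Hom[OF delay_mu_act_Hom Ide_Hom] delay_mu_act_Hom]
  note c2 = Seq_Hom[OF struct_Hom(2) Tens_Hom[OF Ide_Hom delay_mu_act_Hom]]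
  have "((delay_mu_act X Y n \<otimes>\<^sub>a Ide C (delay_obj C Z n)) \<Zcomp> delay_mu_act (X \<otimes>\<^sub>s Y) Z n) \<Zcomp> ?a n =
    (Assoc C (delay_obj C X n) (delay_obj C Y n) (delay_obj C Z n) \<Zcomp>
      (Ide C (delay_obj C X n) \<otimes>\<^sub>a delay_mu_act Y Z n)) \<Zcomp> delay_mu_act X (Y \<otimes>\<^sub>s Z) n" for n
  proof (cases n)
    case 0
    show ?thesis unfolding 0 delay_mu_act_def delay_obj_simps nat.case
      by (rule evals_unique[where p="PT (PT PU PU) PU" and \<sigma>="[]"], (rule evals_rules | (simp; fail))+)
  next
    case (Suc k)
    show ?thesis unfolding Suc delay_mu_act_def delay_obj_simps nat.case
      by (rule evals_unique[where p="PT (PT (PW 0 (X k)) (PW 1 (Y k))) (PW 2 (Z k))" and \<sigma>="[]"],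
        (rule evals_rules | (simp; fail))+)
  qed
  then show ?thesis unfolding delay_mu_pure STREAM_struct
    pure_delay[of "\<lambda>n. Assoc C (X n) (Y n) (Z n)" "\<lambda>n. (X n \<otimes> Y n) \<otimes> Z n" "\<lambda>n. X n \<otimes> (Y n \<otimes> Z n)",
      OF struct_Hom(2)]
    by (simp add: pure_Tens pure_Seq delay_mu_act_Hom Tens_Hom c1 c2 d)
qed

lemma delay_mu_LUnit:
  "sseq (sseq (stens (delay_eps C) (side (delay_obj C X))) (delay_mu C (\<lambda>n. \<one>) X))
      (delay C (LUnit (STREAM C) X)) = LUnit (STREAM C) (delay_obj C X)"
proof -
  let ?a = "case_nat (Ide C \<one>) (\<lambda>n. LUnit C (X n))"
  note m = delay_mu_act_Hom[of "\<lambda>n. \<one>" X, unfolded delay_obj_unit]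
  have "(Ide C (\<one> \<otimes> delay_obj C X n) \<Zcomp> delay_mu_act (\<lambda>n. \<one>) X n) \<Zcomp> ?a n = LUnit C (delay_obj C X n)" for n
    using Ide_Seq[OF m] Ide_Seq[OF Ide_Hom] Seq_Ide[OF struct_Hom(4)] Ide_Seq[OF struct_Hom(4)]
      by (cases n) (simp_all add: delay_mu_act_def)
  then show ?thesis unfolding delay_mu_pure delay_eps_Ide STREAM_struct
    pure_delay[of "\<lambda>n. LUnit C (X n)" "\<lambda>n. \<one> \<otimes> X n" X, OF struct_Hom(4)]
    using m delay_act_Hom[of "\<lambda>n. LUnit C (X n)" "\<lambda>n. \<one> \<otimes> X n" X, OF struct_Hom(4)]
      Seq_Hom[OF struct_Hom(1) m]
    by (simp add: pure_Tens pure_Seq Tens_Ide delay_obj_unit)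
qed

lemma delay_mu_RUnit:
  "sseq (sseq (stens (side (delay_obj C X)) (delay_eps C)) (delay_mu C X (\<lambda>n. \<one>)))
      (delay C (RUnit (STREAM C) X)) = RUnit (STREAM C) (delay_obj C X)"
proof -
  let ?a = "case_nat (Ide C \<one>) (\<lambda>n. RUnit C (X n))"
  note m = delay_mu_act_Hom[of X "\<lambda>n. \<one>", unfolded delay_obj_unit]
  \<comment> \<open>At time 0 \<open>delay_mu\<close> is a left unitor, whereas the law asks for a
    right one.\<close>
  have "LUnit C \<one> = RUnit C \<one>"
    by (rule evals_unique[where p="PT PU PU" and \<sigma>="[]"], (rule evals_rules | (simp; fail))+)
  then have "(Ide C (delay_obj C X n \<otimes> \<one>) \<Zcomp> delay_mu_act X (\<lambda>n. \<one>) n) \<Zcomp> ?a n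
    = RUnit C (delay_obj C X n)" for n
    using Ide_Seq[OF m] Ide_Seq[OF Ide_Hom] Seq_Ide[OF struct_Hom(6)] Ide_Seq[OF struct_Hom(6)]
      by (cases n) (simp_all add: delay_mu_act_def)
  then show ?thesis unfolding delay_mu_pure delay_eps_Ide STREAM_struct
    pure_delay[of "\<lambda>n. RUnit C (X n)" "\<lambda>n. X n \<otimes> \<one>" X, OF struct_Hom(6)]
    using m delay_act_Hom[of "\<lambda>n. RUnit C (X n)" "\<lambda>n. X n \<otimes> \<one>" X, OF struct_Hom(6)]
      Seq_Hom[OF struct_Hom(1) m]
    by (simp add: pure_Tens pure_Seq Tens_Ide delay_obj_unit)
qed

lemma delay_mu_Sym:
  "sseq (delay_mu C X Y) (delay C (Sym (STREAM C) X Y))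
    = sseq (Sym (STREAM C) (delay_obj C X) (delay_obj C Y)) (delay_mu C Y X)"
proof -
  let ?a = "case_nat (Ide C \<one>) (\<lambda>n. Sym C (X n) (Y n))"
  have "delay_mu_act X Y n \<Zcomp> ?a n = Sym C (delay_obj C X n) (delay_obj C Y n) \<Zcomp> delay_mu_act Y X n" for n
  proof (cases n)
    case 0
    show ?thesis unfolding 0 delay_mu_act_def delay_obj_simps nat.case
      by (rule evals_unique[where p="PT PU PU" and \<sigma>="[]"], (rule evals_rules | (simp; fail))+)
  next
    case (Suc k)
    show ?thesis unfolding Suc delay_mu_act_def delay_obj_simps nat.case
      by (rule evals_unique[where p="PT (PW 0 (X k)) (PW 1 (Y k))" and \<sigma>="[]"],
        (rule evals_rules | (simp; fail))+)
  qed
  then show ?thesis unfolding delay_mu_pure STREAM_struct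
    pure_delay[of "\<lambda>n. Sym C (X n) (Y n)" "\<lambda>n. X n \<otimes> Y n" "\<lambda>n. Y n \<otimes> X n", OF struct_Hom(8)]
    using delay_act_Hom[of "\<lambda>n. Sym C (X n) (Y n)" "\<lambda>n. X n \<otimes> Y n" "\<lambda>n. Y n \<otimes> X n", OF struct_Hom(8)]
    by (simp add: pure_Seq delay_mu_act_Hom)
qed

section \<open>The feedback axioms\<close>

lemma arr_inv_STREAM:
  "inverse_arrows (STREAM C) X Y F G \<Longrightarrow> arr_inv (STREAM C) X Y F = G"
  by (rule symmetric_monoidal_category.arr_inv_eq[OF STREAM_symmetric_monoidal_category])

lemma feedback_Hom:
  assumes "F \<in> shom (fbk_dom S X) (S \<otimes>\<^sub>s Y)" shows "feedback C S X Y F \<in> shom X Y"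
  using assms
proof (rule marrow_cases)
  fix M i a assume f: "machine (fbk_dom S X) (S \<otimes>\<^sub>s Y) M i a" and F: "F
    = marrow (fbk_dom S X) (S \<otimes>\<^sub>s Y) M i a"
  show ?thesis unfolding F feedback_marrow[OF f] by (rule marrow_Hom[OF machine_fbk[OF f]])
qed

lemma feedback_tightening:
  assumes "U \<in> shom X' X" "F \<in> shom (fbk_dom S X) (S \<otimes>\<^sub>s Y)" "V \<in> shom Y Y'"
  shows "sseq (sseq U (feedback C S X Y F)) V =
    feedback C S X' Y' (sseq (sseq (stens (side (delay_obj C S)) U) F)
      (stens (side S) V))"
proof -
  obtain M i a where f: "machine (fbk_dom S X) (S \<otimes>\<^sub>s Y) M i a" and F: "F
    = marrow (fbk_dom S X) (S \<otimes>\<^sub>s Y) M i a"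
    using marrow_cases[OF assms(2)] by blast
  obtain N j b where u: "machine X' X N j b" and U: "U = marrow X' X N j b"
    using marrow_cases[OF assms(1)] by blast
  obtain P k c where v: "machine Y Y' P k c" and V: "V = marrow Y Y' P k c"
    using marrow_cases[OF assms(3)] by blast
  note D = machineD[OF f] machineD[OF u] machineD[OF v]
  note s = machine_pure[of "\<lambda>n. Ide C (S n)" S S, OF Ide_Hom]
  note s' = machine_pure[of "\<lambda>n. Ide C (delay_obj C S n)" "delay_obj C S" "delay_obj C S", OF Ide_Hom]
  note uf = machine_seq[OF u machine_fbk[OF f]]
  note ufv = machine_seq[OF uf v]
  note su = machine_tens[OF s' u] and sv = machine_tens[OF s v]
  note suf = machine_seq[OF su f]
  note sufv = machine_seq[OF suf sv]
  note fb = machine_fbk[OF sufv]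
  \<comment> \<open>On the right-hand side the stored value comes last; \<open>r\<close> moves it
    next to \<open>M n\<close>, where the inner feedback of the left-hand side keeps it, and drops
    the unit memories of the two identities.\<close>
  let ?r = "\<lambda>n. swap_last C (((\<one> \<otimes> N n) \<otimes> M n)) (\<one> \<otimes> P n) (delay_obj C S n) \<Zcomp>
      ((Assoc C (\<one> \<otimes> N n) (M n) (delay_obj C S n) \<Zcomp>
        (LUnit C (N n) \<otimes>\<^sub>a Ide C (M n \<otimes> delay_obj C S n))) \<otimes>\<^sub>a LUnit C (P n))"
  \<comment> \<open>Evaluating \<open>?r\<close> on its own yields its typing through
    \<open>evals_Hom\<close>.\<close>
  have r: "evals (?r n) (PT (PT (PT (PT PU (PW 0 (N n))) (PW 1 (M n))) (PT PU (PW 2 (P n))))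
    (PW 3 (delay_obj C S n))) []
      (PT (PT (PW 0 (N n)) (PT (PW 1 (M n)) (PW 3 (delay_obj C S n)))) (PW 2 (P n))) []" for n
    by (rule evals_rules | (simp; fail))+
  show ?thesis unfolding F U V feedback_marrow[OF f] STREAM_Seq[OF u machine_fbk[OF f]] STREAM_Seq[OF uf v]
      STREAM_Ide pure_arrow_marrow STREAM_Tens[OF s' u] STREAM_Tens[OF s v] STREAM_Seq[OF su f]
        STREAM_Seq[OF suf sv] feedback_marrow[OF sufv]
    apply (rule marrow_eqI[OF ufv fb, where r="?r"])
    subgoal for n using evals_Hom[OF r[of n]] by simp
    subgoal unfolding delay_obj_simps
      by (rule evals_unique[where p="PU"
        and \<sigma>="[(j, PU, PW 0 (N 0)), (i, PU, PW 1 (M 0)), (k, PU, PW 2 (P 0))]"],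
        (rule evals_rules | (simp add: D; fail))+)
    subgoal for n unfolding delay_obj_simps
      by (rule evals_unique[where p="PT
        (PT (PT (PT (PT PU (PW 0 (N n))) (PW 1 (M n))) (PT PU (PW 2 (P n))))
          (PW 3 (delay_obj C S n))) (PW 4 (X' n))"
        and \<sigma>="[(b n, PT (PW 0 (N n)) (PW 4 (X' n)), PT (PW 5 (N (Suc n))) (PW 6 (X n))),
          (a n, PT (PW 1 (M n)) (PT (PW 3 (delay_obj C S n)) (PW 6 (X n))), PT (PW 7 (M (Suc n)))
            (PT (PW 8 (S n)) (PW 9 (Y n)))),
          (c n, PT (PW 2 (P n)) (PW 9 (Y n)), PT (PW 10 (P (Suc n))) (PW 11 (Y' n)))]"],
        (rule evals_rules | (simp add: D; fail))+)
    done
qed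

text \<open>The delayed unit sequence is the unit sequence itself and \<open>delay_eps\<close> is an
  identity, so the arrows in front of \<open>F\<close> reduce to a pure \<open>LUnitI\<close>. The
  trailing unit in both memories is the stored value on one side and the memory of the final unitor
  on the other.\<close>

lemma feedback_vanishing:
  assumes "F \<in> shom (fbk_dom (\<lambda>n. \<one>) X) (\<lambda>n. \<one> \<otimes> Y n)"
  shows "feedback C (\<lambda>n. \<one>) X Y F
    = sseq (sseq (sseq (arr_inv (STREAM C) (\<lambda>n. \<one> \<otimes> X n) X (LUnit (STREAM C) X))
     (stens (delay_eps C) (side X))) F) (LUnit (STREAM C) Y)"
proof -
  obtain M i a where f: "machine (fbk_dom (\<lambda>n. \<one>) X) (\<lambda>n. \<one> \<otimes> Y n) M i a" and F: "F
    = marrow (fbk_dom (\<lambda>n. \<one>) X) (\<lambda>n. \<one> \<otimes> Y n) M i a"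
    using marrow_cases[OF assms] by blast
  have lam: "arr_inv (STREAM C) (\<lambda>n. \<one> \<otimes> X n) X (LUnit (STREAM C) X)
    = pure_arrow C X (\<lambda>n. \<one> \<otimes> X n) (\<lambda>n. LUnitI C (X n))"
    unfolding STREAM_LUnit by (rule arr_inv_STREAM[OF pure_iso]) (rule LUnitI_inverse)
  have f1: "machine (\<lambda>n. \<one> \<otimes> X n) (\<lambda>n. \<one> \<otimes> Y n) M i a" using f by (simp add: delay_obj_unit)
  note D = machineD[OF f1]
  note l = machine_pure[of "\<lambda>n. LUnitI C (X n)" X "\<lambda>n. \<one> \<otimes> X n", OF struct_Hom(5)]
  note l' = machine_pure[of "\<lambda>n. LUnit C (Y n)" "\<lambda>n. \<one> \<otimes> Y n" Y, OF struct_Hom(4)]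
  have pre: "sseq (arr_inv (STREAM C) (\<lambda>n. \<one> \<otimes> X n) X (LUnit (STREAM C) X)) (stens (delay_eps C) (side X))
    = pure_arrow C X (\<lambda>n. \<one> \<otimes> X n) (\<lambda>n. LUnitI C (X n))"
    unfolding lam delay_eps_Ide STREAM_Ide
      by (simp add: pure_Tens pure_Seq Tens_Ide Seq_Ide[OF struct_Hom(5)])
  show ?thesis unfolding pre unfolding F feedback_marrow[OF f]
    unfolding delay_obj_unit STREAM_Seq[OF l f1] STREAM_LUnit pure_arrow_marrow
      STREAM_Seq[OF machine_seq[OF l f1] l']
    apply (rule marrow_eqI[OF machine_fbk[OF f, unfolded delay_obj_unit]
      machine_seq[OF machine_seq[OF l f1] l'], where r="\<lambda>n. LUnit C (M n) \<otimes>\<^sub>a Ide C \<one>"])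
    subgoal by (simp add: Tens_Hom)
    subgoal
      by (rule evals_unique[where p="PU" and \<sigma>="[(i, PU, PW 1 (M 0))]"],
        (rule evals_rules | (simp add: D; fail))+)
    subgoal for n
      by (rule evals_unique[where p="PT (PT (PT PU (PW 1 (M n))) PU) (PW 4 (X n))"
        and \<sigma>="[(a n, PT (PW 1 (M n)) (PT PU (PW 4 (X n))), PT (PW 7 (M (Suc n))) (PT PU (PW 9 (Y n))))]"],
        (rule evals_rules | (simp add: D; fail))+)
    done
qed

text \<open>The single store for \<open>S \<otimes>\<^sub>s T\<close> and the two separate stores
  differ only at time 0, where one unit faces two. \<open>delay_mu_inv\<close> bridges this and
  therefore enters \<open>r\<close>.\<close>

lemma feedback_joining:
  assumes "F \<in> shom (fbk_dom S (fbk_dom T X)) (\<lambda>n. S n \<otimes> (T n \<otimes> Y n))"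
  shows "feedback C T X Y (feedback C S (fbk_dom T X) (T \<otimes>\<^sub>s Y) F) =
    feedback C (S \<otimes>\<^sub>s T) X Y (sseq (sseq (sseq
      (stens (arr_inv (STREAM C) (\<lambda>n. delay_obj C S n \<otimes> delay_obj C T n) (delay_obj C (S \<otimes>\<^sub>s T))
        (delay_mu C S T)) (side X))
      (Assoc (STREAM C) (delay_obj C S) (delay_obj C T) X)) F)
      (arr_inv (STREAM C) (\<lambda>n. (S n \<otimes> T n) \<otimes> Y n) (\<lambda>n. S n \<otimes> (T n \<otimes> Y n)) (Assoc (STREAM C) S T Y)))"
proof -
  let ?ST = "\<lambda>n. S n \<otimes> T n"
  obtain M i a where f: "machine (fbk_dom S (fbk_dom T X)) (\<lambda>n. S n \<otimes> (T n \<otimes> Y n)) M i a"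
    and F: "F = marrow (fbk_dom S (fbk_dom T X)) (\<lambda>n. S n \<otimes> (T n \<otimes> Y n)) M i a"
    using marrow_cases[OF assms] by blast
  note D = machineD[OF f]
  have al: "arr_inv (STREAM C) (\<lambda>n. (S n \<otimes> T n) \<otimes> Y n) (\<lambda>n. S n \<otimes> (T n \<otimes> Y n)) (Assoc (STREAM C) S T Y)
     = pure_arrow C (\<lambda>n. S n \<otimes> (T n \<otimes> Y n)) (\<lambda>n. (S n \<otimes> T n) \<otimes> Y n) (\<lambda>n. AssocI C (S n) (T n) (Y n))"
    unfolding STREAM_Assoc by (rule arr_inv_STREAM[OF pure_iso]) (rule AssocI_inverse)
  let ?\<phi> = "\<lambda>n. (delay_mu_inv S T n \<otimes>\<^sub>a Ide C (X n)) \<Zcomp> Assoc C (delay_obj C S n) (delay_obj C T n) (X n)"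
  have \<phi>: "?\<phi> n \<in> Hom C (fbk_dom ?ST X n) (fbk_dom S (fbk_dom T X) n)" for n
    by (rule Seq_Hom[OF Tens_Hom[OF delay_mu_inv_Hom Ide_Hom] struct_Hom(2)])
  have pre: "sseq (stens (arr_inv (STREAM C) (\<lambda>n. delay_obj C S n \<otimes> delay_obj C T n)
    (delay_obj C ?ST) (delay_mu C S T)) (side X))
      (Assoc (STREAM C) (delay_obj C S) (delay_obj C T) X) = pure_arrow C (fbk_dom ?ST X)
        (fbk_dom S (fbk_dom T X)) ?\<phi>"
    unfolding arr_inv_STREAM[OF delay_mu_inverse] STREAM_Ide STREAM_Assoc
    by (simp add: pure_Tens pure_Seq delay_mu_inv_Hom Tens_Hom)
  note l = machine_pure[of ?\<phi> "fbk_dom ?ST X" "fbk_dom S (fbk_dom T X)", OF \<phi>]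
  note l' = machine_pure[of "\<lambda>n. AssocI C (S n) (T n) (Y n)" "\<lambda>n. S n \<otimes> (T n \<otimes> Y n)"
    "\<lambda>n. (S n \<otimes> T n) \<otimes> Y n", OF struct_Hom(3)]
  note ff = machine_fbk[OF machine_fbk[OF f]]
  note lf = machine_seq[OF l f]
  note lfl = machine_seq[OF lf l']
  let ?r = "\<lambda>n. ((RUnit C (\<one> \<otimes> M n) \<Zcomp> LUnit C (M n)) \<otimes>\<^sub>a delay_mu_inv S T n)
    \<Zcomp> AssocI C (M n) (delay_obj C S n) (delay_obj C T n)"
  show ?thesis unfolding pre al F feedback_marrow[OF f] feedback_marrow[OF machine_fbk[OF f]]
      pure_arrow_marrow STREAM_Seq[OF l f] STREAM_Seq[OF lf l'] feedback_marrow[OF lfl]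
    apply (rule marrow_eqI[OF ff machine_fbk[OF lfl], where r="?r"])
    subgoal for n by (rule Seq_Hom[OF Tens_Hom[OF Seq_Hom[OF struct_Hom(6) struct_Hom(4)]
      delay_mu_inv_Hom] struct_Hom(3)])
    subgoal unfolding delay_obj_simps delay_mu_inv_simps
      by (rule evals_unique[where p="PU" and \<sigma>="[(i, PU, PW 1 (M 0))]"],
        (rule evals_rules | (simp add: D; fail))+)
    \<comment> \<open>The store written at time \<open>n\<close> is read at time
      \<open>Suc n\<close>, where \<open>delay_mu_inv\<close> unfolds to an identity. The occurrence
      at time \<open>n\<close> stays opaque: one side runs it in \<open>r n\<close>, the other in
      the action.\<close>
    subgoal for n unfolding delay_obj_simps delay_mu_inv_simps
      by (rule evals_unique[where p="PT (PT (PT (PT PU (PW 0 (M n))) PU) (PW 1 (delay_obj C ?ST n)))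
        (PW 2 (X n))"
        and \<sigma>="[(delay_mu_inv S T n, PW 1 (delay_obj C ?ST n),
          PT (PW 3 (delay_obj C S n)) (PW 4 (delay_obj C T n))),
          (a n, PT (PW 0 (M n)) (PT (PW 3 (delay_obj C S n))
            (PT (PW 4 (delay_obj C T n)) (PW 2 (X n)))), PT (PW 5 (M (Suc n)))
              (PT (PW 6 (S n)) (PT (PW 7 (T n)) (PW 8 (Y n)))))]"],
        (rule evals_rules | (simp add: D delay_mu_inv_Hom; fail))+)
    done
qed

lemma feedback_strength:
  assumes "F \<in> shom (fbk_dom S X) (S \<otimes>\<^sub>s Y)" "G \<in> shom X' Y'"
  shows "stens (feedback C S X Y F) G = feedback C S (X \<otimes>\<^sub>s X') (Y \<otimes>\<^sub>s Y')
     (sseq (sseq (arr_inv (STREAM C) (\<lambda>n. (delay_obj C S n \<otimes> X n) \<otimes> X' n)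
       (\<lambda>n. delay_obj C S n \<otimes> (X n \<otimes> X' n))
       (Assoc (STREAM C) (delay_obj C S) X X')) (stens F G)) (Assoc (STREAM C) S Y Y'))"
proof -
  obtain M i a where f: "machine (fbk_dom S X) (S \<otimes>\<^sub>s Y) M i a" and F: "F
    = marrow (fbk_dom S X) (S \<otimes>\<^sub>s Y) M i a"
    using marrow_cases[OF assms(1)] by blast
  obtain N j b where g: "machine X' Y' N j b" and G: "G = marrow X' Y' N j b"
    using marrow_cases[OF assms(2)] by blast
  note D = machineD[OF f] machineD[OF g]
  have al: "arr_inv (STREAM C) (\<lambda>n. (delay_obj C S n \<otimes> X n) \<otimes> X' n)
    (\<lambda>n. delay_obj C S n \<otimes> (X n \<otimes> X' n)) (Assoc (STREAM C) (delay_obj C S) X X')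
     = pure_arrow C (\<lambda>n. delay_obj C S n \<otimes> (X n \<otimes> X' n)) (\<lambda>n. (delay_obj C S n \<otimes> X n) \<otimes> X' n)
       (\<lambda>n. AssocI C (delay_obj C S n) (X n) (X' n))"
    unfolding STREAM_Assoc by (rule arr_inv_STREAM[OF pure_iso]) (rule AssocI_inverse)
  note l = machine_pure[of "\<lambda>n. AssocI C (delay_obj C S n) (X n) (X' n)"
    "\<lambda>n. delay_obj C S n \<otimes> (X n \<otimes> X' n)" "\<lambda>n. (delay_obj C S n \<otimes> X n) \<otimes> X' n", OF struct_Hom(3)]
  note l' = machine_pure[of "\<lambda>n. Assoc C (S n) (Y n) (Y' n)" "\<lambda>n. (S n \<otimes> Y n) \<otimes> Y' n"
    "\<lambda>n. S n \<otimes> (Y n \<otimes> Y' n)", OF struct_Hom(2)]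
  note fb = machine_tens[OF machine_fbk[OF f] g]
  note fg = machine_tens[OF f g]
  note lf = machine_seq[OF l fg]
  note lfl = machine_seq[OF lf l']
  \<comment> \<open>Feedback around the tensor stores its value behind both memories, feedback
    inside it directly behind \<open>M n\<close>; \<open>r\<close> moves the value past
    \<open>N n\<close> and drops the two unit memories of the associators.\<close>
  let ?r = "\<lambda>n. ((RUnit C (\<one> \<otimes> (M n \<otimes> N n)) \<Zcomp> LUnit C (M n \<otimes> N n)) \<otimes>\<^sub>a Ide C (delay_obj C S n))
    \<Zcomp> swap_last C (M n) (N n) (delay_obj C S n)"
  have r: "evals (?r n) (PT (PT (PT PU (PT (PW 0 (M n)) (PW 1 (N n)))) PU) (PW 3 (delay_obj C S n))) []
      (PT (PT (PW 0 (M n)) (PW 3 (delay_obj C S n))) (PW 1 (N n))) []" for n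
    by (rule evals_rules | (simp; fail))+
  show ?thesis unfolding al unfolding F G feedback_marrow[OF f] STREAM_Tens[OF machine_fbk[OF f] g]
    STREAM_Assoc
      pure_arrow_marrow STREAM_Tens[OF f g] STREAM_Seq[OF l fg] STREAM_Seq[OF lf l'] feedback_marrow[OF lfl]
    apply (rule marrow_eqI[OF fb machine_fbk[OF lfl], where r="?r"])
    subgoal for n using evals_Hom[OF r[of n]] by simp
    subgoal unfolding delay_obj_simps
      by (rule evals_unique[where p="PU" and \<sigma>="[(i, PU, PW 1 (M 0)), (j, PU, PW 2 (N 0))]"],
        (rule evals_rules | (simp add: D; fail))+)
    subgoal for n unfolding delay_obj_simps
      by (rule evals_unique[where p="PT
        (PT (PT (PT PU (PT (PW 0 (M n)) (PW 1 (N n)))) PU) (PW 2 (delay_obj C S n)))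
          (PT (PW 3 (X n)) (PW 4 (X' n)))"
        and \<sigma>="[(a n, PT (PW 0 (M n)) (PT (PW 2 (delay_obj C S n)) (PW 3 (X n))),
          PT (PW 5 (M (Suc n))) (PT (PW 6 (S n)) (PW 7 (Y n)))),
          (b n, PT (PW 1 (N n)) (PW 4 (X' n)), PT (PW 8 (N (Suc n))) (PW 9 (Y' n)))]"],
        (rule evals_rules | (simp add: D; fail))+)
    done
qed

lemma feedback_sliding:
  assumes "H \<in> shom S T" "F \<in> shom (fbk_dom T X) (S \<otimes>\<^sub>s Y)"
  shows "feedback C S X Y (sseq (stens (delay C H) (side X)) F) =
    feedback C T X Y (sseq F (stens H (side Y)))"
proof -
  obtain M i a where f: "machine (fbk_dom T X) (S \<otimes>\<^sub>s Y) M i a" and F: "F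
    = marrow (fbk_dom T X) (S \<otimes>\<^sub>s Y) M i a"
    using marrow_cases[OF assms(2)] by blast
  obtain N j b where h: "machine S T N j b" and H: "H = marrow S T N j b"
    using marrow_cases[OF assms(1)] by blast
  note D = machineD[OF f] machineD[OF h]
  \<comment> \<open>These are the data of the delayed \<open>h\<close>: \<open>?b n\<close> creates
    the initial state of \<open>h\<close> at time 0 and is action \<open>n - 1\<close> of
    \<open>h\<close> later, so \<open>?N\<close> lags one step behind \<open>N\<close>.\<close>
  let ?N = "case_nat \<one> N" let ?b = "case_nat (j \<otimes>\<^sub>a Ide C \<one>) b"
  have b: "?b n \<in> Hom C (?N n \<otimes> delay_obj C S n) (N n \<otimes> delay_obj C T n)" for n
    using machineD(3)[OF machine_delay[OF h], of n] by simp
  note x = machine_pure[of "\<lambda>n. Ide C (X n)" X X, OF Ide_Hom]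
  note y = machine_pure[of "\<lambda>n. Ide C (Y n)" Y Y, OF Ide_Hom]
  note hx = machine_tens[OF machine_delay[OF h] x] and hy = machine_tens[OF h y]
  note hxf = machine_seq[OF hx f] and fhy = machine_seq[OF f hy]
  \<comment> \<open>Performing \<open>?b n\<close> makes up for this lag: the state passes from
    \<open>?N n\<close> to \<open>N n\<close>, and the stored value from the delayed
    \<open>S\<close> to the delayed \<open>T\<close>.\<close>
  let ?r = "\<lambda>n. ((RUnit C (?N n) \<otimes>\<^sub>a Ide C (M n)) \<otimes>\<^sub>a Ide C (delay_obj C S n))
    \<Zcomp> swap_last C (?N n) (M n) (delay_obj C S n)
     \<Zcomp> (?b n \<otimes>\<^sub>a Ide C (M n)) \<Zcomp> swap_last C (N n) (delay_obj C T n) (M n) \<Zcomp>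
       (Sym C (N n) (M n) \<otimes>\<^sub>a Ide C (delay_obj C T n))
     \<Zcomp> ((Ide C (M n) \<otimes>\<^sub>a RUnitI (N n)) \<otimes>\<^sub>a Ide C (delay_obj C T n))"
  have r: "evals (?r n) (PT (PT (PT (PW 0 (?N n)) PU) (PW 1 (M n))) (PW 2 (delay_obj C S n)))
      [(?b n, PT (PW 0 (?N n)) (PW 2 (delay_obj C S n)), PT (PW 3 (N n)) (PW 4 (delay_obj C T n)))]
      (PT (PT (PW 1 (M n)) (PT (PW 3 (N n)) PU)) (PW 4 (delay_obj C T n))) []" for n
    by (rule evals_rules | (simp add: b; fail))+
  \<comment> \<open>At time 0 there is no value to convert, and \<open>r 0\<close> only creates the
    state \<open>j\<close> with which the other machine starts.\<close>
  have init: "(LUnitI C \<one> \<Zcomp> ((LUnitI C \<one> \<Zcomp> (Ide C \<one> \<otimes>\<^sub>a Ide C \<one>)) \<otimes>\<^sub>a i)) \<Zcomp> RUnitI ((\<one> \<otimes> \<one>) \<otimes> M 0) \<Zcomp>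
     (((RUnit C \<one> \<otimes>\<^sub>a Ide C (M 0)) \<otimes>\<^sub>a Ide C \<one>) \<Zcomp> swap_last C \<one> (M 0) \<one>
     \<Zcomp> ((j \<otimes>\<^sub>a Ide C \<one>) \<otimes>\<^sub>a Ide C (M 0)) \<Zcomp> swap_last C (N 0) \<one> (M 0) \<Zcomp> (Sym C (N 0) (M 0) \<otimes>\<^sub>a Ide C \<one>)
     \<Zcomp> ((Ide C (M 0) \<otimes>\<^sub>a RUnitI (N 0)) \<otimes>\<^sub>a Ide C \<one>)) =
       (LUnitI C \<one> \<Zcomp> (i \<otimes>\<^sub>a (LUnitI C \<one> \<Zcomp> (j \<otimes>\<^sub>a Ide C \<one>)))) \<Zcomp> RUnitI (M 0 \<otimes> (N 0 \<otimes> \<one>))"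
    by (rule evals_unique[where p="PU" and \<sigma>="[(i, PU, PW 1 (M 0)), (j, PU, PW 2 (N 0))]"],
      (rule evals_rules | (simp add: D; fail))+)
  show ?thesis unfolding F H delay_marrow[OF h] STREAM_Ide pure_arrow_marrow
    STREAM_Tens[OF machine_delay[OF h] x] STREAM_Tens[OF h y]
     STREAM_Seq[OF hx f] STREAM_Seq[OF f hy] feedback_marrow[OF hxf] feedback_marrow[OF fhy]
    apply (rule marrow_eqI[OF machine_fbk[OF fhy] machine_fbk[OF hxf], where r="?r", symmetric])
    subgoal for n using evals_Hom[OF r[of n]] by simp
    subgoal using init by simp
    \<comment> \<open>Both sides of the square run \<open>?b n\<close>, \<open>a n\<close> and
      \<open>b n\<close>. On the left \<open>?b n\<close> comes from \<open>r n\<close>; on the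
      right \<open>b n\<close> comes from \<open>r (Suc n)\<close>, because
      \<open>?b (Suc n)\<close> is \<open>b n\<close>.\<close>
    subgoal for n unfolding delay_obj_simps nat.case
      by (rule evals_unique[where p="PT
        (PT (PT (PT (PW 0 (?N n)) PU) (PW 1 (M n))) (PW 2 (delay_obj C S n))) (PW 3 (X n))"
        and \<sigma>="[(?b n, PT (PW 0 (?N n)) (PW 2 (delay_obj C S n)), PT (PW 4 (N n)) (PW 5 (delay_obj C T n))),
          (a n, PT (PW 1 (M n)) (PT (PW 5 (delay_obj C T n)) (PW 3 (X n))), PT (PW 6 (M (Suc n)))
            (PT (PW 7 (S n)) (PW 8 (Y n)))),
          (b n, PT (PW 4 (N n)) (PW 7 (S n)), PT (PW 9 (N (Suc n))) (PW 10 (T n)))]"],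
        (rule evals_rules | (simp add: D b; fail))+)
    done
qed

end

theorem theorem7p26:
  fixes C :: "('o, 'm) smcat"
  assumes "symmetric_monoidal_category C"
    and "productive C"
  shows "feedback_monoidal_category (STREAM C) (delay_obj C) (delay C) (delay_mu C) (delay_eps C)
    (feedback C)"
proof -
  interpret symmetric_monoidal_category C by fact
  interpret S: symmetric_monoidal_category "STREAM C" by (rule STREAM_symmetric_monoidal_category)
  show ?thesis
  proof (unfold_locales, goal_cases)
    case 1 then show ?case by (rule delay_Hom)
  next
    case 2 show ?case by (rule delay_Ide)
  next
    case 3 then show ?case by (rule delay_Seq)
  next
    case 4 show ?case unfolding iso_arrow_def STREAM_TensO using delay_mu_inverse by blast
  next
    case 5
    have "inverse_arrows (STREAM C) (\<lambda>n. \<one>\<^bsub>C\<^esub>) (\<lambda>n. \<one>\<^bsub>C\<^esub>) (delay_eps C) (delay_eps C)"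
      unfolding inverse_arrows_def delay_eps_Ide using S.Ide_Hom S.Ide_Seq[OF S.Ide_Hom] by simp
    then show ?case unfolding iso_arrow_def STREAM_Unit delay_obj_unit by blast
  next
    case 6 then show ?case unfolding STREAM_TensO by (rule delay_mu_natural)
  next
    case 7 show ?case unfolding STREAM_TensO by (rule delay_mu_Assoc)
  next
    case 8 show ?case unfolding STREAM_Unit by (rule delay_mu_LUnit)
  next
    case 9 show ?case unfolding STREAM_Unit by (rule delay_mu_RUnit)
  next
    case 10 show ?case by (rule delay_mu_Sym)
  next
    case (11 F S X Y) then show ?case unfolding STREAM_TensO by (rule feedback_Hom)
  next
    case 12 then show ?case unfolding STREAM_TensO by (rule feedback_tightening)
  next
    case 13 then show ?case unfolding STREAM_TensO STREAM_Unit by (rule feedback_vanishing)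
  next
    case 14 then show ?case unfolding STREAM_TensO by (rule feedback_joining)
  next
    case 15 then show ?case unfolding STREAM_TensO by (rule feedback_strength)
  next
    case 16 then show ?case unfolding STREAM_TensO by (rule feedback_sliding)
  qed
qed
end
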